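(* Let $d \ge 1$ be an integer. For all integers $1 \leq r \leq l$, all $\alpha \in (-1,\infty)$ and all $\gamma \in (-1,\infty)^d$, there exists $C = C(\alpha,\gamma,l,r) > 0$ such that, for every integer $N \geq 1$ and every $u \in \mathrm{H}^l_{\alpha,\gamma}$, $$\left\| u - S^{\alpha,\gamma}_N (u) \right\|_{\alpha,\gamma;r} \leq C \, N^{-1/2 + 2r - l} \, \|u\|_{\alpha,\gamma;l}.$$
   Context: $B^d$ is the open unit ball of $\mathbb{R}^d$ and $\|\cdot\|$ (without subscript, on points) the Euclidean norm. For $\alpha > -1$ and $\gamma = (\gamma_1,\dots,\gamma_d) \in (-1,\infty)^d$, the weight is $W_{\alpha,\gamma}(x) = (1-\|x\|^2)^\alpha \prod_{i=1}^d |x_i|^{\gamma_i}$ on $B^d$. $\mathrm{L}^2_{\alpha,\gamma}$ is the weighted space $\mathrm{L}^2(B^d, W_{\alpha,\gamma})$ with inner product $\langle u,v\rangle_{\alpha,\gamma} = \int_{B^d} u\,v\,W_{\alpha,\gamma}\,dx$ and norm $\|u\|_{\alpha,\gamma} = \langle u,u\rangle_{\alpha,\gamma}^{1/2}$; for tensor-valued functions the same notation denotes the sum of the entrywise inner products. $\Pi^d_N$ is the space of real $d$-variate polynomials of total degree at most $N$, and $S^{\alpha,\gamma}_N$ is the orthogonal projector of $\mathrm{L}^2_{\alpha,\gamma}$ onto $\Pi^d_N$. $\mathrm{C}^m(\overline{B^d})$ is the space of real functions with partial derivatives of order up to $m$ continuous up to the boundary. Let $\sigma_j x := x - 2x_j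 e_j$ be the reflection flipping the sign of the $j$-th coordinate. The Dunkl operators are $$\mathcal{D}^{(\gamma)}_j u(x) := \partial_j u(x) + \frac{\gamma_j}{2}\,\frac{u(x) - u(\sigma_j x)}{x_j}, \qquad j \in \{1,\dots,d\},$$ where for $x_j = 0$ the ratio is interpreted as its limit $2\,\partial_j u(x)$. They map $\mathrm{C}^m(\overline{B^d})$ into $\mathrm{C}^{m-1}(\overline{B^d})$ ($m \ge 1$) and commute. The Dunkl gradient is $\mathcal{D}^{(\gamma)} u = \sum_{j=1}^d \mathcal{D}^{(\gamma)}_j(u)\, e_j$, and $(\mathcal{D}^{(\gamma)})^k u$ is the $k$-fold Dunkl gradient (the $k$-dimensional array of all $\mathcal{D}^{(\gamma)}_{j_1}\cdots\mathcal{D}^{(\gamma)}_{j_k} u$). For an integer $m \ge 0$, $\langle p,q\rangle_{\alpha,\gamma;m} := \sum_{k=0}^m \langle (\mathcal{D}^{(\gamma)})^k p, (\mathcal{D}^{(\gamma)})^k q\rangle_{\alpha,\gamma}$ for $p,q\in \mathrm{C}^m(\overline{B^d})$, with induced norm $\|\cdot\|_{\alpha,\gamma;m}$. The Dunkl–Sobolev space $\mathrm{H}^m_{\alpha,\gamma}$ is the (Hilbert space) completion of $(\mathrm{C}^m(\overline{B^d}), \|\cdot\|_{\alpha,\gamma;m})$, with the extended inner product and norm denoted the same way; functions in $\mathrm{C}^m(\overline{B^d})$ are identified with their images. $\mathrm{H}^0_{\alpha,\gamma} = \mathrm{L}^2_{\alpha,\gamma}$, and for $0 \le r \le l$ elements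 of $\mathrm{H}^l_{\alpha,\gamma}$ are regarded as elements of $\mathrm{H}^r_{\alpha,\gamma}$ through the natural continuous map extending the identity on $\mathrm{C}^l(\overline{B^d})$. *)

theory Defs
  imports "HOL-Analysis.Analysis"
begin

section \<open>Completion of a space with a (semi-definite) inner product\<close>

text \<open>
  The completion of a set \<open>V\<close> of vectors with respect to a positive semi-definite form \<open>ip\<close>,
  realised as Cauchy sequences in \<open>V\<close> modulo sequences tending to zero.  Semi-definiteness is
  allowed because below \<open>V\<close> consists of total HOL functions, which are to be identified when they
  agree on the unit ball; the quotient performs this identification.
\<close>

definition ip_norm :: "('a \<Rightarrow> 'a \<Rightarrow> real) \<Rightarrow> 'a \<Rightarrow> real" where
  "ip_norm ip u = sqrt (ip u u)"

definition cauchy_seqs :: "('a::minus) set \<Rightarrow> ('a \<Rightarrow> 'a \<Rightarrow> real) \<Rightarrow> (nat \<Rightarrow> 'a) set" where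
  "cauchy_seqs V ip =
     {U. (\<forall>n. U n \<in> V) \<and> (\<forall>e>0. \<exists>M. \<forall>i\<ge>M. \<forall>k\<ge>M. ip_norm ip (U i - U k) < e)}"

definition null_rel ::
    "('a::minus) set \<Rightarrow> ('a \<Rightarrow> 'a \<Rightarrow> real) \<Rightarrow> ((nat \<Rightarrow> 'a) \<times> (nat \<Rightarrow> 'a)) set" where
  "null_rel V ip =
     {(U, U'). U \<in> cauchy_seqs V ip \<and> U' \<in> cauchy_seqs V ip \<and>
               (\<lambda>n. ip_norm ip (U n - U' n)) \<longlonglongrightarrow> 0}"

definition completion :: "('a::minus) set \<Rightarrow> ('a \<Rightarrow> 'a \<Rightarrow> real) \<Rightarrow> (nat \<Rightarrow> 'a) set set" where
  "completion V ip = cauchy_seqs V ip // null_rel V ip"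

definition completion_embed ::
    "('a::minus) set \<Rightarrow> ('a \<Rightarrow> 'a \<Rightarrow> real) \<Rightarrow> 'a \<Rightarrow> (nat \<Rightarrow> 'a) set" where
  "completion_embed V ip u = null_rel V ip `` {\<lambda>_. u}"

definition completion_minus ::
    "('a::minus) set \<Rightarrow> ('a \<Rightarrow> 'a \<Rightarrow> real) \<Rightarrow> (nat \<Rightarrow> 'a) set \<Rightarrow> (nat \<Rightarrow> 'a) set \<Rightarrow> (nat \<Rightarrow> 'a) set" where
  "completion_minus V ip A B = null_rel V ip `` {\<lambda>n. U n - U' n | U U'. U \<in> A \<and> U' \<in> B}"

definition completion_ip ::
    "('a \<Rightarrow> 'a \<Rightarrow> real) \<Rightarrow> (nat \<Rightarrow> 'a) set \<Rightarrow> (nat \<Rightarrow> 'a) set \<Rightarrow> real" where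
  "completion_ip ip A B = (THE c. \<forall>U\<in>A. \<forall>U'\<in>B. (\<lambda>n. ip (U n) (U' n)) \<longlonglongrightarrow> c)"


section \<open>Weighted square-integrable functions on the unit ball\<close>

text \<open>
  \<open>0 powr a = 0\<close> in HOL, so the weight may take a non-standard value where some coordinate is \<open>0\<close>;
  these points form a null set and only the resulting measure is used.
\<close>

definition ball_weight :: "real \<Rightarrow> real ^ 'n \<Rightarrow> real ^ 'n \<Rightarrow> real" where
  "ball_weight \<alpha> \<gamma> x = (1 - (norm x)\<^sup>2) powr \<alpha> * (\<Prod>i\<in>UNIV. \<bar>x $ i\<bar> powr (\<gamma> $ i))"

definition ball_measure :: "real \<Rightarrow> real ^ 'n \<Rightarrow> (real ^ 'n) measure" where
  "ball_measure \<alpha> \<gamma> =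
     density (restrict_space lborel (ball 0 1)) (\<lambda>x. ennreal (ball_weight \<alpha> \<gamma> x))"

definition L2_space :: "real \<Rightarrow> real ^ 'n \<Rightarrow> (real ^ 'n \<Rightarrow> real) set" where
  "L2_space \<alpha> \<gamma> = {f \<in> borel_measurable (ball_measure \<alpha> \<gamma>).
                       integrable (ball_measure \<alpha> \<gamma>) (\<lambda>x. (f x)\<^sup>2)}"

definition L2_ip :: "real \<Rightarrow> real ^ 'n \<Rightarrow> (real ^ 'n \<Rightarrow> real) \<Rightarrow> (real ^ 'n \<Rightarrow> real) \<Rightarrow> real" where
  "L2_ip \<alpha> \<gamma> u v = (LINT x|ball_measure \<alpha> \<gamma>. u x * v x)"


section \<open>Polynomials and the orthogonal projector\<close>

definition polys :: "nat \<Rightarrow> (real ^ 'n \<Rightarrow> real) set" where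
  "polys N = range (\<lambda>c :: ('n \<Rightarrow> nat) \<Rightarrow> real.
     \<lambda>x. \<Sum>k\<in>{k. (\<Sum>i\<in>UNIV. k i) \<le> N}. c k * (\<Prod>i\<in>UNIV. (x $ i) ^ k i))"

definition poly_proj ::
    "real \<Rightarrow> real ^ 'n \<Rightarrow> nat \<Rightarrow> (real ^ 'n \<Rightarrow> real) \<Rightarrow> (real ^ 'n \<Rightarrow> real)" where
  "poly_proj \<alpha> \<gamma> N f = (THE p. p \<in> polys N \<and> (\<forall>q\<in>polys N. L2_ip \<alpha> \<gamma> (f - p) q = 0))"


section \<open>Functions of class \<open>C\<^sup>m\<close> up to the boundary, and Dunkl operators\<close>

definition partial_deriv :: "'n \<Rightarrow> (real ^ 'n \<Rightarrow> real) \<Rightarrow> real ^ 'n \<Rightarrow> real" where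
  "partial_deriv j u x = deriv (\<lambda>t. u (x + t *\<^sub>R axis j 1)) 0"

text \<open>
  A function on the closed ball is represented by its values on the open ball; it and its partial
  derivatives are required to extend continuously to the closed ball.  Values of \<open>u\<close> outside the
  open ball are irrelevant.
\<close>

definition cont_upto_boundary :: "(real ^ 'n \<Rightarrow> real) \<Rightarrow> bool" where
  "cont_upto_boundary u \<longleftrightarrow> (\<exists>g. continuous_on (cball 0 1) g \<and> (\<forall>x\<in>ball 0 1. g x = u x))"

primrec C_closed_ball :: "nat \<Rightarrow> (real ^ 'n \<Rightarrow> real) set" where
  "C_closed_ball 0 = {u. cont_upto_boundary u}"
| "C_closed_ball (Suc m) =
     {u. cont_upto_boundary u \<and>
         (\<forall>j. (\<forall>x\<in>ball 0 1. (\<lambda>t. u (x + t *\<^sub>R axis j 1)) field_differentiable (at 0)) \<and>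
              partial_deriv j u \<in> C_closed_ball m)}"

definition reflect :: "'n \<Rightarrow> real ^ 'n \<Rightarrow> real ^ 'n" where
  "reflect j x = x - (2 * x $ j) *\<^sub>R axis j 1"

definition dunkl :: "real ^ 'n \<Rightarrow> 'n \<Rightarrow> (real ^ 'n \<Rightarrow> real) \<Rightarrow> real ^ 'n \<Rightarrow> real" where
  "dunkl \<gamma> j u x = partial_deriv j u x + \<gamma> $ j / 2 *
     (if x $ j = 0 then 2 * partial_deriv j u x else (u x - u (reflect j x)) / x $ j)"

text \<open>
  The entry of the \<open>k\<close>-fold Dunkl gradient with index \<open>[j\<^sub>1, \<dots>, j\<^sub>k]\<close>.
\<close>

definition dunkl_iter :: "real ^ 'n \<Rightarrow> 'n list \<Rightarrow> (real ^ 'n \<Rightarrow> real) \<Rightarrow> real ^ 'n \<Rightarrow> real" where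
  "dunkl_iter \<gamma> js u = foldr (dunkl \<gamma>) js u"


section \<open>Dunkl--Sobolev spaces\<close>

definition sobolev_ip ::
    "real \<Rightarrow> real ^ 'n \<Rightarrow> nat \<Rightarrow> (real ^ 'n \<Rightarrow> real) \<Rightarrow> (real ^ 'n \<Rightarrow> real) \<Rightarrow> real" where
  "sobolev_ip \<alpha> \<gamma> m p q =
     (\<Sum>k\<le>m. \<Sum>js\<in>{js. length js = k}. L2_ip \<alpha> \<gamma> (dunkl_iter \<gamma> js p) (dunkl_iter \<gamma> js q))"

type_synonym 'n sobolev = "(nat \<Rightarrow> real ^ 'n \<Rightarrow> real) set"

definition H_space :: "real \<Rightarrow> real ^ 'n \<Rightarrow> nat \<Rightarrow> 'n sobolev set" where
  "H_space \<alpha> \<gamma> m = completion (C_closed_ball m) (sobolev_ip \<alpha> \<gamma> m)"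

definition H_norm :: "real \<Rightarrow> real ^ 'n \<Rightarrow> nat \<Rightarrow> 'n sobolev \<Rightarrow> real" where
  "H_norm \<alpha> \<gamma> m = ip_norm (completion_ip (sobolev_ip \<alpha> \<gamma> m))"

definition H_embed :: "real \<Rightarrow> real ^ 'n \<Rightarrow> nat \<Rightarrow> (real ^ 'n \<Rightarrow> real) \<Rightarrow> 'n sobolev" where
  "H_embed \<alpha> \<gamma> m = completion_embed (C_closed_ball m) (sobolev_ip \<alpha> \<gamma> m)"

definition H_minus :: "real \<Rightarrow> real ^ 'n \<Rightarrow> nat \<Rightarrow> 'n sobolev \<Rightarrow> 'n sobolev \<Rightarrow> 'n sobolev" where
  "H_minus \<alpha> \<gamma> m = completion_minus (C_closed_ball m) (sobolev_ip \<alpha> \<gamma> m)"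

text \<open>
  The natural map \<open>H\<^sup>l \<rightarrow> H\<^sup>r\<close> for \<open>r \<le> l\<close>: a sequence representing an element of \<open>H\<^sup>l\<close> is also
  Cauchy for the weaker norm of order \<open>r\<close>, and the element is sent to the class of that sequence.
\<close>

definition H_incl :: "real \<Rightarrow> real ^ 'n \<Rightarrow> nat \<Rightarrow> 'n sobolev \<Rightarrow> 'n sobolev" where
  "H_incl \<alpha> \<gamma> r A = null_rel (C_closed_ball r) (sobolev_ip \<alpha> \<gamma> r) `` A"

text \<open>
  The identification of \<open>H\<^sup>0\<close> with the weighted \<open>L\<^sup>2\<close> space: the (almost everywhere unique)
  \<open>L\<^sup>2\<close> limit of the sequences in the class.
\<close>

definition L2_of_H0 :: "real \<Rightarrow> real ^ 'n \<Rightarrow> 'n sobolev \<Rightarrow> (real ^ 'n \<Rightarrow> real)" where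
  "L2_of_H0 \<alpha> \<gamma> A = (SOME f. f \<in> L2_space \<alpha> \<gamma> \<and>
     (\<forall>U\<in>A. (\<lambda>n. ip_norm (L2_ip \<alpha> \<gamma>) (U n - f)) \<longlonglongrightarrow> 0))"

definition H_proj :: "real \<Rightarrow> real ^ 'n \<Rightarrow> nat \<Rightarrow> 'n sobolev \<Rightarrow> (real ^ 'n \<Rightarrow> real)" where
  "H_proj \<alpha> \<gamma> N u = poly_proj \<alpha> \<gamma> N (L2_of_H0 \<alpha> \<gamma> (H_incl \<alpha> \<gamma> 0 u))"

end

theory Submission
  imports Defs
begin

text \<open>
  Write \<open>S\<^sub>N\<close> for the orthogonal projection with respect to the weight with exponent \<open>\<alpha>\<close>, \<open>S'\<^sub>N\<close> for the
  one with respect to the exponent \<open>\<alpha> + 1\<close>, and \<open>r\<close> for the Euclidean norm of the variable.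
  Everything rests on one integration by parts (\<open>dunkl_adjoint\<close>): the adjoint of a Dunkl operator
  \<open>D\<^sub>j\<close>, as a map from the weight with exponent \<open>\<alpha> + 1\<close> to the weight with exponent \<open>\<alpha>\<close>, is
  \<open>2 (\<alpha> + 1) x\<^sub>j - (1 - r\<^sup>2) D\<^sub>j\<close> and raises the degree of polynomials by one.  Therefore
  \<open>D\<^sub>j S\<^sub>N = S'\<^sub>N\<^sub>-\<^sub>1 D\<^sub>j\<close> (\<open>dunkl_proj\<close>), and for \<open>q = D\<^sub>j u\<close>
  \<open>D\<^sub>j (u - S\<^sub>N u) = (q - S\<^sub>N q) + (S\<^sub>N q - S'\<^sub>N\<^sub>-\<^sub>1 q)\<close>.

  The first term is of the same kind as \<open>u - S\<^sub>N u\<close>, with one derivative less on both sides of the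
  estimate.  The second term is a polynomial that involves only two degrees near \<open>N\<close>, because
  multiplication by \<open>1 - r\<^sup>2\<close> relates the two weights and raises degrees by two.  Its norm for the
  exponent \<open>\<alpha>\<close> is compared with its norm for the exponent \<open>\<alpha> + 1\<close> by a trace inequality for
  orthogonal polynomials, which costs \<open>N\<^sup>1\<^sup>/\<^sup>2\<close> (\<open>orthogonal_polynomial_trace\<close>, \<open>proj_next_weight\<close>).  Its
  Sobolev norms are then estimated by an inverse inequality, which costs \<open>N\<^sup>2\<close> for each
  derivative (\<open>snrm_inverse_inequality\<close>).  Together with \<open>\<parallel>q - S\<^sub>N q\<parallel> \<le> C N\<^sup>-\<^sup>k \<parallel>q\<parallel>\<^sub>k\<close>
  (\<open>projection_error_L2\<close>) this is the asserted rate, by induction on the order of the norm on the left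
  (\<open>projection_error_sobolev\<close>).

  The estimate in the mean and the inverse inequality both come from the energy form
  \<open>E(u, v) = \<Sum>\<^sub>j \<langle>D\<^sub>j u, D\<^sub>j v\<rangle> - \<langle>\<theta>u, \<theta>v\<rangle>\<close> with \<open>\<theta> = \<Sum>\<^sub>j x\<^sub>j D\<^sub>j\<close>.
  A second integration by parts (\<open>energy_eq_sturm\<close>) gives \<open>E(u, v) = \<langle>u, L v\<rangle>\<close> for a second order operator
  \<open>L\<close>, called \<open>sturm\<close> below, that does not raise degrees.  So \<open>E\<close> is diagonal for the decomposition
  into orthogonal polynomials by degree, and Euler's relation evaluates it on degree \<open>n\<close> as \<open>n\<^sup>2 + O(n)\<close>
  times the squared norm (\<open>energy_eigenvalue\<close>).  The reflections in
  the Dunkl operators only contribute to lower order terms.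

  All estimates are shown for functions that are smooth up to the boundary, where multiplication by
  coordinates, reflections and Dunkl operators act boundedly.  They extend to the completion because
  \<open>S\<^sub>N\<close> is continuous from \<open>L\<^sup>2\<close> into the finite-dimensional space of polynomials with any Sobolev norm.
\<close>

section \<open>Spaces of functions with a semi-definite inner product\<close>

lemma LIMSEQ_zero_of_le:
  fixes f g :: "nat \<Rightarrow> real"
  assumes "\<And>n. \<bar>f n\<bar> \<le> g n" "g \<longlonglongrightarrow> 0" shows "f \<longlonglongrightarrow> 0"
  by (rule Lim_null_comparison[OF _ assms(2)]) (use assms(1) in simp)

text \<open>
  The instances are the weighted \<open>L\<^sup>2\<close> form and the Sobolev forms.  The form is assumed to be linear on
  \<open>V\<close> only, since outside of \<open>V\<close> the integrals behind it may fail to exist.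
\<close>

locale semi_ip =
  fixes V :: "('x \<Rightarrow> real) set" and ip :: "('x \<Rightarrow> real) \<Rightarrow> ('x \<Rightarrow> real) \<Rightarrow> real"
  assumes V_zero: "(\<lambda>_. 0) \<in> V"
    and V_add: "f \<in> V \<Longrightarrow> g \<in> V \<Longrightarrow> (\<lambda>x. f x + g x) \<in> V"
    and V_scale: "f \<in> V \<Longrightarrow> (\<lambda>x. c * f x) \<in> V"
    and ip_add: "f \<in> V \<Longrightarrow> g \<in> V \<Longrightarrow> h \<in> V \<Longrightarrow> ip (\<lambda>x. f x + g x) h = ip f h + ip g h"
    and ip_scale: "f \<in> V \<Longrightarrow> h \<in> V \<Longrightarrow> ip (\<lambda>x. c * f x) h = c * ip f h"
    and ip_sym: "ip f g = ip g f"
    and ip_nonneg: "ip f f \<ge> 0"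
begin

abbreviation nrm where "nrm \<equiv> ip_norm ip"

lemma V_minus: "f \<in> V \<Longrightarrow> g \<in> V \<Longrightarrow> f - g \<in> V"
  using V_add[of f "\<lambda>x. (-1) * g x"] V_scale[of g "-1"] by (simp add: fun_diff_def)

lemma V_sum: "(\<And>i. i \<in> I \<Longrightarrow> f i \<in> V) \<Longrightarrow> (\<lambda>x. \<Sum>i\<in>I. f i x) \<in> V"
  by (induction I rule: infinite_finite_induct) (auto intro: V_zero V_add)

lemma ip_add_right: "f \<in> V \<Longrightarrow> g \<in> V \<Longrightarrow> h \<in> V \<Longrightarrow> ip h (\<lambda>x. f x + g x) = ip h f + ip h g"
  using ip_add ip_sym by metis

lemma ip_scale_right: "f \<in> V \<Longrightarrow> h \<in> V \<Longrightarrow> ip h (\<lambda>x. c * f x) = c * ip h f"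
  using ip_scale ip_sym by metis

lemma ip_minus:
  assumes "f \<in> V" "g \<in> V" "h \<in> V" shows "ip (f - g) h = ip f h - ip g h"
  using ip_add[of f "\<lambda>x. (-1) * g x" h] V_scale[of g "-1"] ip_scale[of g h "-1"] assms
  by (simp add: fun_diff_def)

lemma ip_minus_right: "f \<in> V \<Longrightarrow> g \<in> V \<Longrightarrow> h \<in> V \<Longrightarrow> ip h (f - g) = ip h f - ip h g"
  using ip_minus ip_sym by metis

lemma ip_zero: "f \<in> V \<Longrightarrow> ip (\<lambda>_. 0) f = 0"
  using ip_scale[of "\<lambda>_. 0" f 0] V_zero by simp

lemma ip_zero_right: "f \<in> V \<Longrightarrow> ip f (\<lambda>_. 0) = 0"
  using ip_zero ip_sym by metis

lemma ip_sum:
  "(\<And>i. i \<in> I \<Longrightarrow> f i \<in> V) \<Longrightarrow> h \<in> V \<Longrightarrow> ip (\<lambda>x. \<Sum>i\<in>I. f i x) h = (\<Sum>i\<in>I. ip (f i) h)"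
  by (induction I rule: infinite_finite_induct) (auto simp: ip_zero ip_add V_sum)

lemma ip_sum_right:
  "(\<And>i. i \<in> I \<Longrightarrow> f i \<in> V) \<Longrightarrow> h \<in> V \<Longrightarrow> ip h (\<lambda>x. \<Sum>i\<in>I. f i x) = (\<Sum>i\<in>I. ip h (f i))"
  by (simp add: ip_sym[of h] ip_sum)

lemma nrm_nonneg [simp]: "nrm f \<ge> 0"
  by (simp add: ip_norm_def ip_nonneg)

lemma nrm_sq: "(nrm f)\<^sup>2 = ip f f"
  by (simp add: ip_norm_def ip_nonneg)

lemma ip_sq_add:
  assumes "f \<in> V" "g \<in> V"
  shows "ip (\<lambda>x. f x + g x) (\<lambda>x. f x + g x) = ip f f + 2 * ip f g + ip g g"
  using assms by (simp add: ip_add ip_add_right V_add ip_sym[of g f])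

lemma ip_sq_minus:
  assumes "f \<in> V" "g \<in> V"
  shows "ip (f - g) (f - g) = ip f f - 2 * ip f g + ip g g"
  using assms by (simp add: ip_minus ip_minus_right V_minus ip_sym[of g f])

lemma Cauchy_Schwarz:
  assumes "f \<in> V" "g \<in> V" shows "\<bar>ip f g\<bar> \<le> nrm f * nrm g"
proof -
  have *: "0 \<le> ip f f - 2 * t * ip f g + t\<^sup>2 * ip g g" for t
    using ip_nonneg[of "f - (\<lambda>x. t * g x)"] assms
    by (simp add: ip_sq_minus V_scale ip_scale ip_scale_right power2_eq_square mult.assoc)
  have "(ip f g)\<^sup>2 \<le> ip f f * ip g g"
  proof (cases "ip g g = 0")
    case True
    have "ip f g = 0"
    proof (rule ccontr)
      assume "ip f g \<noteq> 0"
      then show False using *[of "(ip f f + 1) / (2 * ip f g)"] True by simp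
    qed
    then show ?thesis using True by simp
  next
    case False
    then have "ip g g > 0" using ip_nonneg[of g] by simp
    then show ?thesis using *[of "ip f g / ip g g"]
      by (simp add: field_simps power2_eq_square)
  qed
  then have "sqrt ((ip f g)\<^sup>2) \<le> sqrt (ip f f * ip g g)" by (rule real_sqrt_le_mono)
  then show ?thesis by (simp add: ip_norm_def real_sqrt_mult)
qed

lemma Cauchy_Schwarz_upper: "f \<in> V \<Longrightarrow> g \<in> V \<Longrightarrow> ip f g \<le> nrm f * nrm g"
  using Cauchy_Schwarz[of f g] by linarith

lemma nrm_triangle:
  assumes "f \<in> V" "g \<in> V" shows "nrm (\<lambda>x. f x + g x) \<le> nrm f + nrm g"
proof (rule power2_le_imp_le)
  show "(nrm (\<lambda>x. f x + g x))\<^sup>2 \<le> (nrm f + nrm g)\<^sup>2"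
    using Cauchy_Schwarz_upper[OF assms] assms by (simp add: nrm_sq ip_sq_add power2_sum)
qed simp

lemma nrm_scale: "f \<in> V \<Longrightarrow> nrm (\<lambda>x. c * f x) = \<bar>c\<bar> * nrm f"
  by (simp add: ip_norm_def ip_scale ip_scale_right V_scale real_sqrt_mult
      flip: power2_eq_square mult.assoc)

lemma nrm_zero [simp]: "nrm (\<lambda>_. 0) = 0"
  by (simp add: ip_norm_def ip_zero V_zero)

lemma nrm_sum:
  "(\<And>i. i \<in> I \<Longrightarrow> f i \<in> V) \<Longrightarrow> nrm (\<lambda>x. \<Sum>i\<in>I. f i x) \<le> (\<Sum>i\<in>I. nrm (f i))"
proof (induction I rule: infinite_finite_induct)
  case (insert i I)
  then have "nrm (\<lambda>x. f i x + (\<Sum>i\<in>I. f i x)) \<le> nrm (f i) + nrm (\<lambda>x. \<Sum>i\<in>I. f i x)"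
    by (intro nrm_triangle V_sum) auto
  then show ?case using insert by fastforce
qed auto

lemma nrm_minus_le:
  assumes "f \<in> V" "g \<in> V" shows "nrm (f - g) \<le> nrm f + nrm g"
  using nrm_triangle[of f "\<lambda>x. (-1) * g x"] nrm_scale[of g "-1"] V_scale[of g "-1"] assms
  by (simp add: fun_diff_def)

lemma nrm_minus_commute: "f \<in> V \<Longrightarrow> g \<in> V \<Longrightarrow> nrm (f - g) = nrm (g - f)"
  by (simp add: ip_norm_def ip_sq_minus ip_sym[of f g])

lemma nrm_minus_triangle:
  assumes "f \<in> V" "g \<in> V" "h \<in> V" shows "nrm (f - h) \<le> nrm (f - g) + nrm (g - h)"
  using nrm_triangle[of "f - g" "g - h"] V_minus assms by (simp add: fun_diff_def)

lemma nrm_diff_le: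
  assumes "f \<in> V" "g \<in> V" shows "\<bar>nrm f - nrm g\<bar> \<le> nrm (f - g)"
  using nrm_triangle[of "f - g" g] nrm_triangle[of "g - f" f] V_minus assms
    nrm_minus_commute[of f g] by (simp add: fun_diff_def)

text \<open>
  Orthogonal projection onto a finite span, one generator at a time: the part of the new generator
  orthogonal to the previous ones is either null, hence orthogonal to everything by
  Cauchy--Schwarz, or can be split off.  The generators need not be linearly independent.
\<close>

lemma orthogonal_projection_exists:
  assumes "finite I" and "\<And>i. i \<in> I \<Longrightarrow> b i \<in> V" and "f \<in> V"
  shows "\<exists>c. \<forall>i\<in>I. ip (f - (\<lambda>x. \<Sum>i\<in>I. c i * b i x)) (b i) = 0"
  using assms
proof (induction I arbitrary: f rule: finite_induct)
  case (insert j I)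
  define S where "S c = (\<lambda>x. \<Sum>i\<in>I. c i * b i x)" for c
  have SV: "S c \<in> V" for c unfolding S_def using insert by (auto intro!: V_sum V_scale)
  have bV: "b i \<in> V" if "i \<in> insert j I" for i using insert that by auto
  have proj: "\<exists>c. \<forall>i\<in>I. ip (g - S c) (b i) = 0" if "g \<in> V" for g
    unfolding S_def by (rule insert.IH) (use insert.prems that in auto)
  obtain c where c: "\<forall>i\<in>I. ip (f - S c) (b i) = 0"
    using proj[OF insert.prems(2)] by blast
  obtain c' where c': "\<forall>i\<in>I. ip (b j - S c') (b i) = 0"
    using proj[of "b j"] insert.prems by blast
  define e where "e = b j - S c'"
  have eV: "e \<in> V" unfolding e_def by (intro V_minus SV bV) simp
  have bj: "b j = (\<lambda>x. e x + S c' x)" by (simp add: e_def)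
  have orthS: "ip g (S d) = 0" if "g \<in> V" "\<forall>i\<in>I. ip g (b i) = 0" for g d
    unfolding S_def using that bV
    by (subst ip_sum_right) (auto simp: ip_scale_right V_scale intro!: sum.neutral)
  define a where "a = (if ip e e = 0 then 0 else ip (f - S c) e / ip e e)"
  define g where "g = f - S c - (\<lambda>x. a * e x)"
  have fV: "f \<in> V" and fS: "f - S c \<in> V" using insert.prems V_minus[OF _ SV] by auto
  have gV: "g \<in> V" unfolding g_def by (intro V_minus V_scale fS eV)
  have g1: "\<forall>i\<in>I. ip g (b i) = 0"
  proof
    fix i assume "i \<in> I"
    then show "ip g (b i) = 0"
      using c c' bV[of i] fS eV by (simp add: g_def e_def[symmetric] ip_minus[OF fS V_scale[OF eV]] ip_scale)
  qed
  have "ip (f - S c) e = 0" if "ip e e = 0"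
    using Cauchy_Schwarz[OF fS eV] that by (simp add: ip_norm_def)
  then have "ip g e = 0"
    by (simp add: g_def a_def ip_minus[OF fS V_scale[OF eV] eV] ip_scale[OF eV eV])
  then have g2: "ip g (b j) = 0"
    using orthS[OF gV g1] gV eV SV by (simp add: bj ip_add_right)
  define d where "d i = (if i = j then a else c i - a * c' i)" for i
  have "(\<Sum>i\<in>insert j I. d i * b i x) = S c x + a * e x" for x
  proof -
    have "(\<Sum>i\<in>I. d i * b i x) = (\<Sum>i\<in>I. (c i - a * c' i) * b i x)"
      using insert.hyps by (intro sum.cong) (auto simp: d_def)
    then show ?thesis using insert.hyps
      by (simp add: S_def e_def d_def algebra_simps sum_subtractf sum_distrib_left)
  qed
  then have "f - (\<lambda>x. \<Sum>i\<in>insert j I. d i * b i x) = g"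
    by (simp add: g_def fun_eq_iff)
  then show ?case using g1 g2 by (intro exI[of _ d]) simp
qed auto

subsection \<open>The completion\<close>

lemma cauchy_seqs_V: "U \<in> cauchy_seqs V ip \<Longrightarrow> U n \<in> V"
  by (simp add: cauchy_seqs_def)

lemma cauchy_seqsD:
  "U \<in> cauchy_seqs V ip \<Longrightarrow> e > 0 \<Longrightarrow> \<exists>M. \<forall>i\<ge>M. \<forall>k\<ge>M. nrm (U i - U k) < e"
  unfolding cauchy_seqs_def by blast

lemma const_cauchy: "u \<in> V \<Longrightarrow> (\<lambda>_. u) \<in> cauchy_seqs V ip"
  using nrm_zero by (simp add: cauchy_seqs_def fun_diff_def)

lemma minus_cauchy:
  assumes U: "U \<in> cauchy_seqs V ip" and U': "U' \<in> cauchy_seqs V ip"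
  shows "(\<lambda>n. U n - U' n) \<in> cauchy_seqs V ip"
  unfolding cauchy_seqs_def
proof (intro CollectI conjI allI impI)
  fix n show "U n - U' n \<in> V" using assms cauchy_seqs_V V_minus by auto
next
  fix e :: real assume "e > 0"
  then have "e / 2 > 0" by simp
  obtain M where M: "\<And>i k. i \<ge> M \<Longrightarrow> k \<ge> M \<Longrightarrow> nrm (U i - U k) < e / 2"
    using cauchy_seqsD[OF U \<open>e / 2 > 0\<close>] by blast
  obtain M' where M': "\<And>i k. i \<ge> M' \<Longrightarrow> k \<ge> M' \<Longrightarrow> nrm (U' i - U' k) < e / 2"
    using cauchy_seqsD[OF U' \<open>e / 2 > 0\<close>] by blast
  have "nrm ((U i - U' i) - (U k - U' k)) < e" if "i \<ge> max M M'" "k \<ge> max M M'" for i k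
  proof -
    have "(U i - U' i) - (U k - U' k) = (U i - U k) - (U' i - U' k)" by (simp add: fun_eq_iff)
    then show ?thesis
      using nrm_minus_le[of "U i - U k" "U' i - U' k", OF V_minus V_minus] M[of i k] M'[of i k] that
        cauchy_seqs_V[OF U] cauchy_seqs_V[OF U'] by simp
  qed
  then show "\<exists>M. \<forall>i\<ge>M. \<forall>k\<ge>M. nrm ((U i - U' i) - (U k - U' k)) < e" by blast
qed

lemma null_rel_refl: "U \<in> cauchy_seqs V ip \<Longrightarrow> (U, U) \<in> null_rel V ip"
  using nrm_zero by (simp add: null_rel_def fun_diff_def)

lemma null_rel_sym: "(U, U') \<in> null_rel V ip \<Longrightarrow> (U', U) \<in> null_rel V ip"
  using nrm_minus_commute cauchy_seqs_V by (auto simp: null_rel_def)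

lemma null_rel_trans:
  assumes "(U, U') \<in> null_rel V ip" "(U', U'') \<in> null_rel V ip"
  shows "(U, U'') \<in> null_rel V ip"
proof -
  have UV: "U n \<in> V" "U' n \<in> V" "U'' n \<in> V" for n
    using assms cauchy_seqs_V by (auto simp: null_rel_def)
  have "(\<lambda>n. nrm (U n - U' n) + nrm (U' n - U'' n)) \<longlonglongrightarrow> 0 + 0"
    using assms by (intro tendsto_add) (auto simp: null_rel_def)
  then have lim: "(\<lambda>n. nrm (U n - U' n) + nrm (U' n - U'' n)) \<longlonglongrightarrow> 0" by simp
  have "(\<lambda>n. nrm (U n - U'' n)) \<longlonglongrightarrow> 0"
    by (rule LIMSEQ_zero_of_le[OF _ lim]) (simp only: abs_of_nonneg nrm_nonneg nrm_minus_triangle UV)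
  then show ?thesis using assms unfolding null_rel_def by blast
qed

lemma completion_cases:
  assumes "A \<in> completion V ip"
  obtains U where "U \<in> cauchy_seqs V ip" "A = null_rel V ip `` {U}"
  using assms by (auto simp: completion_def quotient_def)

lemma nrm_convergent:
  assumes U: "U \<in> cauchy_seqs V ip" shows "convergent (\<lambda>n. nrm (U n))"
proof -
  have "Cauchy (\<lambda>n. nrm (U n))"
  proof (rule metric_CauchyI)
    fix e :: real assume "e > 0"
    have "dist (nrm (U m)) (nrm (U n)) \<le> nrm (U m - U n)" for m n
      using nrm_diff_le cauchy_seqs_V[OF U] by (simp add: dist_real_def)
    then show "\<exists>M. \<forall>m\<ge>M. \<forall>n\<ge>M. dist (nrm (U m)) (nrm (U n)) < e"
      using cauchy_seqsD[OF U \<open>e > 0\<close>] le_less_trans by blast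
  qed
  then show ?thesis by (simp add: Cauchy_convergent_iff)
qed

lemma null_rel_nrm_limit:
  assumes "(U, U') \<in> null_rel V ip" and "(\<lambda>n. nrm (U n)) \<longlonglongrightarrow> L"
  shows "(\<lambda>n. nrm (U' n)) \<longlonglongrightarrow> L"
proof -
  have UV: "U n \<in> V" "U' n \<in> V" for n using assms cauchy_seqs_V by (auto simp: null_rel_def)
  have "(\<lambda>n. nrm (U n) - nrm (U' n)) \<longlonglongrightarrow> 0"
    by (rule LIMSEQ_zero_of_le[where g = "\<lambda>n. nrm (U n - U' n)"])
       (use UV nrm_diff_le assms in \<open>auto simp: null_rel_def\<close>)
  from tendsto_diff[OF assms(2) this] show ?thesis by simp
qed

text \<open>
  Polarisation reduces the convergence of the inner products of two representatives of one class to
  the convergence of norms, so the description in the definition of the inner product of the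
  completion determines a unique number.
\<close>

lemma nrm_class_limit:
  assumes U: "U \<in> cauchy_seqs V ip"
  shows "(\<lambda>n. nrm (U n)) \<longlonglongrightarrow> ip_norm (completion_ip ip) (null_rel V ip `` {U})"
proof -
  obtain L where L: "(\<lambda>n. nrm (U n)) \<longlonglongrightarrow> L"
    using nrm_convergent[OF U] by (auto simp: convergent_def)
  let ?A = "null_rel V ip `` {U}"
  have "L \<ge> 0" using L by (rule LIMSEQ_le_const) auto
  have UA: "U \<in> ?A" using null_rel_refl[OF U] by simp
  have *: "(\<lambda>n. ip (U1 n) (U2 n)) \<longlonglongrightarrow> L\<^sup>2" if "U1 \<in> ?A" "U2 \<in> ?A" for U1 U2
  proof -
    have "(U1, U2) \<in> null_rel V ip" using that null_rel_sym null_rel_trans by blast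
    then have d: "(\<lambda>n. nrm (U1 n - U2 n)) \<longlonglongrightarrow> 0" by (simp add: null_rel_def)
    have V: "U1 n \<in> V" "U2 n \<in> V" for n using that cauchy_seqs_V by (auto simp: null_rel_def)
    have "(\<lambda>n. nrm (U1 n)) \<longlonglongrightarrow> L" "(\<lambda>n. nrm (U2 n)) \<longlonglongrightarrow> L"
      using that L null_rel_nrm_limit by auto
    then have "(\<lambda>n. ((nrm (U1 n))\<^sup>2 + (nrm (U2 n))\<^sup>2 - (nrm (U1 n - U2 n))\<^sup>2) / 2)
                 \<longlonglongrightarrow> (L\<^sup>2 + L\<^sup>2 - 0\<^sup>2) / 2"
      using d by (intro tendsto_intros) auto
    moreover have "((nrm (U1 n))\<^sup>2 + (nrm (U2 n))\<^sup>2 - (nrm (U1 n - U2 n))\<^sup>2) / 2 = ip (U1 n) (U2 n)" for n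
      using V by (simp add: nrm_sq ip_sq_minus)
    ultimately show ?thesis by simp
  qed
  have "completion_ip ip ?A ?A = L\<^sup>2"
    unfolding completion_ip_def
  proof (rule the_equality)
    fix c assume "\<forall>U\<in>?A. \<forall>U'\<in>?A. (\<lambda>n. ip (U n) (U' n)) \<longlonglongrightarrow> c"
    then show "c = L\<^sup>2" using UA *[OF UA UA] LIMSEQ_unique by blast
  qed (use * in blast)
  then show ?thesis using L \<open>L \<ge> 0\<close> by (simp add: ip_norm_def)
qed

lemma null_rel_minus:
  assumes "(U, W) \<in> null_rel V ip" and "(U', W') \<in> null_rel V ip"
  shows "((\<lambda>n. U n - U' n), (\<lambda>n. W n - W' n)) \<in> null_rel V ip"
proof -
  have VV: "U n \<in> V" "U' n \<in> V" "W n \<in> V" "W' n \<in> V" for n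
    using assms cauchy_seqs_V by (auto simp: null_rel_def)
  have "(\<lambda>n. nrm (U n - W n) + nrm (U' n - W' n)) \<longlonglongrightarrow> 0 + 0"
    using assms by (intro tendsto_add) (auto simp: null_rel_def)
  then have lim: "(\<lambda>n. nrm (U n - W n) + nrm (U' n - W' n)) \<longlonglongrightarrow> 0" by simp
  have le: "nrm ((U n - U' n) - (W n - W' n)) \<le> nrm (U n - W n) + nrm (U' n - W' n)" for n
  proof -
    have "(U n - U' n) - (W n - W' n) = (U n - W n) - (U' n - W' n)" by (simp add: fun_eq_iff)
    then show ?thesis using nrm_minus_le[OF V_minus[OF VV(1,3)] V_minus[OF VV(2,4)]] by metis
  qed
  have "(\<lambda>n. nrm ((U n - U' n) - (W n - W' n))) \<longlonglongrightarrow> 0"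
    by (rule LIMSEQ_zero_of_le[OF _ lim]) (simp only: abs_of_nonneg nrm_nonneg le)
  then show ?thesis using assms minus_cauchy unfolding null_rel_def by blast
qed

lemma completion_minus_class:
  assumes U: "U \<in> cauchy_seqs V ip" and U': "U' \<in> cauchy_seqs V ip"
  shows "completion_minus V ip (null_rel V ip `` {U}) (null_rel V ip `` {U'})
           = null_rel V ip `` {\<lambda>n. U n - U' n}"
  unfolding completion_minus_def
proof (intro equalityI subsetI)
  fix X assume "X \<in> null_rel V ip ``
    {\<lambda>n. W n - W' n | W W'. W \<in> null_rel V ip `` {U} \<and> W' \<in> null_rel V ip `` {U'}}"
  then obtain W W' where "(U, W) \<in> null_rel V ip" "(U', W') \<in> null_rel V ip"
    "((\<lambda>n. W n - W' n), X) \<in> null_rel V ip" by auto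
  then show "X \<in> null_rel V ip `` {\<lambda>n. U n - U' n}"
    using null_rel_minus null_rel_trans by blast
next
  fix X assume "X \<in> null_rel V ip `` {\<lambda>n. U n - U' n}"
  then show "X \<in> null_rel V ip ``
    {\<lambda>n. W n - W' n | W W'. W \<in> null_rel V ip `` {U} \<and> W' \<in> null_rel V ip `` {U'}}"
    using null_rel_refl U U' by blast
qed

end

section \<open>The weighted measure on the ball\<close>

subsection \<open>Integration along coordinate lines\<close>

text \<open>
  Fubini's theorem in the direction of \<open>e\<^sub>j\<close> without choosing coordinates on the complementary
  hyperplane: the lines are parametrised by the points of the slab \<open>0 \<le> x\<^sub>j < 1\<close>, each line being
  counted with total weight one, and translation invariance does the rest.
\<close>

lemma nn_integral_lines:
  fixes f :: "real ^ 'n \<Rightarrow> ennreal"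
  assumes [measurable]: "f \<in> borel_measurable borel"
  shows "(\<integral>\<^sup>+x. f x \<partial>lborel) =
    (\<integral>\<^sup>+x. indicator {x. 0 \<le> x $ j \<and> x $ j < 1} x * (\<integral>\<^sup>+t. f (x + t *\<^sub>R axis j 1) \<partial>lborel) \<partial>lborel)"
proof -
  let ?S = "{x :: real ^ 'n. 0 \<le> x $ j \<and> x $ j < 1}"
  have S[measurable]: "?S \<in> sets borel" by measurable
  have "(\<integral>\<^sup>+x. indicator ?S x * (\<integral>\<^sup>+t. f (x + t *\<^sub>R axis j 1) \<partial>lborel) \<partial>lborel)
      = (\<integral>\<^sup>+x. (\<integral>\<^sup>+t. indicator ?S x * f (x + t *\<^sub>R axis j 1) \<partial>lborel) \<partial>lborel)"
    by (simp add: nn_integral_cmult)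
  also have "\<dots> = (\<integral>\<^sup>+t. (\<integral>\<^sup>+x. indicator ?S x * f (x + t *\<^sub>R axis j 1) \<partial>lborel) \<partial>lborel)"
    by (rule lborel_pair.Fubini'[symmetric]) (simp add: split_beta')
  also have "\<dots> = (\<integral>\<^sup>+t. (\<integral>\<^sup>+y. indicator ?S (y - t *\<^sub>R axis j 1) * f y \<partial>lborel) \<partial>lborel)"
  proof (rule nn_integral_cong)
    fix t :: real
    have "(\<integral>\<^sup>+y. indicator ?S (y - t *\<^sub>R axis j 1) * f y \<partial>lborel)
        = (\<integral>\<^sup>+y. indicator ?S (y - t *\<^sub>R axis j 1) * f y \<partial>distr lborel borel (\<lambda>x. t *\<^sub>R axis j 1 + x))"
      by (simp add: lborel_distr_plus)
    also have "\<dots> = (\<integral>\<^sup>+x. indicator ?S x * f (x + t *\<^sub>R axis j 1) \<partial>lborel)"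
      by (subst nn_integral_distr) (auto simp: add.commute)
    finally show "(\<integral>\<^sup>+x. indicator ?S x * f (x + t *\<^sub>R axis j 1) \<partial>lborel)
        = (\<integral>\<^sup>+y. indicator ?S (y - t *\<^sub>R axis j 1) * f y \<partial>lborel)" by simp
  qed
  also have "\<dots> = (\<integral>\<^sup>+y. (\<integral>\<^sup>+t. indicator ?S (y - t *\<^sub>R axis j 1) * f y \<partial>lborel) \<partial>lborel)"
    by (rule lborel_pair.Fubini') (simp add: split_beta')
  also have "\<dots> = (\<integral>\<^sup>+y. f y \<partial>lborel)"
  proof (rule nn_integral_cong)
    fix y :: "real ^ 'n"
    have "(\<integral>\<^sup>+t. indicator ?S (y - t *\<^sub>R axis j 1) * f y \<partial>lborel)
        = (\<integral>\<^sup>+t. f y * indicator {y $ j - 1<..y $ j} t \<partial>lborel)"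
      by (intro nn_integral_cong) (auto simp: indicator_def axis_def split: if_splits)
    also have "\<dots> = f y" by (simp add: nn_integral_cmult)
    finally show "(\<integral>\<^sup>+t. indicator ?S (y - t *\<^sub>R axis j 1) * f y \<partial>lborel) = f y" .
  qed
  finally show ?thesis by simp
qed

text \<open>
  Almost every line carries an integrable restriction, so it suffices to know the integrals along
  lines on which the restriction is integrable.
\<close>

lemma integral_zero_by_lines:
  fixes f :: "real ^ 'n \<Rightarrow> real"
  assumes f: "integrable lborel f"
    and zero: "\<And>y. y $ j = 0 \<Longrightarrow> integrable lborel (\<lambda>t. f (y + t *\<^sub>R axis j 1)) \<Longrightarrow>
                 (LINT t|lborel. f (y + t *\<^sub>R axis j 1)) = 0"
  shows "(LINT x|lborel. f x) = 0"
proof -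
  have [measurable]: "f \<in> borel_measurable borel" using f by auto
  let ?S = "{x :: real ^ 'n. 0 \<le> x $ j \<and> x $ j < 1}"
  have S[measurable]: "?S \<in> sets borel" by measurable
  let ?L = "\<lambda>x t. f (x + t *\<^sub>R axis j 1)"
  have fin: "(\<integral>\<^sup>+x. indicator ?S x * (\<integral>\<^sup>+t. ennreal \<bar>?L x t\<bar> \<partial>lborel) \<partial>lborel) < \<infinity>"
    using f nn_integral_lines[of "\<lambda>x. ennreal \<bar>f x\<bar>" j]
    by (simp add: integrable_iff_bounded)
  then have AE: "AE x in lborel. indicator ?S x * (\<integral>\<^sup>+t. ennreal \<bar>?L x t\<bar> \<partial>lborel) \<noteq> \<infinity>"
    by (intro nn_integral_noteq_infinite) auto
  have "(\<integral>\<^sup>+t. ennreal (?L x t) \<partial>lborel) = (\<integral>\<^sup>+t. ennreal (- ?L x t) \<partial>lborel)"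
    if x: "(\<integral>\<^sup>+t. ennreal \<bar>?L x t\<bar> \<partial>lborel) \<noteq> \<infinity>" for x
  proof -
    have int: "integrable lborel (?L x)"
      using x by (simp add: integrable_iff_bounded top.not_eq_extremum)
    define y where "y = x - x $ j *\<^sub>R axis j 1"
    have sh: "?L y (x $ j + 1 * t) = ?L x t" for t by (simp add: y_def algebra_simps)
    have "integrable lborel (\<lambda>t. ?L y (x $ j + 1 * t))" unfolding sh by (rule int)
    then have "integrable lborel (?L y)" by (subst (asm) lborel_integrable_real_affine_iff) auto
    then have "(LINT t|lborel. ?L y t) = 0" by (rule zero[rotated]) (simp add: y_def axis_def)
    then have 0: "(LINT t|lborel. ?L x t) = 0"
      using lborel_integral_real_affine[of 1 "?L y" "x $ j"] unfolding sh by simp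
    have a: "(\<integral>\<^sup>+t. ennreal (?L x t) \<partial>lborel) \<noteq> \<infinity>" "(\<integral>\<^sup>+t. ennreal (- ?L x t) \<partial>lborel) \<noteq> \<infinity>"
      using int by (auto simp: real_integrable_def)
    have "enn2real (\<integral>\<^sup>+t. ennreal (?L x t) \<partial>lborel) = enn2real (\<integral>\<^sup>+t. ennreal (- ?L x t) \<partial>lborel)"
      using 0 real_lebesgue_integral_def[OF int] by simp
    then have "ennreal (enn2real (\<integral>\<^sup>+t. ennreal (?L x t) \<partial>lborel))
        = ennreal (enn2real (\<integral>\<^sup>+t. ennreal (- ?L x t) \<partial>lborel))" by (rule arg_cong)
    then show ?thesis using a by (simp add: ennreal_enn2real_if)
  qed
  with AE have "AE x in lborel. indicator ?S x * (\<integral>\<^sup>+t. ennreal (?L x t) \<partial>lborel)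
       = indicator ?S x * (\<integral>\<^sup>+t. ennreal (- ?L x t) \<partial>lborel)"
    by (auto elim!: eventually_mono split: split_indicator)
  then have "(\<integral>\<^sup>+x. ennreal (f x) \<partial>lborel) = (\<integral>\<^sup>+x. ennreal (- f x) \<partial>lborel)"
    using nn_integral_lines[of "\<lambda>x. ennreal (f x)" j] nn_integral_lines[of "\<lambda>x. ennreal (- f x)" j]
    by (simp add: nn_integral_cong_AE)
  then show ?thesis using real_lebesgue_integral_def[OF f] by simp
qed

subsection \<open>The weight is integrable\<close>

lemma nn_integral_abs_powr_finite:
  fixes a :: real
  assumes "a > -1"
  shows "(\<integral>\<^sup>+t. ennreal (\<bar>t\<bar> powr a * indicator {-1..1} t) \<partial>lborel) < \<infinity>"
proof -
  let ?g = "\<lambda>t. indicator {0..1} t * ennreal (\<bar>t\<bar> powr a)"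
  have h: "((\<lambda>t::real. \<bar>t\<bar> powr a) has_integral (1 powr (a + 1) / (a + 1))) {0..1}"
    by (rule has_integral_eq[OF _ has_integral_powr_from_0[of a 1]]) (use assms in auto)
  have I: "(\<integral>\<^sup>+t. ?g t \<partial>lborel) = ennreal (1 powr (a + 1) / (a + 1))"
    using nn_integral_has_integral_lebesgue'[OF _ h] by (simp add: mult.commute)
  have "(\<integral>\<^sup>+t. ?g (0 + -1 * t) \<partial>lborel) = (\<integral>\<^sup>+t. ?g t \<partial>lborel)"
    using nn_integral_real_affine[of ?g "-1" 0] by simp
  then have J: "(\<integral>\<^sup>+t. ?g (-t) \<partial>lborel) = ennreal (1 powr (a + 1) / (a + 1))"
    using I by simp
  have "(\<integral>\<^sup>+t. ennreal (\<bar>t\<bar> powr a * indicator {-1..1} t) \<partial>lborel) \<le> (\<integral>\<^sup>+t. ?g t + ?g (-t) \<partial>lborel)"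
    by (intro nn_integral_mono) (auto split: split_indicator)
  also have "\<dots> = (\<integral>\<^sup>+t. ?g t \<partial>lborel) + (\<integral>\<^sup>+t. ?g (-t) \<partial>lborel)"
    by (rule nn_integral_add) auto
  finally show ?thesis unfolding I J by (simp add: order.strict_trans1)
qed

lemma nn_integral_prod_coords:
  fixes f :: "'n::finite \<Rightarrow> real \<Rightarrow> real"
  assumes [measurable]: "\<And>i. f i \<in> borel_measurable borel" and nn: "\<And>i t. f i t \<ge> 0"
  shows "(\<integral>\<^sup>+x. ennreal (\<Prod>i\<in>UNIV. f i (x $ i)) \<partial>lborel) = (\<Prod>i\<in>UNIV. \<integral>\<^sup>+t. ennreal (f i t) \<partial>lborel)"
proof -
  have B: "(Basis :: (real ^ 'n) set) = (\<lambda>i. axis i 1) ` UNIV"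
    by (auto simp: Basis_vec_def)
  have inj: "inj (\<lambda>i::'n. axis i (1::real))" by (auto simp: inj_def axis_eq_axis)
  define h where "h b = f (inv (\<lambda>i. axis i 1) b)" for b :: "real ^ 'n"
  have h: "h (axis i 1) = f i" for i unfolding h_def by (simp add: inv_f_f[OF inj])
  have "(\<integral>\<^sup>+x. ennreal (\<Prod>b\<in>Basis. h b (x \<bullet> b)) \<partial>lborel) = (\<Prod>b\<in>Basis. \<integral>\<^sup>+t. ennreal (h b t) \<partial>lborel)"
    using nn_integral_lborel_prod[of "\<lambda>b t. ennreal (h b t)"] nn
    by (simp add: h_def prod_ennreal)
  then show ?thesis
    unfolding B by (simp add: prod.reindex[OF inj] h inner_axis comp_def)
qed

lemma nn_integral_prod_powr_finite:
  fixes g :: "'n::finite \<Rightarrow> real"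
  assumes "\<And>i. g i > -1"
  shows "(\<integral>\<^sup>+x. ennreal (\<Prod>i\<in>UNIV. \<bar>x $ i\<bar> powr g i * indicator {-1..1} (x $ i)) \<partial>lborel) < \<infinity>"
proof -
  have "(\<integral>\<^sup>+t. ennreal (\<bar>t\<bar> powr g i * indicator {-1..1} t) \<partial>lborel) \<noteq> top" for i
    using nn_integral_abs_powr_finite[OF assms[of i]] by simp
  then show ?thesis
    by (subst nn_integral_prod_coords) (simp_all add: less_top[symmetric] ennreal_prod_eq_top)
qed

lemma nn_integral_distance_powr_le:
  fixes b s :: real
  assumes b: "b > -1" and s: "s \<le> 1"
  shows "(\<integral>\<^sup>+t. ennreal ((s - \<bar>t\<bar>) powr b * indicator {t. \<bar>t\<bar> < s} t) \<partial>lborel) \<le> ennreal (2 / (b + 1))"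
proof (cases "s > 0")
  case False
  then have "{t. \<bar>t\<bar> < s} = {}" by auto
  then show ?thesis by simp
next
  case True
  let ?g = "\<lambda>t. ennreal (t powr b) * indicator {0..s} t"
  have "(\<integral>\<^sup>+t. ?g t \<partial>lborel) = ennreal (s powr (b + 1) / (b + 1))"
    using nn_integral_has_integral_lebesgue'[OF _ has_integral_powr_from_0[of b s]] b True by simp
  also have "\<dots> \<le> ennreal (1 / (b + 1))"
    using b s True by (intro ennreal_leI divide_right_mono) (auto intro: powr_le1)
  finally have I: "(\<integral>\<^sup>+t. ?g t \<partial>lborel) \<le> ennreal (1 / (b + 1))" .
  have J: "(\<integral>\<^sup>+t. ?g (s + -1 * t) \<partial>lborel) = (\<integral>\<^sup>+t. ?g t \<partial>lborel)"
    "(\<integral>\<^sup>+t. ?g (s + 1 * t) \<partial>lborel) = (\<integral>\<^sup>+t. ?g t \<partial>lborel)"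
    using nn_integral_real_affine[of ?g "-1" s] nn_integral_real_affine[of ?g 1 s] by simp_all
  have "(\<integral>\<^sup>+t. ennreal ((s - \<bar>t\<bar>) powr b * indicator {t. \<bar>t\<bar> < s} t) \<partial>lborel)
      \<le> (\<integral>\<^sup>+t. ?g (s + -1 * t) + ?g (s + 1 * t) \<partial>lborel)"
    by (intro nn_integral_mono) (auto split: split_indicator simp: abs_if)
  also have "\<dots> = (\<integral>\<^sup>+t. ?g (s + -1 * t) \<partial>lborel) + (\<integral>\<^sup>+t. ?g (s + 1 * t) \<partial>lborel)"
    by (rule nn_integral_add) auto
  also have "\<dots> \<le> ennreal (1 / (b + 1)) + ennreal (1 / (b + 1))"
    unfolding J by (intro add_mono I)
  also have "\<dots> = ennreal (2 / (b + 1))" using b by (simp add: ennreal_plus[symmetric] del: ennreal_plus)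
  finally show ?thesis .
qed

text \<open>
  Away from the sphere the weight is dominated by a product of powers of the coordinates.  Near the
  sphere some coordinate \<open>x\<^sub>i\<close> is bounded away from zero, the factor \<open>\<bar>x\<^sub>i\<bar> powr \<gamma>\<^sub>i\<close> is then harmless and
  the boundary singularity is integrated first, along the lines parallel to \<open>e\<^sub>i\<close>, on which \<open>1 - r\<^sup>2\<close>
  is comparable with the distance of \<open>\<bar>x\<^sub>i\<bar>\<close> to its maximal value.
\<close>

lemma ball_weight_integrable:
  fixes \<gamma> :: "real ^ 'n"
  assumes \<alpha>: "\<alpha> > -1" and \<gamma>: "\<And>i. \<gamma> $ i > -1"
  shows "(\<integral>\<^sup>+x. ennreal (ball_weight \<alpha> \<gamma> x * indicator (ball 0 1) x) \<partial>lborel) < \<infinity>"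
proof -
  \<comment> \<open>A negative exponent may be assumed; the powers of \<open>1 - r\<^sup>2\<close> are then decreasing functions.\<close>
  define b where "b = min \<alpha> (- 1 / 2)"
  have b: "b > -1" "b < 0" "b \<le> \<alpha>" using \<alpha> by (auto simp: b_def)
  \<comment> \<open>If \<open>r\<^sup>2 > 1 / 2\<close>, some coordinate has modulus at least \<open>c\<close>.\<close>
  define c where "c = sqrt (1 / (2 * CARD('n)))"
  have c: "c > 0" "c\<^sup>2 = 1 / (2 * CARD('n))" by (auto simp: c_def)
  define f where "f i t = \<bar>t\<bar> powr (\<gamma> $ i) * indicator {-1..1} t" for i :: 'n and t :: real
  \<comment> \<open>\<open>s i x\<close> is half the length of the chord through \<open>x\<close> parallel to \<open>e\<^sub>i\<close>; \<open>A\<close> is the part of the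
    weight that is constant along this chord and \<open>B\<close> bounds the singularity at its ends.\<close>
  define s where "s i x = sqrt (1 - (\<Sum>j\<in>UNIV - {i}. (x $ j)\<^sup>2))" for i and x :: "real ^ 'n"
  define A where "A i x = (\<Prod>j\<in>UNIV - {i}. f j (x $ j))" for i and x :: "real ^ 'n"
  define B where "B i x = (s i x - \<bar>x $ i\<bar>) powr b * indicator {t. \<bar>t\<bar> < s i x} (x $ i)"
    for i and x :: "real ^ 'n"
  define P where "P x = (\<Prod>i\<in>UNIV. f i (x $ i))" for x :: "real ^ 'n"
  have [measurable]: "f i \<in> borel_measurable borel" for i unfolding f_def by measurable
  have [measurable]: "s i \<in> borel_measurable borel" "A i \<in> borel_measurable borel"
    "P \<in> borel_measurable borel" for i
    unfolding s_def A_def P_def by measurable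
  have [measurable]: "B i \<in> borel_measurable borel" for i
    unfolding B_def indicator_def mem_Collect_eq by measurable
  define f' where "f' i j t = (if j = i then indicator {-1..1} t else f j t)" for i j and t :: real
  have f'_measurable [measurable]: "f' i j \<in> borel_measurable borel" for i j
    unfolding f'_def by (cases "j = i") auto
  have fnn: "f i t \<ge> 0" for i t by (simp add: f_def)
  have Ann: "A i x \<ge> 0" and Pnn: "P x \<ge> 0" and Bnn: "B i x \<ge> 0" for i x
    by (auto simp: A_def P_def B_def fnn intro!: prod_nonneg)
  define K where "K i = c powr b * c powr (- \<bar>\<gamma> $ i\<bar>)" for i
  have Knn: "K i \<ge> 0" for i by (simp add: K_def)
  have bound: "ball_weight \<alpha> \<gamma> x \<le> (1 / 2) powr b * P x + (\<Sum>i\<in>UNIV. K i * (A i x * B i x))"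
    if x: "x \<in> ball 0 1" for x
  proof -
    have r: "(norm x)\<^sup>2 = (\<Sum>i\<in>UNIV. (x $ i)\<^sup>2)" by (simp add: norm_vec_def L2_set_def sum_nonneg)
    have r1: "(norm x)\<^sup>2 < 1" using x by (simp add: power_less_one_iff abs_square_less_1)
    have xi: "\<bar>x $ i\<bar> \<le> 1" for i using component_le_norm_cart[of x i] x by simp
    have fx: "f i (x $ i) = \<bar>x $ i\<bar> powr (\<gamma> $ i)" for i using xi[of i] by (auto simp: f_def abs_le_iff)
    have W: "ball_weight \<alpha> \<gamma> x = (1 - (norm x)\<^sup>2) powr \<alpha> * P x"
      by (simp add: ball_weight_def P_def fx)
    have ab: "(1 - (norm x)\<^sup>2) powr \<alpha> \<le> (1 - (norm x)\<^sup>2) powr b"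
      using r1 b by (intro powr_mono') auto
    have sum_nn: "(\<Sum>i\<in>UNIV. K i * (A i x * B i x)) \<ge> 0"
      by (intro sum_nonneg mult_nonneg_nonneg Knn Ann Bnn)
    show ?thesis
    proof (cases "(norm x)\<^sup>2 \<le> 1 / 2")
      case True
      then have "(1 - (norm x)\<^sup>2) powr b \<le> (1 / 2) powr b"
        using b by (intro powr_mono2') auto
      then have "ball_weight \<alpha> \<gamma> x \<le> (1 / 2) powr b * P x"
        unfolding W using ab Pnn by (intro mult_right_mono) auto
      then show ?thesis using sum_nn by linarith
    next
      case False
      have "\<exists>i. (x $ i)\<^sup>2 \<ge> c\<^sup>2"
      proof (rule ccontr)
        assume "\<nexists>i. (x $ i)\<^sup>2 \<ge> c\<^sup>2"
        then have "(\<Sum>i\<in>(UNIV::'n set). (x $ i)\<^sup>2) \<le> (\<Sum>i\<in>(UNIV::'n set). c\<^sup>2)"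
          by (intro sum_mono) (simp add: not_le less_imp_le)
        then show False using False r c by simp
      qed
      then obtain i where "(x $ i)\<^sup>2 \<ge> c\<^sup>2" by blast
      then have "\<bar>c\<bar> \<le> \<bar>x $ i\<bar>" by (simp only: abs_le_square_iff)
      then have ci: "c \<le> \<bar>x $ i\<bar>" by simp
      have rs: "1 - (norm x)\<^sup>2 = 1 - (\<Sum>j\<in>UNIV - {i}. (x $ j)\<^sup>2) - (x $ i)\<^sup>2"
        unfolding r by (simp add: sum.remove[of UNIV i])
      have "(x $ i)\<^sup>2 \<ge> 0" by simp
      then have pos: "1 - (\<Sum>j\<in>UNIV - {i}. (x $ j)\<^sup>2) > 0" using rs r1 by linarith
      then have s2: "(s i x)\<^sup>2 = 1 - (\<Sum>j\<in>UNIV - {i}. (x $ j)\<^sup>2)" and s0: "s i x > 0"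
        by (auto simp: s_def)
      have "\<bar>x $ i\<bar>\<^sup>2 < (s i x)\<^sup>2" using rs r1 s2 by simp
      then have sx: "\<bar>x $ i\<bar> < s i x" using s0 by (meson power2_less_imp_less less_imp_le)
      have fac: "1 - (norm x)\<^sup>2 = (s i x - \<bar>x $ i\<bar>) * (s i x + \<bar>x $ i\<bar>)"
        unfolding rs s2[symmetric] by (simp add: algebra_simps power2_eq_square)
      have "(1 - (norm x)\<^sup>2) powr b = (s i x - \<bar>x $ i\<bar>) powr b * (s i x + \<bar>x $ i\<bar>) powr b"
        unfolding fac by (rule powr_mult)
      also have "\<dots> \<le> (s i x - \<bar>x $ i\<bar>) powr b * c powr b"
        using b c ci sx by (intro mult_left_mono powr_mono2') auto
      finally have 1: "(1 - (norm x)\<^sup>2) powr \<alpha> \<le> c powr b * B i x"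
        using ab sx by (simp add: B_def mult.commute)
      have "\<bar>x $ i\<bar> powr (\<gamma> $ i) \<le> \<bar>x $ i\<bar> powr (- \<bar>\<gamma> $ i\<bar>)"
        using xi[of i] by (intro powr_mono') auto
      also have "\<dots> \<le> c powr (- \<bar>\<gamma> $ i\<bar>)" using c ci by (intro powr_mono2') auto
      finally have 2: "f i (x $ i) \<le> c powr (- \<bar>\<gamma> $ i\<bar>)" by (simp add: fx)
      have 3: "P x = f i (x $ i) * A i x" by (simp add: P_def A_def prod.remove[of UNIV i])
      have "ball_weight \<alpha> \<gamma> x \<le> (c powr b * B i x) * (c powr (- \<bar>\<gamma> $ i\<bar>) * A i x)"
        unfolding W 3 using 1 2 Ann Bnn fnn by (intro mult_mono mult_right_mono) auto
      also have "\<dots> = K i * (A i x * B i x)" by (simp add: K_def)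
      also have "\<dots> \<le> (\<Sum>i\<in>UNIV. K i * (A i x * B i x))"
        by (rule member_le_sum) (auto intro!: mult_nonneg_nonneg Knn Ann Bnn)
      finally show ?thesis using Pnn[of x] by (simp add: add_increasing)
    qed
  qed
  have fin: "(\<integral>\<^sup>+x. ennreal (A i x * B i x) \<partial>lborel) < \<infinity>" for i
  proof -
    have A_line: "A i (x + t *\<^sub>R axis i 1) = A i x" and s_line: "s i (x + t *\<^sub>R axis i 1) = s i x" for x t
      by (auto simp: A_def s_def axis_def intro!: prod.cong sum.cong)
    have inner: "(\<integral>\<^sup>+t. ennreal (A i (x + t *\<^sub>R axis i 1) * B i (x + t *\<^sub>R axis i 1)) \<partial>lborel)
        \<le> ennreal (A i x) * ennreal (2 / (b + 1))" for x
    proof -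
      let ?h = "\<lambda>t. ennreal ((s i x - \<bar>t\<bar>) powr b * indicator {t. \<bar>t\<bar> < s i x} t)"
      have [measurable]: "?h \<in> borel_measurable borel"
        unfolding indicator_def mem_Collect_eq by measurable
      have "s i x \<le> 1" by (simp add: s_def sum_nonneg)
      then have "(\<integral>\<^sup>+t. ?h t \<partial>lborel) \<le> ennreal (2 / (b + 1))"
        by (intro nn_integral_distance_powr_le b)
      moreover have "(\<integral>\<^sup>+t. ?h (x $ i + 1 * t) \<partial>lborel) = (\<integral>\<^sup>+t. ?h t \<partial>lborel)"
        using nn_integral_real_affine[of ?h 1 "x $ i"] by simp
      moreover have "B i (x + t *\<^sub>R axis i 1)
          = (s i x - \<bar>x $ i + 1 * t\<bar>) powr b * indicator {t. \<bar>t\<bar> < s i x} (x $ i + 1 * t)" for t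
        by (simp add: B_def s_line)
      ultimately have "(\<integral>\<^sup>+t. ennreal (B i (x + t *\<^sub>R axis i 1)) \<partial>lborel) \<le> ennreal (2 / (b + 1))"
        by simp
      then have "ennreal (A i x) * (\<integral>\<^sup>+t. ennreal (B i (x + t *\<^sub>R axis i 1)) \<partial>lborel)
          \<le> ennreal (A i x) * ennreal (2 / (b + 1))" by (rule mult_left_mono) simp
      then show ?thesis
        by (simp add: A_line ennreal_mult Ann Bnn nn_integral_cmult)
    qed
    have "(\<integral>\<^sup>+x. ennreal (A i x * B i x) \<partial>lborel)
      \<le> (\<integral>\<^sup>+x. indicator {x. 0 \<le> x $ i \<and> x $ i < 1} x * (ennreal (A i x) * ennreal (2 / (b + 1))) \<partial>lborel)"
      by (subst nn_integral_lines[of _ i]) (auto intro!: nn_integral_mono mult_left_mono inner)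
    also have "\<dots> \<le> (\<integral>\<^sup>+x. ennreal (2 / (b + 1)) *
        ennreal (\<Prod>j\<in>UNIV. f' i j (x $ j)) \<partial>lborel)"
    proof (rule nn_integral_mono)
      fix x :: "real ^ 'n"
      have "(\<Prod>j\<in>UNIV. f' i j (x $ j))
          = indicator {-1..1} (x $ i) * A i x"
        by (auto simp: prod.remove[of UNIV i] A_def f'_def intro!: prod.cong)
      then show "indicator {x. 0 \<le> x $ i \<and> x $ i < 1} x * (ennreal (A i x) * ennreal (2 / (b + 1)))
        \<le> ennreal (2 / (b + 1)) *
          ennreal (\<Prod>j\<in>UNIV. f' i j (x $ j))"
        by (auto split: split_indicator simp: mult.commute)
    qed
    also have "\<dots> = ennreal (2 / (b + 1)) * (\<integral>\<^sup>+x.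
        ennreal (\<Prod>j\<in>UNIV. f' i j (x $ j)) \<partial>lborel)"
      by (rule nn_integral_cmult) measurable
    also have "(\<integral>\<^sup>+x. ennreal (\<Prod>j\<in>UNIV. f' i j (x $ j)) \<partial>lborel)
       = (\<Prod>j\<in>UNIV. \<integral>\<^sup>+t. ennreal (f' i j t) \<partial>lborel)"
      by (rule nn_integral_prod_coords) (auto simp: fnn f'_def)
    also have "ennreal (2 / (b + 1)) * \<dots> < \<infinity>"
    proof -
      have "(\<integral>\<^sup>+t. ennreal (f' i j t) \<partial>lborel) \<noteq> \<infinity>" for j
      proof (cases "j = i")
        case True
        then show ?thesis by (simp add: f'_def ennreal_indicator)
      next
        case False
        then show ?thesis using nn_integral_abs_powr_finite[OF \<gamma>[of j]] by (simp add: f'_def f_def)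
      qed
      then show ?thesis by (simp add: less_top[symmetric] ennreal_mult_eq_top_iff ennreal_prod_eq_top)
    qed
    finally show ?thesis .
  qed
  have "(\<integral>\<^sup>+x. ennreal (ball_weight \<alpha> \<gamma> x * indicator (ball 0 1) x) \<partial>lborel)
     \<le> (\<integral>\<^sup>+x. ennreal ((1 / 2) powr b) * ennreal (P x)
            + (\<Sum>i\<in>UNIV. ennreal (K i) * ennreal (A i x * B i x)) \<partial>lborel)"
  proof (rule nn_integral_mono)
    fix x :: "real ^ 'n"
    have "ball_weight \<alpha> \<gamma> x * indicator (ball 0 1) x
        \<le> (1 / 2) powr b * P x + (\<Sum>i\<in>UNIV. K i * (A i x * B i x))"
      using bound[of x] Pnn[of x] Knn Ann Bnn
      by (auto split: split_indicator intro!: add_nonneg_nonneg sum_nonneg)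
    then have "ennreal (ball_weight \<alpha> \<gamma> x * indicator (ball 0 1) x)
        \<le> ennreal ((1 / 2) powr b * P x + (\<Sum>i\<in>UNIV. K i * (A i x * B i x)))" by (rule ennreal_leI)
    also have "\<dots> = ennreal ((1 / 2) powr b) * ennreal (P x)
            + (\<Sum>i\<in>UNIV. ennreal (K i) * ennreal (A i x * B i x))"
      using Pnn Knn Ann Bnn
      by (simp add: ennreal_plus ennreal_mult sum_ennreal[symmetric] sum_nonneg)
    finally show "ennreal (ball_weight \<alpha> \<gamma> x * indicator (ball 0 1) x) \<le> \<dots>" .
  qed
  also have "\<dots> = ennreal ((1 / 2) powr b) * (\<integral>\<^sup>+x. ennreal (P x) \<partial>lborel)
            + (\<Sum>i\<in>UNIV. ennreal (K i) * (\<integral>\<^sup>+x. ennreal (A i x * B i x) \<partial>lborel))"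
    by (subst nn_integral_add) (auto simp: nn_integral_sum nn_integral_cmult)
  also have "\<dots> < \<infinity>"
    using fin nn_integral_prod_powr_finite[of "\<lambda>i. \<gamma> $ i"] \<gamma>
    by (simp add: P_def f_def ennreal_mult_less_top)
  finally show ?thesis .
qed

subsection \<open>Functions continuous up to the boundary\<close>

abbreviation Cball :: "nat \<Rightarrow> (real ^ 'n \<Rightarrow> real) set" where "Cball \<equiv> C_closed_ball"

lemma Cball_0I: "continuous_on (cball 0 1) g \<Longrightarrow> (\<And>x. x \<in> ball 0 1 \<Longrightarrow> g x = u x) \<Longrightarrow> u \<in> Cball 0"
  by (auto simp: cont_upto_boundary_def)

lemma Cball_0E:
  assumes "u \<in> Cball 0"
  obtains g where "continuous_on (cball 0 1) g" "\<And>x. x \<in> ball 0 1 \<Longrightarrow> g x = u x"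
  using assms by (auto simp: cont_upto_boundary_def)

lemma Cball_0_continuous: "u \<in> Cball 0 \<Longrightarrow> continuous_on (ball 0 1) u"
  by (elim Cball_0E) (metis ball_subset_cball continuous_on_cong continuous_on_subset)

lemma Cball_0_bounded:
  assumes "u \<in> Cball 0"
  obtains B where "B > 0" "\<And>x. x \<in> ball 0 1 \<Longrightarrow> \<bar>u x\<bar> \<le> B"
proof -
  obtain g where g: "continuous_on (cball 0 1) g" "\<And>x. x \<in> ball 0 1 \<Longrightarrow> g x = u x"
    using assms by (rule Cball_0E) blast
  have "bounded (g ` cball 0 1)"
    by (intro compact_imp_bounded compact_continuous_image g compact_cball)
  then obtain B where "B > 0" "\<And>x. x \<in> cball 0 1 \<Longrightarrow> \<bar>g x\<bar> \<le> B"
    by (auto simp: bounded_pos)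
  then show ?thesis using that g(2) by (metis ball_subset_cball subsetD)
qed

subsection \<open>The reflections\<close>

lemma reflect_nth: "reflect j x $ i = (if i = j then - (x $ i) else x $ i)"
  by (auto simp: reflect_def axis_def)

lemma reflect_reflect [simp]: "reflect j (reflect j x) = x"
  by (simp add: vec_eq_iff reflect_nth)

lemma norm_reflect [simp]: "norm (reflect j x) = norm x"
  unfolding norm_vec_def L2_set_def
  by (rule arg_cong[where f = sqrt], rule sum.cong) (auto simp: reflect_nth)

lemma reflect_in_ball [simp]: "reflect j x \<in> ball 0 1 \<longleftrightarrow> x \<in> ball 0 1"
  by simp

lemma reflect_continuous [continuous_intros]:
  "continuous_on S f \<Longrightarrow> continuous_on S (\<lambda>x. reflect j (f x))"
  unfolding reflect_def by (intro continuous_intros)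

lemma reflect_measurable [measurable]: "reflect j \<in> borel_measurable borel"
  by (intro borel_measurable_continuous_onI continuous_intros)

lemma ball_weight_reflect [simp]: "ball_weight \<alpha> \<gamma> (reflect j x) = ball_weight \<alpha> \<gamma> x"
  unfolding ball_weight_def norm_reflect
  by (rule arg_cong[where f = "(*) _"], rule prod.cong) (auto simp: reflect_nth)

lemma lborel_reflect: "distr lborel borel (reflect j) = (lborel :: (real ^ 'n) measure)"
proof -
  define c where "c b = (if b = axis j 1 then -1 else 1 :: real)" for b :: "real ^ 'n"
  have "0 + (\<Sum>b\<in>Basis. (c b * (x \<bullet> b)) *\<^sub>R b) = reflect j x" for x
  proof (rule euclidean_eqI)
    fix b :: "real ^ 'n" assume b: "b \<in> Basis"
    then obtain i where i: "b = axis i 1" by (auto simp: Basis_vec_def)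
    show "(0 + (\<Sum>b\<in>Basis. (c b * (x \<bullet> b)) *\<^sub>R b)) \<bullet> b = reflect j x \<bullet> b"
      using b by (simp add: inner_sum_left_Basis) (simp add: i c_def inner_axis reflect_nth axis_eq_axis)
  qed
  then have "lborel = density (distr lborel borel (reflect j)) (\<lambda>_. (\<Prod>b\<in>Basis. \<bar>c b\<bar>))"
    using lborel_affine_euclidean[of c 0] by (simp add: c_def)
  also have "(\<Prod>b\<in>Basis. \<bar>c b\<bar>) = 1" by (rule prod.neutral) (simp add: c_def)
  finally show ?thesis by (simp add: density_1)
qed

subsection \<open>The weighted Lebesgue space\<close>

lemma ball_weight_measurable [measurable]: "ball_weight \<alpha> \<gamma> \<in> borel_measurable borel"
  unfolding ball_weight_def[abs_def] by measurable

lemma ball_weight_nonneg: "ball_weight \<alpha> \<gamma> x \<ge> 0"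
  by (simp add: ball_weight_def prod_nonneg)

lemma norm_sq_less_1: "x \<in> ball 0 1 \<Longrightarrow> (norm x)\<^sup>2 < 1"
  by (simp add: abs_square_less_1)

lemma ball_weight_next:
  assumes "x \<in> ball 0 1"
  shows "ball_weight (\<alpha> + 1) \<gamma> x = (1 - (norm x)\<^sup>2) * ball_weight \<alpha> \<gamma> x"
  using norm_sq_less_1[OF assms] by (simp add: ball_weight_def powr_add)

lemma space_ball_measure [simp]: "space (ball_measure \<alpha> \<gamma>) = ball 0 1"
  by (simp add: ball_measure_def space_restrict_space)

lemma sets_ball_measure [measurable_cong]:
  "sets (ball_measure \<alpha> \<gamma>) = sets (restrict_space borel (ball 0 1))"
  by (simp add: ball_measure_def sets_restrict_space)

lemma measurable_ball_measure:
  fixes f :: "real ^ 'n \<Rightarrow> real"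
  shows "f \<in> borel_measurable (ball_measure \<alpha> \<gamma>) \<longleftrightarrow>
    (\<lambda>x. indicator (ball 0 1) x * f x) \<in> borel_measurable borel"
proof -
  have "f \<in> borel_measurable (ball_measure \<alpha> \<gamma>) \<longleftrightarrow> f \<in> borel_measurable (restrict_space borel (ball 0 1))"
    by (simp add: measurable_cong_sets[OF sets_ball_measure refl])
  then show ?thesis by (simp add: borel_measurable_restrict_space_iff)
qed

lemma integrable_ball_measure:
  fixes f :: "real ^ 'n \<Rightarrow> real"
  assumes f: "f \<in> borel_measurable (ball_measure \<alpha> \<gamma>)"
  shows "integrable (ball_measure \<alpha> \<gamma>) f \<longleftrightarrow>
      integrable lborel (\<lambda>x. indicator (ball 0 1) x * (ball_weight \<alpha> \<gamma> x * f x))"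
    and "integral\<^sup>L (ball_measure \<alpha> \<gamma>) f =
      (LINT x|lborel. indicator (ball 0 1) x * (ball_weight \<alpha> \<gamma> x * f x))"
proof -
  have f': "f \<in> borel_measurable (restrict_space lborel (ball 0 1))"
    using f by (simp add: measurable_ball_measure borel_measurable_restrict_space_iff)
  have W: "ball_weight \<alpha> \<gamma> \<in> borel_measurable (restrict_space lborel (ball 0 1))"
    by (rule measurable_restrict_space1) simp
  have B: "ball 0 1 \<inter> space lborel \<in> sets (lborel :: (real ^ 'n) measure)" by simp
  show "integrable (ball_measure \<alpha> \<gamma>) f \<longleftrightarrow>
      integrable lborel (\<lambda>x. indicator (ball 0 1) x * (ball_weight \<alpha> \<gamma> x * f x))"
    unfolding ball_measure_def integrable_density[OF f' W AE_I2[OF ball_weight_nonneg]]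
      integrable_restrict_space[OF B] by simp
  show "integral\<^sup>L (ball_measure \<alpha> \<gamma>) f =
      (LINT x|lborel. indicator (ball 0 1) x * (ball_weight \<alpha> \<gamma> x * f x))"
    unfolding ball_measure_def integral_density[OF f' W AE_I2[OF ball_weight_nonneg]]
      integral_restrict_space[OF B] by simp
qed

lemma Cball_0_measurable:
  assumes "u \<in> Cball 0" shows "u \<in> borel_measurable (ball_measure \<alpha> \<gamma>)"
  unfolding measurable_ball_measure
  using borel_measurable_continuous_on_indicator[of "ball 0 1" u] Cball_0_continuous[OF assms] by simp

lemma L2_ip_cong:
  "(\<And>x. x \<in> ball 0 1 \<Longrightarrow> u x = u' x) \<Longrightarrow> (\<And>x. x \<in> ball 0 1 \<Longrightarrow> v x = v' x) \<Longrightarrow>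
     L2_ip \<alpha> \<gamma> u v = L2_ip \<alpha> \<gamma> u' v'"
  unfolding L2_ip_def by (rule Bochner_Integration.integral_cong) auto

lemma measurable_reflect_ball:
  fixes f :: "real ^ 'n \<Rightarrow> real"
  assumes "f \<in> borel_measurable (ball_measure \<alpha> \<gamma>)"
  shows "(\<lambda>x. f (reflect j x)) \<in> borel_measurable (ball_measure \<alpha> \<gamma>)"
proof -
  have [measurable]: "(\<lambda>x. indicator (ball 0 1) x * f x) \<in> borel_measurable borel"
    using assms by (simp add: measurable_ball_measure)
  have "(\<lambda>x. indicator (ball 0 1) (reflect j x) * f (reflect j x)) \<in> borel_measurable borel"
    using measurable_compose[OF reflect_measurable[of j], of "\<lambda>x. indicator (ball 0 1) x * f x"] by measurable
  then show ?thesis by (simp add: measurable_ball_measure indicator_def)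
qed

lemma integral_reflect:
  fixes f :: "real ^ 'n \<Rightarrow> real"
  assumes f: "f \<in> borel_measurable (ball_measure \<alpha> \<gamma>)"
  shows "(LINT x|ball_measure \<alpha> \<gamma>. f (reflect j x)) = (LINT x|ball_measure \<alpha> \<gamma>. f x)"
    and "integrable (ball_measure \<alpha> \<gamma>) (\<lambda>x. f (reflect j x)) \<longleftrightarrow> integrable (ball_measure \<alpha> \<gamma>) f"
proof -
  let ?h = "\<lambda>x. indicator (ball 0 1) x * (ball_weight \<alpha> \<gamma> x * f x)"
  have "(\<lambda>x. ball_weight \<alpha> \<gamma> x * (indicator (ball 0 1) x * f x)) \<in> borel_measurable borel"
    using f unfolding measurable_ball_measure by measurable
  then have h: "?h \<in> borel_measurable borel" by (simp add: mult.left_commute)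
  have hr: "?h (reflect j x) = indicator (ball 0 1) x * (ball_weight \<alpha> \<gamma> x * f (reflect j x))" for x
    by (simp add: indicator_def)
  have fr: "(\<lambda>x. f (reflect j x)) \<in> borel_measurable (ball_measure \<alpha> \<gamma>)"
    by (rule measurable_reflect_ball[OF f])
  have "(LINT x|lborel. ?h (reflect j x)) = (LINT x|distr lborel borel (reflect j). ?h x)"
    by (rule integral_distr[symmetric]) (use h in auto)
  then show "(LINT x|ball_measure \<alpha> \<gamma>. f (reflect j x)) = (LINT x|ball_measure \<alpha> \<gamma>. f x)"
    unfolding integrable_ball_measure(2)[OF f] integrable_ball_measure(2)[OF fr] lborel_reflect hr .
  have "integrable lborel (\<lambda>x. ?h (reflect j x)) \<longleftrightarrow> integrable (distr lborel borel (reflect j)) ?h"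
    by (rule integrable_distr_eq[symmetric]) (use h in auto)
  then show "integrable (ball_measure \<alpha> \<gamma>) (\<lambda>x. f (reflect j x)) \<longleftrightarrow> integrable (ball_measure \<alpha> \<gamma>) f"
    unfolding integrable_ball_measure(1)[OF f] integrable_ball_measure(1)[OF fr] lborel_reflect hr .
qed

locale ball_wt =
  fixes \<alpha> :: real and \<gamma> :: "real ^ 'n"
  assumes \<alpha>: "\<alpha> > -1" and \<gamma>: "\<And>i. \<gamma> $ i > -1"
begin

abbreviation "\<mu> \<equiv> ball_measure \<alpha> \<gamma>"

lemma next_weight: "ball_wt (\<alpha> + 1) \<gamma>"
  using \<alpha> \<gamma> by unfold_locales auto

sublocale finite_measure \<mu>
proof
  have B: "ball 0 1 \<in> sets \<mu>" using sets.top[of \<mu>] by simp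
  have "emeasure \<mu> (space \<mu>) = (\<integral>\<^sup>+x. ennreal (ball_weight \<alpha> \<gamma> x) * indicator (ball 0 1) x
     \<partial>restrict_space lborel (ball 0 1))"
    unfolding ball_measure_def
    by (subst emeasure_density)
       (auto simp: space_restrict_space sets_restrict_space_iff intro: measurable_restrict_space1)
  also have "\<dots> = (\<integral>\<^sup>+x. ennreal (ball_weight \<alpha> \<gamma> x) * indicator (ball 0 1) x * indicator (ball 0 1) x \<partial>lborel)"
    by (rule nn_integral_restrict_space) simp
  also have "\<dots> = (\<integral>\<^sup>+x. ennreal (ball_weight \<alpha> \<gamma> x * indicator (ball 0 1) x) \<partial>lborel)"
    by (rule nn_integral_cong) (auto split: split_indicator)
  finally show "emeasure \<mu> (space \<mu>) \<noteq> \<infinity>" using ball_weight_integrable[OF \<alpha> \<gamma>] by simp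
qed

lemma integrable_bounded:
  fixes f :: "real ^ 'n \<Rightarrow> real"
  assumes "f \<in> borel_measurable \<mu>" "\<And>x. x \<in> ball 0 1 \<Longrightarrow> \<bar>f x\<bar> \<le> B"
  shows "integrable \<mu> f"
  by (rule integrable_const_bound[of _ B]) (use assms in auto)

lemma Cball_0_integrable:
  assumes "u \<in> Cball 0" shows "integrable \<mu> u"
proof -
  obtain B where "\<And>x. x \<in> ball 0 1 \<Longrightarrow> \<bar>u x\<bar> \<le> B" using assms by (rule Cball_0_bounded) blast
  with Cball_0_measurable[OF assms] show ?thesis by (rule integrable_bounded)
qed

lemma Cball_0_L2: "u \<in> Cball 0 \<Longrightarrow> u \<in> L2_space \<alpha> \<gamma>"
proof -
  assume u: "u \<in> Cball 0"
  note [measurable] = Cball_0_measurable[OF u, of \<alpha> \<gamma>]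
  obtain B where "\<And>x. x \<in> ball 0 1 \<Longrightarrow> \<bar>u x\<bar> \<le> B" using u by (rule Cball_0_bounded) blast
  then have "integrable \<mu> (\<lambda>x. (u x)\<^sup>2)"
    by (intro integrable_bounded[where B = "B\<^sup>2"]) (auto simp: abs_le_square_iff[symmetric] intro: order_trans[OF _ abs_ge_self])
  then show ?thesis by (simp add: L2_space_def)
qed

lemma L2_mult_integrable:
  assumes "f \<in> L2_space \<alpha> \<gamma>" "g \<in> L2_space \<alpha> \<gamma>" shows "integrable \<mu> (\<lambda>x. f x * g x)"
proof -
  have [measurable]: "f \<in> borel_measurable \<mu>" "g \<in> borel_measurable \<mu>"
    and i: "integrable \<mu> (\<lambda>x. (f x)\<^sup>2)" "integrable \<mu> (\<lambda>x. (g x)\<^sup>2)"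
    using assms by (auto simp: L2_space_def)
  have "\<bar>f x * g x\<bar> \<le> (f x)\<^sup>2 + (g x)\<^sup>2" for x
  proof -
    have "2 * (\<bar>f x\<bar> * \<bar>g x\<bar>) \<le> (f x)\<^sup>2 + (g x)\<^sup>2"
      using sum_squares_bound[of "\<bar>f x\<bar>" "\<bar>g x\<bar>"] by simp
    moreover have "0 \<le> \<bar>f x\<bar> * \<bar>g x\<bar>" by simp
    ultimately show ?thesis unfolding abs_mult by linarith
  qed
  then show ?thesis
    by (intro Bochner_Integration.integrable_bound[OF Bochner_Integration.integrable_add[OF i]]) auto
qed

sublocale L2: semi_ip "L2_space \<alpha> \<gamma>" "L2_ip \<alpha> \<gamma>"
proof
  show "(\<lambda>_. 0) \<in> L2_space \<alpha> \<gamma>" by (simp add: L2_space_def)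
next
  fix f g assume fg: "f \<in> L2_space \<alpha> \<gamma>" "g \<in> L2_space \<alpha> \<gamma>"
  then have "integrable \<mu> (\<lambda>x. (f x)\<^sup>2 + 2 * (f x * g x) + (g x)\<^sup>2)"
    using L2_mult_integrable[OF fg]
    by (intro Bochner_Integration.integrable_add) (auto simp: L2_space_def)
  then show "(\<lambda>x. f x + g x) \<in> L2_space \<alpha> \<gamma>"
    using fg by (auto simp: L2_space_def power2_sum algebra_simps)
next
  fix f and c :: real assume "f \<in> L2_space \<alpha> \<gamma>"
  then show "(\<lambda>x. c * f x) \<in> L2_space \<alpha> \<gamma>" by (auto simp: L2_space_def power_mult_distrib)
next
  fix f g h assume "f \<in> L2_space \<alpha> \<gamma>" "g \<in> L2_space \<alpha> \<gamma>" "h \<in> L2_space \<alpha> \<gamma>"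
  then show "L2_ip \<alpha> \<gamma> (\<lambda>x. f x + g x) h = L2_ip \<alpha> \<gamma> f h + L2_ip \<alpha> \<gamma> g h"
    by (simp add: L2_ip_def distrib_right L2_mult_integrable)
next
  fix f h and c :: real assume "f \<in> L2_space \<alpha> \<gamma>" "h \<in> L2_space \<alpha> \<gamma>"
  then show "L2_ip \<alpha> \<gamma> (\<lambda>x. c * f x) h = c * L2_ip \<alpha> \<gamma> f h"
    by (simp add: L2_ip_def mult.assoc)
next
  fix f g show "L2_ip \<alpha> \<gamma> f g = L2_ip \<alpha> \<gamma> g f" by (simp add: L2_ip_def mult.commute)
next
  fix f show "L2_ip \<alpha> \<gamma> f f \<ge> 0" by (simp add: L2_ip_def)
qed

abbreviation nrm :: "(real ^ 'n \<Rightarrow> real) \<Rightarrow> real" where "nrm \<equiv> ip_norm (L2_ip \<alpha> \<gamma>)"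

lemma L2_ip_eqI:
  assumes "\<And>x. x \<in> ball 0 1 \<Longrightarrow> u x * v x = u' x * v' x"
  shows "L2_ip \<alpha> \<gamma> u v = L2_ip \<alpha> \<gamma> u' v'"
  unfolding L2_ip_def by (rule Bochner_Integration.integral_cong) (use assms in auto)

lemma L2_ip_next:
  assumes "u \<in> Cball 0" "v \<in> Cball 0"
  shows "L2_ip (\<alpha> + 1) \<gamma> u v = (LINT x|\<mu>. (1 - (norm x)\<^sup>2) * (u x * v x))"
proof -
  have [measurable]: "u \<in> borel_measurable (ball_measure a \<gamma>)" "v \<in> borel_measurable (ball_measure a \<gamma>)" for a
    using assms Cball_0_measurable by auto
  have [measurable]: "(\<lambda>x. norm x) \<in> borel_measurable \<mu>"
    using Cball_0_measurable[OF Cball_0I[of norm norm]] by (auto intro: continuous_intros)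
  have m: "(\<lambda>x. u x * v x) \<in> borel_measurable (ball_measure (\<alpha> + 1) \<gamma>)"
    "(\<lambda>x. (1 - (norm x)\<^sup>2) * (u x * v x)) \<in> borel_measurable \<mu>" by measurable
  show ?thesis
    unfolding L2_ip_def integrable_ball_measure(2)[OF m(1)] integrable_ball_measure(2)[OF m(2)]
    by (intro Bochner_Integration.integral_cong) (auto simp: ball_weight_next split: split_indicator)
qed

text \<open>The weight vanishes only on the coordinate hyperplanes, which form a null set.\<close>

lemma L2_ip_definite:
  assumes u: "u \<in> Cball 0" and 0: "L2_ip \<alpha> \<gamma> u u = 0" and x: "x \<in> ball 0 1"
  shows "u x = 0"
proof (rule ccontr)
  assume ux: "u x \<noteq> 0"
  let ?U = "{y \<in> ball 0 1. u y \<noteq> 0}"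
  have cont: "continuous_on (ball 0 1) u" by (rule Cball_0_continuous[OF u])
  have "open ?U"
    using continuous_open_preimage[OF cont open_ball, of "- {0}"]
    by (simp add: vimage_def Int_def open_Compl)
  have [measurable]: "u \<in> borel_measurable \<mu>" by (rule Cball_0_measurable[OF u])
  have m: "(\<lambda>x. u x * u x) \<in> borel_measurable \<mu>" by measurable
  let ?h = "\<lambda>x. indicator (ball 0 1) x * (ball_weight \<alpha> \<gamma> x * (u x * u x))"
  have int: "integrable lborel ?h"
    using integrable_ball_measure(1)[OF m] L2_mult_integrable[OF Cball_0_L2 Cball_0_L2] u by blast
  have "(LINT x|lborel. ?h x) = 0"
    using 0 integrable_ball_measure(2)[OF m] by (simp add: L2_ip_def)
  then have "AE x in lborel. ?h x = 0"
    by (subst (asm) integral_nonneg_eq_0_iff_AE[OF int]) (simp_all add: ball_weight_nonneg)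
  then have "AE x in lebesgue. ?h x = 0" by (rule AE_completion)
  then obtain N where N: "\<And>x. x \<in> space lebesgue - N \<Longrightarrow> ?h x = 0" "N \<in> null_sets lebesgue"
    by (rule AE_E3) blast
  have "?U \<subseteq> N \<union> (\<Union>i. {y. y $ i = 0})"
  proof
    fix y assume y: "y \<in> ?U"
    show "y \<in> N \<union> (\<Union>i. {y. y $ i = 0})"
    proof (cases "\<exists>i. y $ i = 0")
      case False
      have "(norm y)\<^sup>2 < 1" using y norm_sq_less_1 by blast
      then have "ball_weight \<alpha> \<gamma> y \<noteq> 0" using False by (auto simp: ball_weight_def)
      then have "?h y \<noteq> 0" using y by simp
      then show ?thesis using N(1)[of y] by auto
    qed auto
  qed
  moreover have "negligible (N \<union> (\<Union>i. {y :: real ^ 'n. y $ i = 0}))"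
  proof (rule negligible_Un)
    show "negligible N" using N by (simp add: negligible_iff_null_sets)
    show "negligible (\<Union>i. {y :: real ^ 'n. y $ i = 0})"
      by (intro negligible_Union) (auto simp: negligible_standard_hyperplane_cart)
  qed
  ultimately have "negligible ?U" by (rule negligible_subset[rotated])
  then show False using \<open>open ?U\<close> open_not_negligible[of ?U] x ux by blast
qed


text \<open>
  Completeness: a rapidly convergent subsequence has absolutely summable increments in \<open>L\<^sup>1\<close>, hence
  converges almost everywhere, and Fatou's lemma identifies the limit in the mean.
\<close>

lemma L2_nrm_abs: "nrm (\<lambda>x. \<bar>f x\<bar>) = nrm f"
  by (simp add: ip_norm_def L2_ip_def abs_mult[symmetric])

lemma L2_abs: "f \<in> L2_space \<alpha> \<gamma> \<Longrightarrow> (\<lambda>x. \<bar>f x\<bar>) \<in> L2_space \<alpha> \<gamma>"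
  by (auto simp: L2_space_def)

lemma L2_one: "(\<lambda>_. 1) \<in> L2_space \<alpha> \<gamma>"
  by (rule Cball_0_L2, rule Cball_0I[of "\<lambda>_. 1"]) auto

lemma L2_integrable: "f \<in> L2_space \<alpha> \<gamma> \<Longrightarrow> integrable \<mu> f"
  using L2_mult_integrable[OF _ L2_one] by simp

lemma L1_le_L2:
  assumes "f \<in> L2_space \<alpha> \<gamma>" shows "(LINT x|\<mu>. \<bar>f x\<bar>) \<le> nrm f * nrm (\<lambda>_. 1)"
  using L2.Cauchy_Schwarz_upper[OF L2_abs[OF assms] L2_one] by (simp add: L2_nrm_abs L2_ip_def)

lemma nn_integral_sq_eq_nrm:
  assumes "f \<in> L2_space \<alpha> \<gamma>" shows "(\<integral>\<^sup>+x. ennreal ((f x)\<^sup>2) \<partial>\<mu>) = ennreal ((nrm f)\<^sup>2)"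
  using nn_integral_eq_integral[of \<mu> "\<lambda>x. (f x)\<^sup>2"] assms
  unfolding L2.nrm_sq by (simp add: L2_space_def L2_ip_def power2_eq_square)

theorem L2_complete:
  assumes U: "U \<in> cauchy_seqs (L2_space \<alpha> \<gamma>) (L2_ip \<alpha> \<gamma>)"
  shows "\<exists>f\<in>L2_space \<alpha> \<gamma>. (\<lambda>n. nrm (U n - f)) \<longlonglongrightarrow> 0"
proof -
  have UV: "U n \<in> L2_space \<alpha> \<gamma>" for n by (rule L2.cauchy_seqs_V[OF U])
  then have [measurable]: "U n \<in> borel_measurable \<mu>" for n by (auto simp: L2_space_def)
  have "\<exists>M. \<forall>i\<ge>M. \<forall>k\<ge>M. nrm (U i - U k) < (1 / 2) ^ m" for m :: nat
    by (rule L2.cauchy_seqsD[OF U]) simp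
  then obtain M where M: "\<And>m i k. i \<ge> M m \<Longrightarrow> k \<ge> M m \<Longrightarrow> nrm (U i - U k) < (1 / 2) ^ m"
    by metis
  \<comment> \<open>An increasing choice of indices beyond the thresholds \<open>M\<close>.\<close>
  define s where "s k = (\<Sum>i\<le>k. M i) + k" for k
  have sM: "s k \<ge> M k" for k unfolding s_def by (simp add: member_le_sum trans_le_add1)
  have smono: "s k \<le> s (Suc k)" for k by (simp add: s_def)
  have sk: "s k \<ge> k" for k by (simp add: s_def)
  define g where "g k x = \<bar>U (s (Suc k)) x - U (s k) x\<bar>" for k x
  have gm [measurable]: "g k \<in> borel_measurable \<mu>" for k unfolding g_def by measurable
  define c where "c = nrm (\<lambda>_. 1)"
  have c0: "c \<ge> 0" by (simp add: c_def)
  have gint: "(\<integral>\<^sup>+x. ennreal (g k x) \<partial>\<mu>) \<le> ennreal ((1 / 2) ^ k * c)" for k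
  proof -
    have V: "U (s (Suc k)) - U (s k) \<in> L2_space \<alpha> \<gamma>" by (rule L2.V_minus[OF UV UV])
    have "nrm (U (s (Suc k)) - U (s k)) \<le> (1 / 2) ^ k"
      using M[of k "s (Suc k)" "s k"] sM[of k] smono[of k] by simp
    then have "(LINT x|\<mu>. g k x) \<le> (1 / 2) ^ k * c"
      using order_trans[OF L1_le_L2[OF V] mult_right_mono] c0 by (simp add: g_def c_def)
    moreover have "integrable \<mu> (g k)"
      using L2_integrable[OF L2_abs[OF V]] by (simp add: g_def[abs_def])
    moreover have "AE x in \<mu>. 0 \<le> g k x" by (simp add: g_def)
    ultimately have "(\<integral>\<^sup>+x. ennreal (g k x) \<partial>\<mu>) = ennreal (LINT x|\<mu>. g k x)"
      by (intro nn_integral_eq_integral)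
    also have "\<dots> \<le> ennreal ((1 / 2) ^ k * c)" by (rule ennreal_leI) fact
    finally show ?thesis .
  qed
  have "(\<integral>\<^sup>+x. (\<Sum>k. ennreal (g k x)) \<partial>\<mu>) = (\<Sum>k. \<integral>\<^sup>+x. ennreal (g k x) \<partial>\<mu>)"
    by (rule nn_integral_suminf) measurable
  also have "\<dots> \<le> (\<Sum>k. ennreal ((1 / 2) ^ k * c))" by (intro suminf_le gint) auto
  also have "\<dots> = ennreal (\<Sum>k. (1 / 2) ^ k * c)"
    using c0 by (intro suminf_ennreal2 summable_mult2 summable_geometric) auto
  finally have "(\<integral>\<^sup>+x. (\<Sum>k. ennreal (g k x)) \<partial>\<mu>) \<noteq> \<infinity>" by (auto simp: top_unique)
  then have "AE x in \<mu>. (\<Sum>k. ennreal (g k x)) \<noteq> \<infinity>" by (intro nn_integral_noteq_infinite) auto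
  then have AE: "AE x in \<mu>. convergent (\<lambda>k. U (s k) x)"
  proof (rule eventually_mono)
    fix x assume "(\<Sum>k. ennreal (g k x)) \<noteq> \<infinity>"
    then have "summable (\<lambda>k. g k x)" by (intro summable_suminf_not_top) (auto simp: g_def)
    then have "summable (\<lambda>k. U (s (Suc k)) x - U (s k) x)"
      unfolding g_def real_norm_def[symmetric] by (rule summable_norm_cancel)
    then have "convergent (\<lambda>n. \<Sum>k<n. U (s (Suc k)) x - U (s k) x)"
      by (simp add: summable_iff_convergent)
    then have "convergent (\<lambda>n. U (s n) x - U (s 0) x)" by (simp only: sum_lessThan_telescope[of "\<lambda>n. U (s n) x"])
    then show "convergent (\<lambda>k. U (s k) x)" using convergent_diff_const_right_iff by blast
  qed
  define f where "f x = lim (\<lambda>k. U (s k) x)" for x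
  have [measurable]: "f \<in> borel_measurable \<mu>" unfolding f_def[abs_def] by measurable
  have AEf: "AE x in \<mu>. (\<lambda>k. U (s k) x) \<longlonglongrightarrow> f x"
    using AE by (auto simp: f_def convergent_LIMSEQ_iff elim: eventually_mono)
  have bound: "(\<integral>\<^sup>+x. ennreal ((U n x - f x)\<^sup>2) \<partial>\<mu>) \<le> ennreal (e\<^sup>2)"
    if e: "e > 0" and n: "\<And>i. i \<ge> n \<Longrightarrow> nrm (U n - U i) < e" for n e
  proof -
    have "(\<integral>\<^sup>+x. ennreal ((U n x - f x)\<^sup>2) \<partial>\<mu>)
        = (\<integral>\<^sup>+x. liminf (\<lambda>k. ennreal ((U n x - U (s k) x)\<^sup>2)) \<partial>\<mu>)"
    proof (rule nn_integral_cong_AE, rule eventually_mono[OF AEf])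
      fix x assume "(\<lambda>k. U (s k) x) \<longlonglongrightarrow> f x"
      then have "(\<lambda>k. ennreal ((U n x - U (s k) x)\<^sup>2)) \<longlonglongrightarrow> ennreal ((U n x - f x)\<^sup>2)"
        by (intro tendsto_intros)
      then show "ennreal ((U n x - f x)\<^sup>2) = liminf (\<lambda>k. ennreal ((U n x - U (s k) x)\<^sup>2))"
        using lim_imp_Liminf[OF trivial_limit_sequentially] by metis
    qed
    also have "\<dots> \<le> liminf (\<lambda>k. \<integral>\<^sup>+x. ennreal ((U n x - U (s k) x)\<^sup>2) \<partial>\<mu>)"
      by (rule nn_integral_liminf) measurable
    also have "\<dots> \<le> limsup (\<lambda>k. \<integral>\<^sup>+x. ennreal ((U n x - U (s k) x)\<^sup>2) \<partial>\<mu>)"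
      by (rule Liminf_le_Limsup) simp
    also have "\<dots> \<le> ennreal (e\<^sup>2)"
    proof (rule Limsup_bounded, rule eventually_sequentiallyI[of n])
      fix k assume "k \<ge> n"
      then have "nrm (U n - U (s k)) < e" using n[of "s k"] sk[of k] by simp
      then have "(nrm (U n - U (s k)))\<^sup>2 \<le> e\<^sup>2" by (intro power_mono) auto
      then show "(\<integral>\<^sup>+x. ennreal ((U n x - U (s k) x)\<^sup>2) \<partial>\<mu>) \<le> ennreal (e\<^sup>2)"
        using nn_integral_sq_eq_nrm[OF L2.V_minus[OF UV UV], of n "s k"] by (simp add: ennreal_leI)
    qed
    finally show ?thesis .
  qed
  have dV: "U n - f \<in> L2_space \<alpha> \<gamma>" and dn: "nrm (U n - f) \<le> e"
    if e: "e > 0" and n: "\<And>i. i \<ge> n \<Longrightarrow> nrm (U n - U i) < e" for n e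
  proof -
    have "integrable \<mu> (\<lambda>x. (U n x - f x)\<^sup>2)"
      unfolding integrable_iff_bounded using bound[OF that] by (auto simp: less_top[symmetric] top_unique)
    then show V: "U n - f \<in> L2_space \<alpha> \<gamma>" by (simp add: L2_space_def fun_diff_def)
    have "ennreal ((nrm (U n - f))\<^sup>2) \<le> ennreal (e\<^sup>2)"
      using bound[OF that] nn_integral_sq_eq_nrm[OF V] by simp
    then have "(nrm (U n - f))\<^sup>2 \<le> e\<^sup>2" by simp
    then show "nrm (U n - f) \<le> e" by (rule power2_le_imp_le) (use e in simp)
  qed
  have fV: "f \<in> L2_space \<alpha> \<gamma>"
  proof -
    have "U (M 0) - f \<in> L2_space \<alpha> \<gamma>" by (rule dV[of 1]) (use M[where m = 0] in auto)
    then have "U (M 0) - (U (M 0) - f) \<in> L2_space \<alpha> \<gamma>" by (rule L2.V_minus[OF UV])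
    moreover have "U (M 0) - (U (M 0) - f) = f" by (simp add: fun_eq_iff)
    ultimately show ?thesis by simp
  qed
  have "(\<lambda>n. nrm (U n - f)) \<longlonglongrightarrow> 0"
  proof (rule LIMSEQ_I)
    fix e :: real assume "e > 0"
    then obtain N where N: "\<forall>i\<ge>N. \<forall>k\<ge>N. nrm (U i - U k) < e / 2"
      using L2.cauchy_seqsD[OF U, of "e / 2"] by auto
    have "nrm (U n - f) < e" if "n \<ge> N" for n
      using dn[of "e / 2" n] N that \<open>e > 0\<close> by force
    then show "\<exists>N. \<forall>n\<ge>N. norm (nrm (U n - f) - 0) < e" by auto
  qed
  then show ?thesis using fV by blast
qed

end

section \<open>Differentiability up to the boundary and Dunkl operators\<close>

subsection \<open>Functions with partial derivatives continuous up to the boundary\<close>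

text \<open>
  Membership in the ball occurs as a side condition throughout and is kept folded.
\<close>

declare mem_ball [simp del] mem_ball_0 [simp del] mem_cball [simp del] mem_cball_0 [simp del]
  C_closed_ball.simps [simp del]

lemma DERIV_affine:
  fixes f :: "real \<Rightarrow> real"
  assumes "(f has_field_derivative D) (at (c * t + d))"
  shows "((\<lambda>s. f (c * s + d)) has_field_derivative D * c) (at t within S)"
  by (rule DERIV_chain2[of f D "\<lambda>s. c * s + d" t c S, OF assms]) (auto intro!: derivative_eq_intros)

lemma eventually_line_in_ball:
  assumes "x \<in> ball (0 :: real ^ 'n) 1"
  shows "\<forall>\<^sub>F t in nhds 0. x + t *\<^sub>R axis j 1 \<in> ball 0 1"
proof -
  have "((\<lambda>t. x + t *\<^sub>R axis j 1) \<longlongrightarrow> x + 0 *\<^sub>R axis j 1) (nhds 0)"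
    by (intro tendsto_intros) (simp add: filterlim_ident)
  then show ?thesis
    using topological_tendstoD[of _ x "nhds 0" "ball 0 1"] assms by simp
qed

lemma line_derivative_cong:
  fixes x :: "real ^ 'n"
  assumes "x \<in> ball 0 1" and "\<And>y. y \<in> ball 0 1 \<Longrightarrow> u y = v y"
  shows "((\<lambda>t. u (x + t *\<^sub>R axis j 1)) has_field_derivative D) (at 0) \<longleftrightarrow>
         ((\<lambda>t. v (x + t *\<^sub>R axis j 1)) has_field_derivative D) (at 0)"
  by (rule DERIV_cong_ev)
     (use eventually_line_in_ball[OF assms(1), of j] assms(2) in \<open>auto elim: eventually_mono\<close>)

lemma partial_derivI:
  "((\<lambda>t. u (x + t *\<^sub>R axis j 1)) has_field_derivative D) (at 0) \<Longrightarrow> partial_deriv j u x = D"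
  by (simp add: partial_deriv_def DERIV_imp_deriv)

lemma partial_deriv_cong:
  assumes "x \<in> ball 0 1" "\<And>y. y \<in> ball 0 1 \<Longrightarrow> u y = v y"
  shows "partial_deriv j u x = partial_deriv j v x"
  unfolding partial_deriv_def
  by (rule deriv_cong_ev)
     (use eventually_line_in_ball[OF assms(1), of j] assms(2) in \<open>auto elim: eventually_mono\<close>)

lemma Cball_SucD:
  assumes "u \<in> Cball (Suc m)"
  shows "u \<in> Cball 0" "partial_deriv j u \<in> Cball m"
    "x \<in> ball 0 1 \<Longrightarrow> ((\<lambda>t. u (x + t *\<^sub>R axis j 1)) has_field_derivative partial_deriv j u x) (at 0)"
  using assms by (auto simp: C_closed_ball.simps partial_deriv_def DERIV_deriv_iff_field_differentiable)

lemma Cball_cong: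
  "(\<And>x. x \<in> ball 0 1 \<Longrightarrow> u x = v x) \<Longrightarrow> u \<in> Cball m \<longleftrightarrow> v \<in> Cball m"
proof (induction m arbitrary: u v)
  case 0
  then show ?case by (simp add: C_closed_ball.simps cont_upto_boundary_def)
next
  case (Suc m)
  have "cont_upto_boundary u \<longleftrightarrow> cont_upto_boundary v"
    using Suc.prems by (simp add: cont_upto_boundary_def)
  moreover have "partial_deriv j u \<in> Cball m \<longleftrightarrow> partial_deriv j v \<in> Cball m" for j
    by (rule Suc.IH) (rule partial_deriv_cong, use Suc.prems in auto)
  moreover have "(\<lambda>t. u (x + t *\<^sub>R axis j 1)) field_differentiable (at 0) \<longleftrightarrow>
      (\<lambda>t. v (x + t *\<^sub>R axis j 1)) field_differentiable (at 0)" if "x \<in> ball 0 1" for j x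
    unfolding field_differentiable_def
    using line_derivative_cong[of x u v, OF that Suc.prems] by blast
  ultimately show ?case by (simp add: C_closed_ball.simps)
qed

lemma Cball_SucI:
  assumes "u \<in> Cball 0" and d: "\<And>j. d j \<in> Cball m"
    and der: "\<And>j x. x \<in> ball 0 1 \<Longrightarrow> ((\<lambda>t. u (x + t *\<^sub>R axis j 1)) has_field_derivative d j x) (at 0)"
  shows "u \<in> Cball (Suc m)"
proof -
  have "partial_deriv j u \<in> Cball m" for j
    using Cball_cong[of "partial_deriv j u" "d j" m] partial_derivI[OF der] d by blast
  moreover have "(\<lambda>t. u (x + t *\<^sub>R axis j 1)) field_differentiable (at 0)" if "x \<in> ball 0 1" for x j
    using der[OF that] unfolding field_differentiable_def by blast
  ultimately show ?thesis using assms(1) by (simp add: C_closed_ball.simps)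
qed

lemma Cball_Suc_subset: "u \<in> Cball (Suc m) \<Longrightarrow> u \<in> Cball m"
proof (induction m arbitrary: u)
  case 0
  then show ?case by (rule Cball_SucD(1))
next
  case (Suc m)
  show ?case
    by (rule Cball_SucI[where d = "\<lambda>j. partial_deriv j u"])
       (use Cball_SucD[OF Suc.prems] Suc.IH in auto)
qed

lemma Cball_mono: "m \<le> n \<Longrightarrow> u \<in> Cball n \<Longrightarrow> u \<in> Cball m"
  by (induction n rule: nat_induct_at_least) (auto dest: Cball_Suc_subset)

lemma Cball_0: "u \<in> Cball m \<Longrightarrow> u \<in> Cball 0"
  using Cball_mono by blast

lemma Cball_const [intro]: "(\<lambda>_. c) \<in> Cball m"
proof (induction m arbitrary: c)
  case 0
  show ?case by (rule Cball_0I[of "\<lambda>_. c"]) auto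
next
  case (Suc m)
  have "(\<lambda>_. c) \<in> Cball 0" by (rule Cball_0I[of "\<lambda>_. c"]) auto
  then show ?case
    by (rule Cball_SucI[where d = "\<lambda>_ _. 0"]) (use Suc in auto)
qed

lemma Cball_coord [intro]: "(\<lambda>x. x $ i) \<in> Cball m"
proof -
  have 0: "(\<lambda>x. x $ i) \<in> Cball 0"
    by (rule Cball_0I[of "\<lambda>x. x $ i"]) (auto intro!: continuous_intros)
  show ?thesis
  proof (cases m)
    case (Suc k)
    show ?thesis unfolding Suc
    proof (rule Cball_SucI[where d = "\<lambda>j _. axis j 1 $ i", OF 0])
      show "((\<lambda>t. (x + t *\<^sub>R axis j 1) $ i) has_field_derivative axis j 1 $ i) (at 0)" for j x
        by (auto intro!: derivative_eq_intros)
    qed auto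
  qed (use 0 in auto)
qed

lemma Cball_0_add: "f \<in> Cball 0 \<Longrightarrow> g \<in> Cball 0 \<Longrightarrow> (\<lambda>x. f x + g x) \<in> Cball 0"
proof (elim Cball_0E)
  fix f' g' assume "continuous_on (cball 0 1) f'" "\<And>x. x \<in> ball 0 1 \<Longrightarrow> f' x = f x"
    "continuous_on (cball 0 1) g'" "\<And>x. x \<in> ball 0 1 \<Longrightarrow> g' x = g x"
  then show ?thesis by (intro Cball_0I[of "\<lambda>x. f' x + g' x"] continuous_intros) auto
qed

lemma Cball_add [intro]: "f \<in> Cball m \<Longrightarrow> g \<in> Cball m \<Longrightarrow> (\<lambda>x. f x + g x) \<in> Cball m"
proof (induction m arbitrary: f g)
  case 0
  then show ?case by (rule Cball_0_add)
next
  case (Suc m)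
  note f = Cball_SucD[OF Suc.prems(1)] and g = Cball_SucD[OF Suc.prems(2)]
  have "(\<lambda>x. f x + g x) \<in> Cball 0"
    using f(1) g(1) by (rule Cball_0_add)
  then show ?case
    by (rule Cball_SucI[where d = "\<lambda>j x. partial_deriv j f x + partial_deriv j g x"])
       (auto intro!: Suc.IH f g DERIV_add)
qed

lemma Cball_0_mult: "f \<in> Cball 0 \<Longrightarrow> g \<in> Cball 0 \<Longrightarrow> (\<lambda>x. f x * g x) \<in> Cball 0"
proof (elim Cball_0E)
  fix f' g' assume "continuous_on (cball 0 1) f'" "\<And>x. x \<in> ball 0 1 \<Longrightarrow> f' x = f x"
    "continuous_on (cball 0 1) g'" "\<And>x. x \<in> ball 0 1 \<Longrightarrow> g' x = g x"
  then show ?thesis by (intro Cball_0I[of "\<lambda>x. f' x * g' x"] continuous_intros) auto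
qed

lemma Cball_mult [intro]: "f \<in> Cball m \<Longrightarrow> g \<in> Cball m \<Longrightarrow> (\<lambda>x. f x * g x) \<in> Cball m"
proof (induction m arbitrary: f g)
  case 0
  then show ?case by (rule Cball_0_mult)
next
  case (Suc m)
  note f = Cball_SucD[OF Suc.prems(1)] and g = Cball_SucD[OF Suc.prems(2)]
  have 0: "(\<lambda>x. f x * g x) \<in> Cball 0"
    using f(1) g(1) by (rule Cball_0_mult)
  show ?case
  proof (rule Cball_SucI[where d = "\<lambda>j x. partial_deriv j f x * g x + partial_deriv j g x * f x", OF 0])
    fix j
    show "(\<lambda>x. partial_deriv j f x * g x + partial_deriv j g x * f x) \<in> Cball m"
      by (intro Cball_add Suc.IH f(2) g(2) Suc.prems[THEN Cball_Suc_subset])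
    fix x :: "real ^ 'a" assume "x \<in> ball 0 1"
    from DERIV_mult[OF f(3)[OF this] g(3)[OF this], of j j]
    show "((\<lambda>t. f (x + t *\<^sub>R axis j 1) * g (x + t *\<^sub>R axis j 1)) has_field_derivative
        partial_deriv j f x * g x + partial_deriv j g x * f x) (at 0)" by simp
  qed
qed

lemma Cball_scale [intro]: "f \<in> Cball m \<Longrightarrow> (\<lambda>x. c * f x) \<in> Cball m"
  by (intro Cball_mult Cball_const)

lemma Cball_minus [intro]: "f \<in> Cball m \<Longrightarrow> g \<in> Cball m \<Longrightarrow> (\<lambda>x. f x - g x) \<in> Cball m"
  using Cball_add[of f m "\<lambda>x. (-1) * g x"] Cball_scale[of g m "-1"] by simp

lemma Cball_fun_minus [intro]: "f \<in> Cball m \<Longrightarrow> g \<in> Cball m \<Longrightarrow> f - g \<in> Cball m"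
  unfolding fun_diff_def by (rule Cball_minus)

lemma Cball_sum [intro]: "(\<And>i. i \<in> I \<Longrightarrow> f i \<in> Cball m) \<Longrightarrow> (\<lambda>x. \<Sum>i\<in>I. f i x) \<in> Cball m"
  by (induction I rule: infinite_finite_induct) auto

lemma Cball_prod [intro]: "(\<And>i. i \<in> I \<Longrightarrow> f i \<in> Cball m) \<Longrightarrow> (\<lambda>x. \<Prod>i\<in>I. f i x) \<in> Cball m"
  by (induction I rule: infinite_finite_induct) auto

lemma Cball_power [intro]: "f \<in> Cball m \<Longrightarrow> (\<lambda>x. f x ^ k) \<in> Cball m"
  by (induction k) auto

lemma norm_sq_eq_sum: "(norm (x :: real ^ 'n))\<^sup>2 = (\<Sum>i\<in>UNIV. (x $ i)\<^sup>2)"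
  by (simp add: norm_vec_def L2_set_def sum_nonneg)

lemma Cball_norm_sq [intro]: "(\<lambda>x. (norm x)\<^sup>2) \<in> Cball m"
  unfolding norm_sq_eq_sum by (intro Cball_sum Cball_power Cball_coord)

lemma norm_sq_line_deriv:
  "((\<lambda>t. (norm (x + t *\<^sub>R axis j 1 :: real ^ 'n))\<^sup>2) has_field_derivative 2 * x $ j) (at 0)"
proof -
  have "(norm (x + t *\<^sub>R axis j 1))\<^sup>2 = (norm x)\<^sup>2 + 2 * t * x $ j + t\<^sup>2" for t
    unfolding power2_norm_eq_inner
    by (simp add: inner_add_left inner_add_right inner_axis inner_axis' algebra_simps power2_eq_square)
  then show ?thesis by (auto intro!: derivative_eq_intros)
qed

lemma reflect_in_cball [simp]: "reflect j x \<in> cball 0 1 \<longleftrightarrow> x \<in> cball 0 1"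
  by (simp add: mem_cball_0)

lemma reflect_line: "reflect i (x + t *\<^sub>R axis j 1) = reflect i x + ((if i = j then -1 else 1) * t) *\<^sub>R axis j 1"
  by (auto simp: vec_eq_iff reflect_nth axis_def)

lemma partial_deriv_reflect:
  assumes u: "u \<in> Cball (Suc m)" and x: "x \<in> ball 0 1"
  shows "((\<lambda>t. u (reflect i (x + t *\<^sub>R axis j 1))) has_field_derivative
           (if i = j then -1 else 1) * partial_deriv j u (reflect i x)) (at 0)"
proof -
  define c where "c = (if i = j then -1 else 1 :: real)"
  have "reflect i x \<in> ball 0 1" using x by simp
  from Cball_SucD(3)[OF u this, of j]
  have "((\<lambda>t. u (reflect i x + t *\<^sub>R axis j 1)) has_field_derivative partial_deriv j u (reflect i x))
      (at (c * 0 + 0))" by simp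
  from DERIV_affine[OF this]
  show ?thesis unfolding reflect_line c_def[symmetric] by (simp add: mult.commute)
qed

lemma Cball_reflect: "u \<in> Cball m \<Longrightarrow> (\<lambda>x. u (reflect i x)) \<in> Cball m"
proof (induction m arbitrary: u)
  case 0
  obtain g where g: "continuous_on (cball 0 1) g" "\<And>x. x \<in> ball 0 1 \<Longrightarrow> g x = u x"
    using 0 by (rule Cball_0E) blast
  show ?case
    by (rule Cball_0I[of "\<lambda>x. g (reflect i x)"])
       (auto intro!: continuous_on_compose2[OF g(1)] continuous_intros simp: g(2))
next
  case (Suc m)
  note u = Cball_SucD[OF Suc.prems]
  obtain g where g: "continuous_on (cball 0 1) g" "\<And>x. x \<in> ball 0 1 \<Longrightarrow> g x = u x"
    using u(1) by (rule Cball_0E) blast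
  have 0: "(\<lambda>x. u (reflect i x)) \<in> Cball 0"
    by (rule Cball_0I[of "\<lambda>x. g (reflect i x)"])
       (auto intro!: continuous_on_compose2[OF g(1)] continuous_intros simp: g(2))
  show ?case
    by (rule Cball_SucI[OF 0 Cball_scale partial_deriv_reflect[OF Suc.prems]], rule Suc.IH, rule u(2))
qed

lemma line_derivative_at:
  assumes u: "u \<in> Cball (Suc m)" and x: "x + s *\<^sub>R axis j 1 \<in> ball 0 1"
  shows "((\<lambda>t. u (x + t *\<^sub>R axis j 1)) has_field_derivative partial_deriv j u (x + s *\<^sub>R axis j 1)) (at s)"
proof -
  have "((\<lambda>t. u (x + s *\<^sub>R axis j 1 + t *\<^sub>R axis j 1)) has_field_derivative
      partial_deriv j u (x + s *\<^sub>R axis j 1)) (at 0)" by (rule Cball_SucD(3)[OF u x])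
  then have "((\<lambda>t. u (x + (t + s) *\<^sub>R axis j 1)) has_field_derivative
      partial_deriv j u (x + s *\<^sub>R axis j 1)) (at 0)" by (simp add: algebra_simps)
  then show ?thesis using DERIV_shift[of "\<lambda>t. u (x + t *\<^sub>R axis j 1)" _ 0 s] by simp
qed

subsection \<open>The difference quotients in the Dunkl operators\<close>

definition scale_coord :: "'n \<Rightarrow> real \<Rightarrow> real ^ 'n \<Rightarrow> real ^ 'n" where
  "scale_coord j t x = x + ((t - 1) * x $ j) *\<^sub>R axis j 1"

text \<open>
  The moments \<open>t\<^sup>k\<close> make the family closed under differentiation: a derivative in the direction of
  \<open>e\<^sub>j\<close> turns \<open>k\<close> into \<open>k + 1\<close>.
\<close>

definition line_average :: "'n \<Rightarrow> nat \<Rightarrow> (real ^ 'n \<Rightarrow> real) \<Rightarrow> real ^ 'n \<Rightarrow> real" where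
  "line_average j k v x = integral (cbox (-1) 1) (\<lambda>t. t ^ k * v (scale_coord j t x))"

lemma scale_coord_nth: "scale_coord j t x $ i = (if i = j then t * x $ i else x $ i)"
  by (auto simp: scale_coord_def axis_def algebra_simps)

lemma norm_scale_coord_le:
  assumes "t \<in> cbox (-1) 1" shows "norm (scale_coord j t x) \<le> norm x"
proof -
  have "\<bar>t\<bar> \<le> 1" using assms by auto
  then show ?thesis
    by (intro norm_le_componentwise_cart)
       (auto simp: scale_coord_nth abs_mult mult_left_le_one_le)
qed

lemma scale_coord_ball: "t \<in> cbox (-1) 1 \<Longrightarrow> x \<in> ball 0 1 \<Longrightarrow> scale_coord j t x \<in> ball 0 1"
  using norm_scale_coord_le[of t j x] by (simp add: mem_ball_0 del: mem_box)

lemma scale_coord_cball: "t \<in> cbox (-1) 1 \<Longrightarrow> x \<in> cball 0 1 \<Longrightarrow> scale_coord j t x \<in> cball 0 1"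
  using norm_scale_coord_le[of t j x] by (simp add: mem_cball_0 del: mem_box)

lemma scale_coord_continuous [continuous_intros]:
  "continuous_on S f \<Longrightarrow> continuous_on S g \<Longrightarrow> continuous_on S (\<lambda>p. scale_coord j (f p) (g p))"
  unfolding scale_coord_def by (intro continuous_intros)

lemma scale_coord_line:
  "scale_coord j t (x + s *\<^sub>R axis i 1) = scale_coord j t x + ((if i = j then t else 1) * s) *\<^sub>R axis i 1"
  by (auto simp: vec_eq_iff scale_coord_nth axis_def algebra_simps)

lemma line_average_Cball_0:
  assumes "v \<in> Cball 0" shows "line_average j k v \<in> Cball 0"
proof -
  obtain g where g: "continuous_on (cball 0 1) g" "\<And>x. x \<in> ball 0 1 \<Longrightarrow> g x = v x"
    using assms by (rule Cball_0E) blast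
  have "continuous_on (cball 0 1 \<times> cbox (-1) 1) (\<lambda>p. snd p ^ k * g (scale_coord j (snd p) (fst p)))"
    by (intro continuous_intros continuous_on_compose2[OF g(1)])
       (auto simp del: mem_box intro!: scale_coord_cball)
  then have "continuous_on (cball 0 1) (line_average j k g)"
    unfolding line_average_def by (intro integral_continuous_on_param) (simp add: split_beta')
  then show ?thesis
    by (rule Cball_0I)
       (auto simp: line_average_def scale_coord_ball g(2) simp del: mem_box mult_eq_0_iff mult_cancel_left
         intro!: integral_cong)
qed

lemma line_average_deriv:
  assumes v: "v \<in> Cball (Suc m)" and x: "x \<in> ball 0 1"
  shows "((\<lambda>s. line_average j k v (x + s *\<^sub>R axis i 1)) has_field_derivative
    line_average j (if i = j then Suc k else k) (partial_deriv i v) x) (at 0)"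
proof -
  define c where "c t = (if i = j then 1 else 0) * t + (if i = j then 0 else 1 :: real)" for t
  have c: "(if i = j then t else 1) = c t" for t by (simp add: c_def)
  define U where "U = {s. x + s *\<^sub>R axis i 1 \<in> ball 0 1}"
  have cont_v': "continuous_on (ball 0 1) (partial_deriv i v)" and cont_v: "continuous_on (ball 0 1) v"
    using Cball_SucD[OF v] Cball_0 Cball_0_continuous by blast+
  have Uo: "open U" unfolding U_def
    using continuous_open_vimage[of "ball 0 1" "\<lambda>s. x + s *\<^sub>R axis i 1"]
    by (auto simp: vimage_def intro!: continuous_intros)
  have Uc: "convex U"
  proof -
    have "U = (\<lambda>s. x + s *\<^sub>R axis i 1) -` ball 0 1" by (auto simp: U_def)
    also have "\<dots> = (\<lambda>s. s *\<^sub>R axis i 1) -` ((\<lambda>y. x + y) -` ball 0 1)" by auto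
    also have "(\<lambda>y. x + y) -` ball 0 1 = ball (-x) 1" by (auto simp: mem_ball dist_norm norm_minus_commute add.commute)
    finally show ?thesis
      by (simp add: convex_linear_vimage linear_scaleR_left)
  qed
  have 0: "0 \<in> U" using x by (simp add: U_def)
  have in_ball: "scale_coord j t x + (c t * s) *\<^sub>R axis i 1 \<in> ball 0 1" if "s \<in> U" "t \<in> cbox (-1) 1" for s t
    using scale_coord_ball[OF that(2), of "x + s *\<^sub>R axis i 1" j] that(1)
    unfolding scale_coord_line U_def c by blast
  define fx where "fx s t = t ^ k * (c t * partial_deriv i v (scale_coord j t x + (c t * s) *\<^sub>R axis i 1))" for s t
  have "((\<lambda>s. integral (cbox (-1) 1) (\<lambda>t. t ^ k * v (scale_coord j t x + (c t * s) *\<^sub>R axis i 1)))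
      has_field_derivative integral (cbox (-1) 1) (fx 0)) (at 0 within U)"
  proof (rule leibniz_rule_field_derivative[OF _ _ _ 0 Uc])
    fix s t :: real assume s: "s \<in> U" and t: "t \<in> cbox (-1) 1"
    have "((\<lambda>s. v (scale_coord j t x + s *\<^sub>R axis i 1)) has_field_derivative
        partial_deriv i v (scale_coord j t x + (c t * s) *\<^sub>R axis i 1)) (at (c t * s))"
      by (rule line_derivative_at[OF v in_ball[OF s t]])
    then have "((\<lambda>s. v (scale_coord j t x + s *\<^sub>R axis i 1)) has_field_derivative
        partial_deriv i v (scale_coord j t x + (c t * s) *\<^sub>R axis i 1)) (at (c t * s + 0))" by simp
    from DERIV_affine[OF this, of U]
    have "((\<lambda>s. v (scale_coord j t x + (c t * s) *\<^sub>R axis i 1)) has_field_derivative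
        partial_deriv i v (scale_coord j t x + (c t * s) *\<^sub>R axis i 1) * c t) (at s within U)" by simp
    from DERIV_cmult[OF this, of "t ^ k"]
    show "((\<lambda>s. t ^ k * v (scale_coord j t x + (c t * s) *\<^sub>R axis i 1)) has_field_derivative fx s t)
        (at s within U)" by (simp add: fx_def mult_ac)
  next
    fix s assume s: "s \<in> U"
    show "(\<lambda>t. t ^ k * v (scale_coord j t x + (c t * s) *\<^sub>R axis i 1)) integrable_on cbox (-1) 1"
    proof (rule integrable_continuous, intro continuous_intros continuous_on_compose2[OF cont_v])
      show "continuous_on (cbox (-1) 1) c"
        unfolding c_def[abs_def] by (intro continuous_intros)
    qed (use in_ball[OF s] in auto)
  next
    show "continuous_on (U \<times> cbox (-1) 1) (\<lambda>(s, t). fx s t)"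
      unfolding fx_def split_beta'
    proof (intro continuous_intros continuous_on_compose2[OF cont_v'])
      show "continuous_on (U \<times> cbox (-1) 1) (\<lambda>p. c (snd p))"
        and "continuous_on (U \<times> cbox (-1) 1) (\<lambda>p. c (snd p))"
        unfolding c_def by (intro continuous_intros)+
    qed (use in_ball in auto)
  qed
  then have "((\<lambda>s. integral (cbox (-1) 1) (\<lambda>t. t ^ k * v (scale_coord j t x + (c t * s) *\<^sub>R axis i 1)))
      has_field_derivative integral (cbox (-1) 1) (fx 0)) (at 0)"
    using at_within_open[OF 0 Uo] by simp
  moreover have "integral (cbox (-1) 1) (fx 0) = line_average j (if i = j then Suc k else k) (partial_deriv i v) x"
    unfolding line_average_def by (rule integral_cong) (simp add: fx_def c_def)
  moreover have "line_average j k v (x + s *\<^sub>R axis i 1)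
      = integral (cbox (-1) 1) (\<lambda>t. t ^ k * v (scale_coord j t x + (c t * s) *\<^sub>R axis i 1))" for s
    unfolding line_average_def scale_coord_line c ..
  ultimately show ?thesis by simp
qed

lemma line_average_Cball: "v \<in> Cball m \<Longrightarrow> line_average j k v \<in> Cball m"
proof (induction m arbitrary: v k)
  case 0
  then show ?case by (rule line_average_Cball_0)
next
  case (Suc m)
  note v = Cball_SucD[OF Suc.prems]
  show ?case
    by (rule Cball_SucI[OF line_average_Cball_0[OF v(1)] _ line_average_deriv[OF Suc.prems]])
       (rule Suc.IH, rule v(2))
qed

text \<open>
  Written as an average of the partial derivative, the difference quotient makes sense across the
  hyperplane \<open>x\<^sub>j = 0\<close> and inherits the smoothness of that derivative.
\<close>

lemma dunkl_eq_average:
  assumes u: "u \<in> Cball (Suc m)" and x: "x \<in> ball 0 1"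
  shows "dunkl \<gamma> j u x = partial_deriv j u x + \<gamma> $ j / 2 * line_average j 0 (partial_deriv j u) x"
proof (cases "x $ j = 0")
  case True
  then have "scale_coord j t x = x" for t by (simp add: scale_coord_def)
  then show ?thesis using True by (simp add: dunkl_def line_average_def)
next
  case False
  have der: "((\<lambda>t. u (scale_coord j t x)) has_vector_derivative
      x $ j * partial_deriv j u (scale_coord j t x)) (at t within cbox (-1) 1)" if t: "t \<in> cbox (-1) 1" for t
  proof -
    have eq: "scale_coord j t x = x + (x $ j * t + (- (x $ j))) *\<^sub>R axis j 1" for t
      by (simp add: scale_coord_def algebra_simps)
    have "x + (x $ j * t + (- (x $ j))) *\<^sub>R axis j 1 \<in> ball 0 1"
      using scale_coord_ball[OF t x, of j] by (simp add: eq)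
    from DERIV_affine[OF line_derivative_at[OF u this]]
    have "((\<lambda>t. u (scale_coord j t x)) has_field_derivative
        partial_deriv j u (scale_coord j t x) * x $ j) (at t within cbox (-1) 1)"
      unfolding eq .
    then show ?thesis by (simp add: has_real_derivative_iff_has_vector_derivative mult.commute)
  qed
  have "((\<lambda>t. x $ j * partial_deriv j u (scale_coord j t x)) has_integral
      (u (scale_coord j 1 x) - u (scale_coord j (-1) x))) {-1..1}"
    by (rule fundamental_theorem_of_calculus) (use der in \<open>auto simp: cbox_interval\<close>)
  then have "u (scale_coord j 1 x) - u (scale_coord j (-1) x)
      = integral {-1..1} (\<lambda>t. x $ j * partial_deriv j u (scale_coord j t x))"
    by (rule integral_unique[symmetric])
  moreover have "scale_coord j 1 x = x" "scale_coord j (-1) x = reflect j x"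
    by (simp_all add: scale_coord_def reflect_def)
  moreover have "integral {-1..1} (\<lambda>t. x $ j * partial_deriv j u (scale_coord j t x))
      = x $ j * line_average j 0 (partial_deriv j u) x"
    by (simp add: line_average_def cbox_interval)
  ultimately have "u x - u (reflect j x) = x $ j * line_average j 0 (partial_deriv j u) x" by simp
  then show ?thesis using False by (simp add: dunkl_def)
qed

lemma dunkl_Cball:
  assumes "u \<in> Cball (Suc m)" shows "dunkl \<gamma> j u \<in> Cball m"
proof -
  have "(\<lambda>x. partial_deriv j u x + \<gamma> $ j / 2 * line_average j 0 (partial_deriv j u) x) \<in> Cball m"
    by (intro Cball_add Cball_scale line_average_Cball Cball_SucD(2)[OF assms])
  then show ?thesis by (subst Cball_cong[OF dunkl_eq_average[OF assms]])
qed

subsection \<open>Calculus of the Dunkl operators\<close>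

lemma Cball_partialI:
  assumes "u \<in> Cball (Suc m)" "x \<in> ball 0 1"
    and "((\<lambda>t. v (x + t *\<^sub>R axis j 1)) has_field_derivative D) (at 0)"
    and "\<And>y. y \<in> ball 0 1 \<Longrightarrow> v y = u y"
  shows "partial_deriv j u x = D"
  using partial_derivI[OF assms(3)] partial_deriv_cong[OF assms(2), of u v] assms(4) by simp

lemma partial_deriv_add:
  assumes "u \<in> Cball (Suc m)" "v \<in> Cball (Suc m)" "x \<in> ball 0 1"
  shows "partial_deriv j (\<lambda>x. u x + v x) x = partial_deriv j u x + partial_deriv j v x"
  by (rule partial_derivI, rule DERIV_add) (rule Cball_SucD(3)[OF assms(1,3)] Cball_SucD(3)[OF assms(2,3)])+

lemma partial_deriv_mult:
  assumes "u \<in> Cball (Suc m)" "v \<in> Cball (Suc m)" "x \<in> ball 0 1"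
  shows "partial_deriv j (\<lambda>x. u x * v x) x = partial_deriv j u x * v x + u x * partial_deriv j v x"
  using DERIV_mult[OF Cball_SucD(3)[OF assms(1,3)] Cball_SucD(3)[OF assms(2,3)], of j j]
  by (intro partial_derivI) (simp add: mult.commute)

lemma partial_deriv_const: "partial_deriv j (\<lambda>_. c) x = 0"
  by (rule partial_derivI) simp

lemma partial_deriv_coord: "partial_deriv j (\<lambda>x. x $ i) x = (if i = j then 1 else 0)"
  by (rule partial_derivI) (auto intro!: derivative_eq_intros simp: axis_def)

lemma dunkl_cong:
  "x \<in> ball 0 1 \<Longrightarrow> (\<And>y. y \<in> ball 0 1 \<Longrightarrow> u y = v y) \<Longrightarrow> dunkl \<gamma> j u x = dunkl \<gamma> j v x"
  using partial_deriv_cong[of x u v j] by (simp add: dunkl_def)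

lemma dunkl_add:
  assumes "u \<in> Cball (Suc m)" "v \<in> Cball (Suc m)" "x \<in> ball 0 1"
  shows "dunkl \<gamma> j (\<lambda>x. u x + v x) x = dunkl \<gamma> j u x + dunkl \<gamma> j v x"
  unfolding dunkl_def partial_deriv_add[OF assms]
  by (simp add: field_simps)

lemma dunkl_scale:
  assumes "u \<in> Cball (Suc m)" "x \<in> ball 0 1"
  shows "dunkl \<gamma> j (\<lambda>x. c * u x) x = c * dunkl \<gamma> j u x"
  unfolding dunkl_def partial_deriv_mult[OF Cball_const assms] partial_deriv_const
  by (simp add: field_simps)

lemma dunkl_minus:
  assumes "u \<in> Cball (Suc m)" "v \<in> Cball (Suc m)" "x \<in> ball 0 1"
  shows "dunkl \<gamma> j (u - v) x = dunkl \<gamma> j u x - dunkl \<gamma> j v x"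
  using dunkl_add[OF assms(1) Cball_scale[OF assms(2), of "-1"] assms(3), of \<gamma> j]
    dunkl_scale[OF assms(2,3), of \<gamma> j "-1"] by (simp add: fun_diff_def)

lemma partial_deriv_even:
  assumes g: "g \<in> Cball (Suc m)" and x: "x \<in> ball 0 1" "x $ j = 0"
    and even: "\<And>y. y \<in> ball 0 1 \<Longrightarrow> g (reflect j y) = g y"
  shows "partial_deriv j g x = 0"
proof -
  have r: "reflect j x = x" using x by (simp add: reflect_def)
  have "partial_deriv j g x = - partial_deriv j g x"
    using Cball_partialI[OF g x(1) partial_deriv_reflect[OF g x(1), of j j] even] by (simp add: r)
  then show ?thesis by simp
qed

lemma dunkl_mult_even:
  assumes g: "g \<in> Cball (Suc m)" and u: "u \<in> Cball (Suc m)" and x: "x \<in> ball 0 1"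
    and even: "\<And>y. y \<in> ball 0 1 \<Longrightarrow> g (reflect j y) = g y"
  shows "dunkl \<gamma> j (\<lambda>x. g x * u x) x = g x * dunkl \<gamma> j u x + partial_deriv j g x * u x"
proof (cases "x $ j = 0")
  case True
  then show ?thesis
    using partial_deriv_even[OF g x True even]
    unfolding dunkl_def partial_deriv_mult[OF g u x] by (simp add: algebra_simps)
next
  case False
  then show ?thesis unfolding dunkl_def partial_deriv_mult[OF g u x] even[OF x]
    by (simp add: field_simps)
qed

lemma coord_mult_dunkl:
  "x $ j * dunkl \<gamma> j u x = x $ j * partial_deriv j u x + \<gamma> $ j / 2 * (u x - u (reflect j x))"
proof (cases "x $ j = 0")
  case True
  then show ?thesis by (simp add: reflect_def)
next
  case False
  then show ?thesis by (simp add: dunkl_def distrib_left)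
qed

text \<open>The commutation relation between the Dunkl operators and the coordinates.\<close>

lemma dunkl_coord_mult:
  assumes u: "u \<in> Cball (Suc m)" and x: "x \<in> ball 0 1"
  shows "dunkl \<gamma> j (\<lambda>x. x $ i * u x) x =
    x $ i * dunkl \<gamma> j u x + (if i = j then u x + \<gamma> $ j * u (reflect j x) else 0)"
proof (cases "i = j")
  case True
  show ?thesis
  proof (cases "x $ j = 0")
    case True
    then have r: "reflect j x = x" by (simp add: reflect_def)
    show ?thesis using True \<open>i = j\<close> unfolding dunkl_def partial_deriv_mult[OF Cball_coord u x]
      by (simp add: partial_deriv_coord r algebra_simps)
  next
    case False
    then show ?thesis using \<open>i = j\<close> unfolding dunkl_def partial_deriv_mult[OF Cball_coord u x]
      by (simp add: partial_deriv_coord reflect_nth field_simps)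
  qed
next
  case False
  then show ?thesis
    using dunkl_mult_even[OF Cball_coord u x, of j i \<gamma>]
    by (simp add: partial_deriv_coord reflect_nth)
qed

lemma reflect_commute: "reflect i (reflect j x) = reflect j (reflect i x)"
  by (simp add: vec_eq_iff reflect_nth)

lemma dunkl_reflect:
  assumes u: "u \<in> Cball (Suc m)" and x: "x \<in> ball 0 1"
  shows "dunkl \<gamma> j (\<lambda>x. u (reflect i x)) x = (if i = j then -1 else 1) * dunkl \<gamma> j u (reflect i x)"
proof -
  note p = partial_derivI[OF partial_deriv_reflect[OF u x, of i j]]
  show ?thesis
  proof (cases "i = j")
    case True
    then show ?thesis unfolding dunkl_def p
      by (cases "x $ j = 0") (simp_all add: reflect_nth field_simps)
  next
    case False
    then show ?thesis unfolding dunkl_def p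
      by (simp add: reflect_nth reflect_commute[of j i])
  qed
qed

section \<open>Polynomials and orthogonal projections\<close>

subsection \<open>Polynomials of degree less than \<open>n\<close>\<close>

definition monomial :: "('n \<Rightarrow> nat) \<Rightarrow> real ^ 'n \<Rightarrow> real" where
  "monomial k x = (\<Prod>i\<in>UNIV. (x $ i) ^ k i)"

text \<open>
  Counting degrees strictly from above makes the zero space the first one, so that the orthogonal
  decomposition into the spaces of degree \<open>0, 1, \<dots>\<close> starts from nothing.
\<close>

definition polys_below :: "nat \<Rightarrow> (real ^ 'n \<Rightarrow> real) set" where
  "polys_below n = range (\<lambda>c x. \<Sum>k | sum k UNIV < n. c k * monomial k x)"

lemma polys_eq_below: "polys N = polys_below (Suc N)"
  by (simp add: polys_def polys_below_def monomial_def less_Suc_eq_le)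

lemma finite_multi_indices: "finite {k :: 'n::finite \<Rightarrow> nat. sum k UNIV < n}"
proof (rule finite_subset)
  show "{k :: 'n \<Rightarrow> nat. sum k UNIV < n} \<subseteq> Pi\<^sub>E UNIV (\<lambda>_. {..<n})"
  proof
    fix k :: "'n \<Rightarrow> nat" assume "k \<in> {k. sum k UNIV < n}"
    then have "k i < n" for i using member_le_sum[of i UNIV k] by simp
    then show "k \<in> Pi\<^sub>E UNIV (\<lambda>_. {..<n})" by (simp add: PiE_UNIV_domain)
  qed
qed (simp add: finite_PiE)

lemma below_zero [intro]: "(\<lambda>_. 0) \<in> polys_below n"
  unfolding polys_below_def by (rule range_eqI[of _ _ "\<lambda>_. 0"]) simp

lemma below_add [intro]:
  assumes "p \<in> polys_below n" "q \<in> polys_below n" shows "(\<lambda>x. p x + q x) \<in> polys_below n"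
proof -
  obtain c d where "p = (\<lambda>x. \<Sum>k | sum k UNIV < n. c k * monomial k x)"
    "q = (\<lambda>x. \<Sum>k | sum k UNIV < n. d k * monomial k x)"
    using assms by (auto simp: polys_below_def)
  then show ?thesis unfolding polys_below_def
    by (intro range_eqI[of _ _ "\<lambda>k. c k + d k"]) (simp add: sum.distrib distrib_right)
qed

lemma below_scale [intro]:
  assumes "p \<in> polys_below n" shows "(\<lambda>x. a * p x) \<in> polys_below n"
proof -
  obtain c where "p = (\<lambda>x. \<Sum>k | sum k UNIV < n. c k * monomial k x)"
    using assms by (auto simp: polys_below_def)
  then show ?thesis unfolding polys_below_def
    by (intro range_eqI[of _ _ "\<lambda>k. a * c k"]) (simp add: sum_distrib_left mult.assoc)
qed

lemma below_monomial [intro]: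
  assumes "sum k UNIV < n" shows "monomial k \<in> polys_below n"
  unfolding polys_below_def
proof (rule range_eqI[of _ _ "\<lambda>l. if l = k then 1 else 0"])
  have "(\<Sum>l | sum l UNIV < n. (if l = k then 1 else 0) * monomial l x) = monomial k x" for x
    by (subst sum.remove[of _ k]) (auto simp: finite_multi_indices assms intro!: sum.neutral)
  then show "monomial k = (\<lambda>x. \<Sum>l | sum l UNIV < n. (if l = k then 1 else 0) * monomial l x)"
    by (simp add: fun_eq_iff)
qed

lemma below_sum [intro]:
  "(\<And>i. i \<in> I \<Longrightarrow> p i \<in> polys_below n) \<Longrightarrow> (\<lambda>x. \<Sum>i\<in>I. p i x) \<in> polys_below n"
  by (induction I rule: infinite_finite_induct) auto

lemma below_minus [intro]:
  "p \<in> polys_below n \<Longrightarrow> q \<in> polys_below n \<Longrightarrow> (\<lambda>x. p x - q x) \<in> polys_below n"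
  using below_add[of p n "\<lambda>x. (-1) * q x"] below_scale[of q n "-1"] by simp

lemma below_fun_minus [intro]: "p \<in> polys_below n \<Longrightarrow> q \<in> polys_below n \<Longrightarrow> p - q \<in> polys_below n"
  unfolding fun_diff_def by (rule below_minus)

lemma below_induct [consumes 1, case_names zero add monomial]:
  assumes p: "p \<in> polys_below n"
    and "P (\<lambda>_. 0)"
    and "\<And>f g. f \<in> polys_below n \<Longrightarrow> g \<in> polys_below n \<Longrightarrow> P f \<Longrightarrow> P g \<Longrightarrow> P (\<lambda>x. f x + g x)"
    and "\<And>c k. sum k UNIV < n \<Longrightarrow> P (\<lambda>x. c * monomial k x)"
  shows "P p"
proof -
  obtain c where c: "p = (\<lambda>x. \<Sum>k | sum k UNIV < n. c k * monomial k x)"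
    using p by (auto simp: polys_below_def)
  have "P (\<lambda>x. \<Sum>k\<in>I. c k * monomial k x)" if "I \<subseteq> {k. sum k UNIV < n}" for I
    using finite_subset[OF that finite_multi_indices] that
  proof (induction I rule: finite_induct)
    case (insert k I)
    then have "P (\<lambda>x. c k * monomial k x + (\<Sum>k\<in>I. c k * monomial k x))"
      by (intro assms(3)[of "\<lambda>x. c k * monomial k x" "\<lambda>x. \<Sum>k\<in>I. c k * monomial k x"] assms(4)
            below_scale below_sum below_monomial) auto
    then show ?case using insert by simp
  qed (simp add: assms(2))
  then show ?thesis unfolding c by blast
qed

lemma below_mono: "n \<le> m \<Longrightarrow> p \<in> polys_below n \<Longrightarrow> p \<in> polys_below m"
  by (rotate_tac, induction rule: below_induct) (simp_all add: below_zero below_add below_scale below_monomial)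

lemma below_0: "p \<in> polys_below 0 \<Longrightarrow> p = (\<lambda>_. 0)"
  by (simp add: polys_below_def image_def)

lemma monomial_mult: "monomial k x * monomial l x = monomial (\<lambda>i. k i + l i) x"
  by (simp add: monomial_def power_add prod.distrib)

lemma below_mult:
  assumes "p \<in> polys_below n" "q \<in> polys_below m"
  shows "(\<lambda>x. p x * q x) \<in> polys_below (n + m)"
  using assms(1)
proof (induction rule: below_induct)
  case (add f g)
  then show ?case by (simp add: distrib_right below_add)
next
  case (monomial c k)
  from assms(2) show ?case
  proof (induction rule: below_induct)
    case (add f g)
    then show ?case by (simp add: distrib_left below_add)
  next
    case (monomial d l)
    have "(\<lambda>x. (c * d) * monomial (\<lambda>i. k i + l i) x) \<in> polys_below (n + m)"
      using \<open>sum k UNIV < n\<close> monomial by (intro below_scale below_monomial) (simp add: sum.distrib)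
    then show ?case by (simp add: monomial_mult[symmetric] mult_ac)
  qed auto
qed auto

lemma below_coord_mult [intro]:
  assumes "p \<in> polys_below n" shows "(\<lambda>x. x $ i * p x) \<in> polys_below (Suc n)"
  using assms
proof (induction rule: below_induct)
  case (add f g)
  then show ?case by (simp add: distrib_left below_add)
next
  case (monomial c k)
  let ?e = "\<lambda>j. if j = i then 1 else 0 :: nat"
  have "monomial ?e x = x $ i" for x
    by (simp add: monomial_def if_distrib[of "power _"] prod.delta cong: if_cong)
  then have eq: "x $ i * monomial k x = monomial (\<lambda>j. ?e j + k j) x" for x
    by (metis monomial_mult)
  have "(\<lambda>x. c * monomial (\<lambda>j. ?e j + k j) x) \<in> polys_below (Suc n)"
    using monomial by (intro below_scale below_monomial) (simp add: sum.distrib)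
  then show ?case by (simp add: eq[symmetric] mult_ac)
qed auto

lemma below_const: "(\<lambda>_. c) \<in> polys_below (Suc n)"
proof -
  have "(\<lambda>x. c * monomial (\<lambda>_. 0) x) \<in> polys_below (Suc n)" by (intro below_scale below_monomial) simp
  then show ?thesis by (simp add: monomial_def)
qed

lemma below_coord: "(\<lambda>x. x $ i) \<in> polys_below (Suc (Suc n))"
  using below_coord_mult[OF below_const[of 1 n], of i] by simp

lemma below_Cball: "p \<in> polys_below n \<Longrightarrow> p \<in> Cball m"
  unfolding polys_below_def monomial_def
  by (auto intro!: Cball_sum Cball_mult Cball_const Cball_prod Cball_power Cball_coord)

lemma monomial_reflect: "monomial k (reflect j x) = (-1) ^ k j * monomial k x"
proof -
  have "monomial k (reflect j x) = (- (x $ j)) ^ k j * (\<Prod>i\<in>UNIV - {j}. (x $ i) ^ k i)"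
    unfolding monomial_def by (subst prod.remove[of _ j]) (auto simp: reflect_nth intro!: prod.cong)
  also have "\<dots> = (-1) ^ k j * monomial k x"
    unfolding monomial_def by (subst (2) prod.remove[of _ j]) (auto simp: power_minus[of "x $ j"])
  finally show ?thesis .
qed

lemma below_reflect [intro]: "p \<in> polys_below n \<Longrightarrow> (\<lambda>x. p (reflect j x)) \<in> polys_below n"
proof (induction rule: below_induct)
  case (monomial c k)
  then have "(\<lambda>x. (c * (-1) ^ k j) * monomial k x) \<in> polys_below n" by (intro below_scale below_monomial)
  then show ?case by (simp add: monomial_reflect mult.assoc)
qed auto

lemma monomial_line_deriv:
  "((\<lambda>t. monomial k (x + t *\<^sub>R axis j 1)) has_field_derivative
     real (k j) * (x $ j) ^ (k j - 1) * (\<Prod>i\<in>UNIV - {j}. (x $ i) ^ k i)) (at 0)"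
proof -
  have "monomial k (x + t *\<^sub>R axis j 1) = (x $ j + t) ^ k j * (\<Prod>i\<in>UNIV - {j}. (x $ i) ^ k i)" for t
    unfolding monomial_def by (subst prod.remove[of _ j]) (auto simp: axis_def intro!: prod.cong)
  then show ?thesis by (auto intro!: derivative_eq_intros)
qed

lemma below_line_differentiable:
  assumes "p \<in> polys_below n"
  shows "((\<lambda>t. p (x + t *\<^sub>R axis j 1)) has_field_derivative partial_deriv j p x) (at 0)"
proof -
  have "\<exists>D. ((\<lambda>t. p (x + t *\<^sub>R axis j 1)) has_field_derivative D) (at 0)"
    using assms
  proof (induction rule: below_induct)
    case zero
    show ?case using DERIV_const by blast
  next
    case (add f g)
    then show ?case using DERIV_add by blast
  next
    case (monomial c k)
    show ?case using DERIV_cmult[OF monomial_line_deriv] by blast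
  qed
  then show ?thesis using partial_derivI by metis
qed

lemma partial_deriv_below_add:
  "p \<in> polys_below n \<Longrightarrow> q \<in> polys_below m \<Longrightarrow>
     partial_deriv j (\<lambda>x. p x + q x) x = partial_deriv j p x + partial_deriv j q x"
  by (intro partial_derivI DERIV_add below_line_differentiable)

lemma partial_deriv_cmonomial:
  "partial_deriv j (\<lambda>x. c * monomial k x) x =
     c * (real (k j) * (x $ j) ^ (k j - 1) * (\<Prod>i\<in>UNIV - {j}. (x $ i) ^ k i))"
  by (intro partial_derivI DERIV_cmult monomial_line_deriv)

lemma dunkl_monomial:
  fixes x :: "real ^ 'n"
  shows "dunkl \<gamma> j (\<lambda>x. c * monomial k x) x =
    (c * (real (k j) + (if odd (k j) then \<gamma> $ j else 0))) * monomial (k(j := k j - 1)) x"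
proof -
  define R where "R = (\<Prod>i\<in>UNIV - {j}. (x $ i) ^ k i)"
  have m: "monomial k x = (x $ j) ^ k j * R"
    unfolding monomial_def R_def by (rule prod.remove) auto
  have m': "monomial (k(j := k j - 1)) x = (x $ j) ^ (k j - 1) * R"
    unfolding monomial_def R_def by (subst prod.remove[of _ j]) (auto intro!: prod.cong)
  note pd = partial_deriv_cmonomial[of j c k x, folded R_def]
  show ?thesis
  proof (cases "k j")
    case 0
    then show ?thesis by (simp add: dunkl_def pd monomial_reflect)
  next
    case (Suc l)
    have m'': "monomial (k(j := l)) x = (x $ j) ^ l * R" using m' Suc by simp
    show ?thesis
    proof (cases "x $ j = 0")
      case True
      then show ?thesis unfolding dunkl_def pd using Suc m'' by (cases l) (auto simp: algebra_simps)
    next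
      case False
      then show ?thesis using Suc m''
        by (cases "even l") (auto simp: dunkl_def pd m monomial_reflect field_simps)
    qed
  qed
qed

lemma dunkl_below_add:
  "p \<in> polys_below n \<Longrightarrow> q \<in> polys_below m \<Longrightarrow>
     dunkl \<gamma> j (\<lambda>x. p x + q x) x = dunkl \<gamma> j p x + dunkl \<gamma> j q x"
  unfolding dunkl_def by (simp add: partial_deriv_below_add field_simps)

lemma below_dunkl [intro]: "p \<in> polys_below (Suc n) \<Longrightarrow> dunkl \<gamma> j p \<in> polys_below n"
proof (induction rule: below_induct)
  case zero
  have "dunkl \<gamma> j (\<lambda>_. 0) = (\<lambda>_. 0)" by (rule ext) (simp add: dunkl_def partial_deriv_const)
  then show ?case using below_zero by simp
next
  case (add f g)
  have "dunkl \<gamma> j (\<lambda>x. f x + g x) = (\<lambda>x. dunkl \<gamma> j f x + dunkl \<gamma> j g x)"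
    by (rule ext) (rule dunkl_below_add[OF add(1,2)])
  then show ?case using add by (simp add: below_add)
next
  case (monomial c k)
  show ?case
  proof (cases "k j")
    case 0
    then show ?thesis using below_zero unfolding dunkl_monomial by simp
  next
    case (Suc l)
    have "sum k UNIV = k j + sum k (UNIV - {j})" by (rule sum.remove) auto
    moreover have "sum (k(j := k j - 1)) UNIV = (k j - 1) + sum k (UNIV - {j})"
      by (subst sum.remove[of _ j]) (auto intro!: sum.cong)
    ultimately show ?thesis using Suc monomial unfolding dunkl_monomial
      by (intro below_scale below_monomial) simp
  qed
qed

text \<open>
  Euler's relation modulo lower degree: on monomials of the top degree \<open>n\<close> the operator
  \<open>x \<cdot> \<nabla>\<close> is multiplication by \<open>n\<close>.
\<close>

lemma euler_below:
  "p \<in> polys_below (Suc n) \<Longrightarrow>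
    (\<lambda>x. (\<Sum>j\<in>UNIV. x $ j * partial_deriv j p x) - real n * p x) \<in> polys_below n"
proof (induction rule: below_induct)
  case zero
  show ?case using below_zero by (simp add: partial_deriv_const)
next
  case (add f g)
  then have "(\<lambda>x. ((\<Sum>j\<in>UNIV. x $ j * partial_deriv j f x) - real n * f x)
      + ((\<Sum>j\<in>UNIV. x $ j * partial_deriv j g x) - real n * g x)) \<in> polys_below n" by (intro below_add)
  moreover have "(\<lambda>x. ((\<Sum>j\<in>UNIV. x $ j * partial_deriv j f x) - real n * f x)
      + ((\<Sum>j\<in>UNIV. x $ j * partial_deriv j g x) - real n * g x))
    = (\<lambda>x. (\<Sum>j\<in>UNIV. x $ j * partial_deriv j (\<lambda>x. f x + g x) x) - real n * (f x + g x))"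
    using add by (simp add: partial_deriv_below_add distrib_left sum.distrib fun_eq_iff)
  ultimately show ?case by simp
next
  case (monomial c k)
  have "x $ j * partial_deriv j (\<lambda>x. c * monomial k x) x = real (k j) * (c * monomial k x)" for j x
  proof -
    have "monomial k x = (x $ j) ^ k j * (\<Prod>i\<in>UNIV - {j}. (x $ i) ^ k i)"
      unfolding monomial_def by (rule prod.remove) auto
    then show ?thesis unfolding partial_deriv_cmonomial by (cases "k j") auto
  qed
  then have eq: "(\<lambda>x. (\<Sum>j\<in>UNIV. x $ j * partial_deriv j (\<lambda>x. c * monomial k x) x) - real n * (c * monomial k x))
      = (\<lambda>x. ((real (sum k UNIV) - real n) * c) * monomial k x)"
    by (simp add: sum_distrib_right[symmetric] left_diff_distrib mult.assoc)
  show ?case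
  proof (cases "sum k UNIV = n")
    case True
    then show ?thesis unfolding eq using below_zero by simp
  next
    case False
    then show ?thesis unfolding eq using monomial by (intro below_scale below_monomial) simp
  qed
qed

lemma below_zero_on_ball:
  assumes p: "p \<in> polys_below n" and 0: "\<And>x. x \<in> ball 0 1 \<Longrightarrow> p x = 0"
  shows "p = (\<lambda>_. 0)"
proof
  fix y :: "real ^ 'a"
  obtain c where c: "p = (\<lambda>x. \<Sum>k | sum k UNIV < n. c k * monomial k x)"
    using p by (auto simp: polys_below_def)
  define P where "P = (\<Sum>k | sum k UNIV < n. monom (c k * monomial k y) (sum k UNIV))"
  have P: "poly P t = p (t *\<^sub>R y)" for t
    unfolding P_def c
    by (simp add: poly_sum poly_monom monomial_def power_mult_distrib prod.distrib power_sum mult_ac)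
  have "P = 0"
  proof (rule ccontr)
    assume "P \<noteq> 0"
    then have "finite {t. poly P t = 0}" by (rule poly_roots_finite)
    moreover have "{0<..<1 / (norm y + 1)} \<subseteq> {t. poly P t = 0}"
    proof
      fix t assume t: "t \<in> {0<..<1 / (norm y + 1)}"
      have "norm y + 1 > 0" using norm_ge_zero[of y] by linarith
      then have "t * (norm y + 1) < 1" using t by (simp add: field_simps)
      then have "t * norm y < 1" using t by (simp add: algebra_simps)
      then have "t *\<^sub>R y \<in> ball 0 1" using t by (simp add: mem_ball_0)
      then show "t \<in> {t. poly P t = 0}" by (simp add: P 0)
    qed
    ultimately have "finite {0<..<1 / (norm y + 1)}" by (rule finite_subset[rotated])
    moreover have "1 / (norm y + 1) > 0" by (simp add: add_nonneg_pos)
    ultimately show False using infinite_Ioo by blast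
  qed
  then show "p y = 0" using P[of 1] by simp
qed

lemma real_polynomial_function_below:
  fixes p :: "real ^ 'n \<Rightarrow> real"
  assumes "real_polynomial_function p" shows "\<exists>n. p \<in> polys_below n"
  using assms
proof (induction rule: real_polynomial_function.induct)
  case (linear f)
  interpret bounded_linear f by fact
  have "f x = (\<Sum>i\<in>UNIV. f (axis i 1) * x $ i)" for x
  proof -
    have "f x = f (\<Sum>i\<in>UNIV. x $ i *\<^sub>R axis i 1)"
      by (rule arg_cong[where f = f]) (simp add: vec_eq_iff axis_def if_distrib cong: if_cong)
    then show ?thesis by (simp add: sum scaleR mult.commute)
  qed
  then have "f = (\<lambda>x. \<Sum>i\<in>UNIV. f (axis i 1) * x $ i)" by blast
  moreover have "(\<lambda>x. \<Sum>i\<in>UNIV. f (axis i 1) * x $ i) \<in> polys_below (Suc (Suc 0))"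
    by (intro below_sum below_scale below_coord)
  ultimately show ?case by metis
next
  case (const c)
  then show ?case using below_const by blast
next
  case (add f g)
  then obtain n m where "f \<in> polys_below n" "g \<in> polys_below m" by blast
  then have "f \<in> polys_below (n + m)" "g \<in> polys_below (n + m)" by (auto intro: below_mono[rotated])
  then show ?case using below_add by blast
next
  case (mult f g)
  then show ?case using below_mult by blast
qed

lemma Cball_0_approx:
  assumes "u \<in> Cball 0" "e > 0"
  obtains n p where "p \<in> polys_below n" "\<And>x. x \<in> ball 0 1 \<Longrightarrow> \<bar>u x - p x\<bar> < e"
proof -
  obtain g where g: "continuous_on (cball 0 1) g" "\<And>x. x \<in> ball 0 1 \<Longrightarrow> g x = u x"
    using assms(1) by (rule Cball_0E) blast
  obtain p where p: "real_polynomial_function p" "\<And>x. x \<in> cball 0 1 \<Longrightarrow> \<bar>g x - p x\<bar> < e"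
    using Stone_Weierstrass_real_polynomial_function[OF compact_cball g(1) assms(2)] by blast
  obtain n where "p \<in> polys_below n" using real_polynomial_function_below[OF p(1)] by blast
  then show ?thesis using that p(2) g(2) ball_subset_cball by (metis subsetD)
qed

subsection \<open>Orthogonal projections onto polynomials\<close>

context ball_wt
begin

abbreviation ip where "ip \<equiv> L2_ip \<alpha> \<gamma>"

definition proj :: "nat \<Rightarrow> (real ^ 'n \<Rightarrow> real) \<Rightarrow> real ^ 'n \<Rightarrow> real" where
  "proj n f = (THE p. p \<in> polys_below n \<and> (\<forall>q\<in>polys_below n. ip (f - p) q = 0))"

lemma poly_proj_eq: "poly_proj \<alpha> \<gamma> N f = proj (Suc N) f"
  by (simp add: poly_proj_def proj_def polys_eq_below)

lemma below_L2: "p \<in> polys_below n \<Longrightarrow> p \<in> L2_space \<alpha> \<gamma>"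
  by (rule Cball_0_L2[OF below_Cball])

lemma below_nrm_zero: "p \<in> polys_below n \<Longrightarrow> ip p p = 0 \<Longrightarrow> p = (\<lambda>_. 0)"
  using below_zero_on_ball L2_ip_definite below_Cball by metis

lemma proj_unique:
  assumes f: "f \<in> L2_space \<alpha> \<gamma>" and p: "p \<in> polys_below n" "\<And>q. q \<in> polys_below n \<Longrightarrow> ip (f - p) q = 0"
  shows "proj n f = p"
  unfolding proj_def
proof (rule the_equality)
  fix p' assume p': "p' \<in> polys_below n \<and> (\<forall>q\<in>polys_below n. ip (f - p') q = 0)"
  note L = below_L2[OF p(1)] below_L2[OF conjunct1[OF p']]
  have d: "p' - p \<in> polys_below n" using p' p(1) by blast
  have "ip (p' - p) (p' - p) = ip (f - p) (p' - p) - ip (f - p') (p' - p)"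
    using f L by (simp add: L2.ip_minus L2.V_minus)
  also have "\<dots> = 0" using d p(2) p' by simp
  finally have "p' - p = (\<lambda>_. 0)" by (rule below_nrm_zero[OF d])
  then show "p' = p" by (simp add: fun_eq_iff)
qed (use p in blast)

lemma proj_props:
  assumes f: "f \<in> L2_space \<alpha> \<gamma>"
  shows "proj n f \<in> polys_below n" "q \<in> polys_below n \<Longrightarrow> ip (f - proj n f) q = 0"
proof -
  obtain c where c: "\<forall>k\<in>{k. sum k UNIV < n}. ip (f - (\<lambda>x. \<Sum>k | sum k UNIV < n. c k * monomial k x)) (monomial k) = 0"
    using L2.orthogonal_projection_exists[OF finite_multi_indices _ f, of n monomial]
      below_L2[OF below_monomial] by blast
  define p where "p = (\<lambda>x. \<Sum>k | sum k UNIV < n. c k * monomial k x)"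
  have p: "p \<in> polys_below n" unfolding p_def by (intro below_sum below_scale below_monomial) auto
  have fp: "f - p \<in> L2_space \<alpha> \<gamma>" using f below_L2[OF p] L2.V_minus by blast
  have orth: "ip (f - p) q = 0" if "q \<in> polys_below n" for q
    using that
  proof (induction rule: below_induct)
    case zero
    show ?case by (rule L2.ip_zero_right[OF fp])
  next
    case (add g h)
    then show ?case using L2.ip_add_right[OF below_L2 below_L2 fp] by (simp del: minus_apply)
  next
    case (monomial a k)
    then show ?case using c L2.ip_scale_right[OF below_L2[OF below_monomial] fp]
      by (simp add: p_def del: minus_apply)
  qed
  have "proj n f = p" by (rule proj_unique[OF f p orth])
  then show "proj n f \<in> polys_below n" "q \<in> polys_below n \<Longrightarrow> ip (f - proj n f) q = 0"
    using p orth by auto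
qed

lemma proj_L2: "f \<in> L2_space \<alpha> \<gamma> \<Longrightarrow> proj n f \<in> L2_space \<alpha> \<gamma>"
  by (rule below_L2[OF proj_props(1)])

lemma proj_ip:
  assumes "f \<in> L2_space \<alpha> \<gamma>" "q \<in> polys_below n" shows "ip (proj n f) q = ip f q"
  using proj_props(2)[OF assms] L2.ip_minus[OF assms(1) proj_L2[OF assms(1)] below_L2[OF assms(2)]] by simp

lemma proj_id: "p \<in> polys_below n \<Longrightarrow> proj n p = p"
  by (rule proj_unique) (auto simp: below_L2 L2.ip_zero fun_diff_def)

lemma proj_minus:
  assumes "f \<in> L2_space \<alpha> \<gamma>" "g \<in> L2_space \<alpha> \<gamma>" shows "proj n (f - g) = proj n f - proj n g"
proof (rule proj_unique)
  fix q :: "real ^ 'n \<Rightarrow> real" assume q: "q \<in> polys_below n"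
  show "ip (f - g - (proj n f - proj n g)) q = 0"
    using proj_ip[OF assms(1) q] proj_ip[OF assms(2) q] assms proj_L2 below_L2[OF q]
    by (simp add: L2.ip_minus L2.V_minus)
qed (use assms proj_props(1) L2.V_minus in auto)

lemma proj_pythagoras:
  assumes f: "f \<in> L2_space \<alpha> \<gamma>"
  shows "(nrm f)\<^sup>2 = (nrm (proj n f))\<^sup>2 + (nrm (f - proj n f))\<^sup>2"
  using proj_ip[OF f proj_props(1)[OF f]] L2.ip_sq_minus[OF f proj_L2[OF f]]
  by (simp add: L2.nrm_sq)

lemma nrm_proj_le:
  assumes "f \<in> L2_space \<alpha> \<gamma>" shows "nrm (proj n f) \<le> nrm f"
  by (rule power2_le_imp_le) (use proj_pythagoras[OF assms, of n] in simp_all)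

lemma nrm_minus_proj_le:
  assumes "f \<in> L2_space \<alpha> \<gamma>" shows "nrm (f - proj n f) \<le> nrm f"
  by (rule power2_le_imp_le) (simp_all add: proj_pythagoras[OF assms, of n])

lemma proj_best:
  assumes f: "f \<in> L2_space \<alpha> \<gamma>" and p: "p \<in> polys_below n"
  shows "nrm (f - proj n f) \<le> nrm (f - p)"
proof -
  have fp: "f - p \<in> L2_space \<alpha> \<gamma>" using f below_L2[OF p] L2.V_minus by blast
  have "(f - p) - proj n (f - p) = f - proj n f"
    using proj_minus[OF f below_L2[OF p]] proj_id[OF p] by (simp add: fun_eq_iff)
  then show ?thesis using nrm_minus_proj_le[OF fp, of n] by simp
qed

lemma nrm_le_bound:
  assumes "u \<in> Cball 0" "\<And>x. x \<in> ball 0 1 \<Longrightarrow> \<bar>u x\<bar> \<le> B" "B \<ge> 0"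
  shows "nrm u \<le> B * nrm (\<lambda>_. 1)"
proof (rule power2_le_imp_le)
  have "(LINT x|\<mu>. u x * u x) \<le> (LINT x|\<mu>. B\<^sup>2 * (1 * 1))"
  proof (rule integral_mono)
    show "integrable \<mu> (\<lambda>x. u x * u x)"
      using L2_mult_integrable Cball_0_L2[OF assms(1)] by blast
    fix x assume "x \<in> space \<mu>"
    then have "\<bar>u x\<bar>\<^sup>2 \<le> B\<^sup>2" using assms(2)[of x] by (intro power_mono) auto
    then show "u x * u x \<le> B\<^sup>2 * (1 * 1)" by (simp add: power2_eq_square)
  qed simp
  then show "(nrm u)\<^sup>2 \<le> (B * nrm (\<lambda>_. 1))\<^sup>2"
    unfolding power_mult_distrib L2.nrm_sq by (simp add: L2_ip_def mult.commute)
qed (use assms(3) in simp)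

text \<open>Polynomials are dense: uniform approximation on the ball is approximation in the mean.\<close>

lemma proj_approx:
  assumes u: "u \<in> Cball 0" and e: "e > 0"
  obtains M where "\<And>n. n \<ge> M \<Longrightarrow> nrm (u - proj n u) < e"
proof -
  define c where "c = nrm (\<lambda>_. 1) + 1"
  have c: "c > 0" using L2.nrm_nonneg[of "\<lambda>_. 1"] by (simp add: c_def add_nonneg_pos)
  obtain M p where p: "p \<in> polys_below M" "\<And>x. x \<in> ball 0 1 \<Longrightarrow> \<bar>u x - p x\<bar> < e / c"
    by (rule Cball_0_approx[OF u divide_pos_pos[OF e c]]) blast
  have "nrm (u - p) \<le> e / c * nrm (\<lambda>_. 1)"
    using p(2) e c by (intro nrm_le_bound Cball_fun_minus below_Cball[OF p(1)] u) (auto intro: less_imp_le)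
  also have "\<dots> < e" using e c by (simp add: c_def field_simps)
  finally have "nrm (u - p) < e" .
  then have "nrm (u - proj n u) < e" if "n \<ge> M" for n
    using proj_best[OF Cball_0_L2[OF u] below_mono[OF that p(1)]] by simp
  then show ?thesis by (rule that)
qed

end

section \<open>Integration by parts\<close>

text \<open>
  On a half-line the Dunkl operator is a classical derivative with respect to a power weight, applied
  to functions vanishing at the origin; for exponents down to \<open>-1\<close> the integrated function
  vanishes at both end points.
\<close>

lemma line_integral_zero:
  fixes h h' :: "real \<Rightarrow> real"
  assumes s: "s > 0" and a: "a > -1" and g: "g > -1" and h0: "h 0 = 0"
    and der: "\<And>t. \<bar>t\<bar> < s \<Longrightarrow> (h has_field_derivative h' t) (at t)"
    and cont: "continuous_on {-s<..<s} h'"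
    and bdd: "\<And>t. \<bar>t\<bar> < s \<Longrightarrow> \<bar>h t\<bar> \<le> B"
  defines "Q \<equiv> \<lambda>t. t powr g * (s\<^sup>2 - t\<^sup>2) powr a *
      ((s\<^sup>2 - t\<^sup>2) * (h' t + g * h t / t) - 2 * (a + 1) * t * h t)"
  assumes int: "set_integrable lborel {0<..<s} Q"
  shows "(LINT t|lborel. indicator {0<..<s} t * Q t) = 0"
proof -
  define G where "G t = h t * (t powr g * (s\<^sup>2 - t\<^sup>2) powr (a + 1))" for t
  have pos: "s\<^sup>2 - t\<^sup>2 > 0" if "\<bar>t\<bar> < s" for t
    using that power_strict_mono[of "\<bar>t\<bar>" s 2] by simp
  have G': "(G has_vector_derivative Q t) (at t)" if t: "0 < t" "t < s" for t
  proof -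
    have p: "s\<^sup>2 - t\<^sup>2 > 0" using pos[of t] t by simp
    have "((\<lambda>t. t powr g) has_field_derivative g * t powr (g - 1)) (at t)"
      using t by (auto intro!: derivative_eq_intros)
    moreover have "((\<lambda>t. (s\<^sup>2 - t\<^sup>2) powr (a + 1)) has_field_derivative
        - ((a + 1) * (s\<^sup>2 - t\<^sup>2) powr a * (2 * t))) (at t)"
      using p by (auto intro!: derivative_eq_intros)
    moreover have "(h has_field_derivative h' t) (at t)" using der[of t] t by simp
    ultimately have "(G has_field_derivative h' t * (t powr g * (s\<^sup>2 - t\<^sup>2) powr (a + 1)) +
        (g * t powr (g - 1) * (s\<^sup>2 - t\<^sup>2) powr (a + 1) +
          - ((a + 1) * (s\<^sup>2 - t\<^sup>2) powr a * (2 * t)) * t powr g) * h t) (at t)"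
      unfolding G_def by (intro DERIV_mult)
    moreover have e1: "t powr (g - 1) = t powr g / t" using t by (simp add: powr_diff)
    have e2: "(s\<^sup>2 - t\<^sup>2) powr (a + 1) = (s\<^sup>2 - t\<^sup>2) powr a * (s\<^sup>2 - t\<^sup>2)"
      using p by (simp add: powr_add)
    have "h' t * (t powr g * (s\<^sup>2 - t\<^sup>2) powr (a + 1)) +
        (g * t powr (g - 1) * (s\<^sup>2 - t\<^sup>2) powr (a + 1) +
          - ((a + 1) * (s\<^sup>2 - t\<^sup>2) powr a * (2 * t)) * t powr g) * h t = Q t"
      unfolding Q_def e1 e2 using t by (simp add: field_simps)
    ultimately have "(G has_field_derivative Q t) (at t)" by simp
    then show ?thesis by (simp add: has_real_derivative_iff_has_vector_derivative)
  qed
  have conth: "continuous_on {0<..<s} h"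
  proof (rule continuous_at_imp_continuous_on, rule ballI)
    fix t assume "t \<in> {0<..<s}"
    then show "isCont h t" using DERIV_isCont[OF der[of t]] by simp
  qed
  have conth': "continuous_on {0<..<s} h'"
    by (rule continuous_on_subset[OF cont]) (use s in auto)
  have "continuous_on {0<..<s} Q"
    unfolding Q_def
    by (intro continuous_intros conth conth') (auto dest: pos[OF abs_of_pos[THEN ord_eq_less_trans]])
  then have Qc: "isCont Q t" if "0 < t" "t < s" for t
    using that by (simp add: continuous_on_eq_continuous_at)
  have lim0: "(G \<longlongrightarrow> 0) (at_right 0)"
  proof -
    have "((\<lambda>t. h t / t) \<longlongrightarrow> h' 0) (at_right 0)"
      using der[of 0] s h0 unfolding DERIV_def by (auto intro: tendsto_mono[OF at_le])
    moreover have "((\<lambda>t::real. t powr (g + 1)) \<longlongrightarrow> 0) (at_right 0)"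
      by (rule tendsto_zero_powrI[where b = "g + 1"])
         (use g in \<open>auto intro!: tendsto_intros simp: eventually_at_right_less eventually_mono[OF eventually_at_right_less]\<close>)
    moreover have "((\<lambda>t. (s\<^sup>2 - t\<^sup>2) powr (a + 1)) \<longlongrightarrow> (s\<^sup>2 - 0\<^sup>2) powr (a + 1)) (at_right 0)"
      using s by (intro tendsto_intros) auto
    ultimately have "((\<lambda>t. (h t / t) * (t powr (g + 1) * (s\<^sup>2 - t\<^sup>2) powr (a + 1)))
        \<longlongrightarrow> h' 0 * (0 * (s\<^sup>2 - 0\<^sup>2) powr (a + 1))) (at_right 0)"
      by (intro tendsto_mult)
    moreover have "\<forall>\<^sub>F t in at_right 0. (h t / t) * (t powr (g + 1) * (s\<^sup>2 - t\<^sup>2) powr (a + 1)) = G t"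
      using eventually_at_right_less
      by (rule eventually_mono) (simp add: G_def powr_add)
    ultimately show ?thesis using Lim_transform_eventually by fastforce
  qed
  have lims: "(G \<longlongrightarrow> 0) (at_left s)"
  proof -
    have "((\<lambda>t. t powr g * (s\<^sup>2 - t\<^sup>2) powr (a + 1)) \<longlongrightarrow> s powr g * 0) (at_left s)"
    proof (intro tendsto_mult)
      show "((\<lambda>t. t powr g) \<longlongrightarrow> s powr g) (at_left s)" using s by (intro tendsto_intros) auto
      have "\<forall>\<^sub>F t in at_left s. 0 < t \<and> t < s"
        using eventually_at_left_real[OF s] by (rule eventually_mono) auto
      then have "\<forall>\<^sub>F t in at_left s. 0 \<le> s\<^sup>2 - t\<^sup>2"
        by (rule eventually_mono) (use pos in \<open>force intro: less_imp_le\<close>)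
      moreover have "((\<lambda>t. s\<^sup>2 - t\<^sup>2) \<longlongrightarrow> s\<^sup>2 - s\<^sup>2) (at_left s)" by (intro tendsto_intros)
      ultimately show "((\<lambda>t. (s\<^sup>2 - t\<^sup>2) powr (a + 1)) \<longlongrightarrow> 0) (at_left s)"
        using a by (intro tendsto_zero_powrI[where b = "a + 1"]) auto
    qed
    then have "((\<lambda>t. t powr g * (s\<^sup>2 - t\<^sup>2) powr (a + 1)) \<longlongrightarrow> 0) (at_left s)" by simp
    then show ?thesis
    proof (rule tendsto_0_le[where K = B])
      have "\<forall>\<^sub>F t in at_left s. 0 < t \<and> t < s"
        using eventually_at_left_real[OF s] by (rule eventually_mono) auto
      then show "\<forall>\<^sub>F t in at_left s. norm (G t) \<le> norm (t powr g * (s\<^sup>2 - t\<^sup>2) powr (a + 1)) * B"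
      proof (rule eventually_mono)
        fix t assume "0 < t \<and> t < s"
        then have "\<bar>h t\<bar> \<le> B" using bdd[of t] by simp
        then show "norm (G t) \<le> norm (t powr g * (s\<^sup>2 - t\<^sup>2) powr (a + 1)) * B"
          by (simp add: G_def abs_mult mult.commute[of _ B] mult_right_mono)
      qed
    qed
  qed
  have ei: "einterval 0 (ereal s) = {0<..<s}" by (auto simp: einterval_def zero_ereal_def)
  have "(LBINT t=0..ereal s. Q t) = 0 - 0"
  proof (rule interval_integral_FTC_integrable[where F = G])
    show "0 < ereal s" using s by simp
    show "set_integrable lborel (einterval 0 (ereal s)) Q" unfolding ei by (rule int)
    show "((G \<circ> real_of_ereal) \<longlongrightarrow> 0) (at_right 0)"
      using lim0 unfolding zero_ereal_def ereal_tendsto_simps .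
    show "((G \<circ> real_of_ereal) \<longlongrightarrow> 0) (at_left (ereal s))"
      using lims unfolding ereal_tendsto_simps .
  qed (use G' Qc in auto)
  then show ?thesis
    using s by (simp add: interval_lebesgue_integral_def ei set_lebesgue_integral_def)
qed

context ball_wt
begin

text \<open>
  On the half \<open>x\<^sub>j > 0\<close> of a line parallel to \<open>e\<^sub>j\<close> the integrand is, up to a constant factor, the
  derivative treated in \<open>line_integral_zero\<close>, with \<open>s\<close> half the length of the chord.
\<close>

lemma even_part_integral_zero:
  assumes H: "H \<in> Cball 1" and odd: "\<And>x. x \<in> ball 0 1 \<Longrightarrow> H (reflect j x) = - H x"
    and \<Psi>: "\<Psi> \<in> Cball 0" and \<Psi>_even: "\<And>x. x \<in> ball 0 1 \<Longrightarrow> \<Psi> (reflect j x) = \<Psi> x"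
    and \<Psi>_eq: "\<And>x. x \<in> ball 0 1 \<Longrightarrow> x $ j \<noteq> 0 \<Longrightarrow> \<Psi> x =
      (1 - (norm x)\<^sup>2) * (partial_deriv j H x + \<gamma> $ j * H x / x $ j) - 2 * (\<alpha> + 1) * x $ j * H x"
  shows "(LINT x|\<mu>. \<Psi> x) = 0"
proof -
  note H' = H[unfolded One_nat_def]
  define F where "F x = indicator (ball 0 1) x * (ball_weight \<alpha> \<gamma> x * \<Psi> x)" for x
  have Fint: "integrable lborel F"
    using integrable_ball_measure(1)[OF Cball_0_measurable[OF \<Psi>]] Cball_0_integrable[OF \<Psi>]
    by (simp add: F_def[abs_def])
  have "(LINT x|lborel. F x) = 0"
  proof (rule integral_zero_by_lines[OF Fint, of j])
    fix y :: "real ^ 'n" assume y: "y $ j = 0"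
      and sl: "integrable lborel (\<lambda>t. F (y + t *\<^sub>R axis j 1))"
    define sl where "sl t = F (y + t *\<^sub>R axis j 1)" for t
    have norm_line: "(norm (y + t *\<^sub>R axis j 1))\<^sup>2 = (norm y)\<^sup>2 + t\<^sup>2" for t
      unfolding power2_norm_eq_inner using y
      by (simp add: inner_add_left inner_add_right inner_axis inner_axis' power2_eq_square)
    show "(LINT t|lborel. F (y + t *\<^sub>R axis j 1)) = 0"
    proof (cases "norm y < 1")
      case False
      have "y + t *\<^sub>R axis j 1 \<notin> ball 0 1" for t
      proof
        assume "y + t *\<^sub>R axis j 1 \<in> ball 0 1"
        then have "(norm y)\<^sup>2 + t\<^sup>2 < 1" using norm_sq_less_1 by (metis norm_line)
        moreover have "(norm y)\<^sup>2 \<ge> 1" using False by (simp add: one_le_power)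
        ultimately show False using zero_le_power2[of t] by linarith
      qed
      then show ?thesis by (simp add: F_def)
    next
      case True
      define s where "s = sqrt (1 - (norm y)\<^sup>2)"
      have y1: "(norm y)\<^sup>2 < 1" using True by (simp add: abs_square_less_1)
      then have s: "s > 0" and s2: "s\<^sup>2 = 1 - (norm y)\<^sup>2" by (auto simp: s_def)
      have in_ball: "y + t *\<^sub>R axis j 1 \<in> ball 0 1 \<longleftrightarrow> \<bar>t\<bar> < s" for t
      proof -
        have "y + t *\<^sub>R axis j 1 \<in> ball 0 1 \<longleftrightarrow> (norm (y + t *\<^sub>R axis j 1))\<^sup>2 < 1"
          by (simp add: mem_ball_0 abs_square_less_1)
        also have "\<dots> \<longleftrightarrow> \<bar>t\<bar>\<^sup>2 < s\<^sup>2" unfolding norm_line s2 by auto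
        also have "\<dots> \<longleftrightarrow> \<bar>t\<bar> < s" using power_strict_mono[of "\<bar>t\<bar>" s 2] power2_less_imp_less[of "\<bar>t\<bar>" s] s by auto
        finally show ?thesis .
      qed
      define P where "P = (\<Prod>i\<in>UNIV - {j}. \<bar>y $ i\<bar> powr (\<gamma> $ i))"
      have W: "ball_weight \<alpha> \<gamma> (y + t *\<^sub>R axis j 1) = (s\<^sup>2 - t\<^sup>2) powr \<alpha> * (\<bar>t\<bar> powr (\<gamma> $ j) * P)" for t
      proof -
        have "(\<Prod>i\<in>UNIV. \<bar>(y + t *\<^sub>R axis j 1) $ i\<bar> powr (\<gamma> $ i)) = \<bar>t\<bar> powr (\<gamma> $ j) * P"
          unfolding P_def by (subst prod.remove[of _ j]) (auto simp: y axis_def intro!: prod.cong)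
        then show ?thesis unfolding ball_weight_def norm_line s2 by (simp add: diff_diff_eq)
      qed
      define h where "h t = H (y + t *\<^sub>R axis j 1)" for t
      define h' where "h' t = partial_deriv j H (y + t *\<^sub>R axis j 1)" for t
      define Q where "Q t = t powr (\<gamma> $ j) * (s\<^sup>2 - t\<^sup>2) powr \<alpha> *
        ((s\<^sup>2 - t\<^sup>2) * (h' t + \<gamma> $ j * h t / t) - 2 * (\<alpha> + 1) * t * h t)" for t
      have slQ: "sl t = P * Q t" if t: "0 < t" "t < s" for t
      proof -
        have b: "y + t *\<^sub>R axis j 1 \<in> ball 0 1" using t in_ball by simp
        have yj: "(y + t *\<^sub>R axis j 1) $ j = t" using y by simp
        have n: "1 - (norm (y + t *\<^sub>R axis j 1))\<^sup>2 = s\<^sup>2 - t\<^sup>2" unfolding norm_line s2 by simp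
        show ?thesis using \<Psi>_eq[OF b] t b unfolding sl_def F_def W yj n
          by (simp add: Q_def h_def h'_def)
      qed
      have sl_even: "sl (-t) = sl t" for t
      proof (cases "\<bar>t\<bar> < s")
        case True
        have "reflect j (y + t *\<^sub>R axis j 1) = y + (-t) *\<^sub>R axis j 1"
          using y by (auto simp: vec_eq_iff reflect_nth axis_def)
        then show ?thesis using \<Psi>_even[of "y + t *\<^sub>R axis j 1"] True in_ball[of t] in_ball[of "-t"]
          unfolding sl_def F_def W by simp
      next
        case False
        then show ?thesis using in_ball[of t] in_ball[of "-t"] by (simp add: sl_def F_def)
      qed
      have sl_out: "sl t = 0" if "\<not> \<bar>t\<bar> < s" for t
        using that in_ball[of t] by (simp add: sl_def F_def)
      have slint: "integrable lborel sl" using sl by (simp add: sl_def[abs_def])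
      let ?I = "\<lambda>t. indicator {0<..<s} t * sl t"
      have Iint: "integrable lborel ?I"
        using integrable_mult_indicator[OF _ slint, of "{0<..<s}"] by simp
      have half: "(LINT t|lborel. ?I t) = 0"
      proof (cases "P = 0")
        case True
        have I0: "?I t = 0" for t using slQ[of t] True by (simp split: split_indicator)
        show ?thesis unfolding I0 by simp
      next
        case False
        have eq: "?I t = P * (indicator {0<..<s} t * Q t)" for t
          using slQ[of t] by (simp split: split_indicator)
        have "integrable lborel (\<lambda>t. indicator {0<..<s} t * Q t)"
          using Iint False unfolding eq by simp
        then have Qint: "set_integrable lborel {0<..<s} Q" by (simp add: set_integrable_def)
        obtain B where B: "\<And>x. x \<in> ball 0 1 \<Longrightarrow> \<bar>H x\<bar> \<le> B"
          using Cball_0_bounded[OF Cball_0[OF H]] by blast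
        have "(LINT t|lborel. indicator {0<..<s} t * Q t) = 0"
          unfolding Q_def
        proof (rule line_integral_zero[OF s \<alpha> \<gamma>])
          show "h 0 = 0" using odd[of y] True y by (simp add: h_def reflect_def mem_ball_0)
          show "(h has_field_derivative h' t) (at t)" if "\<bar>t\<bar> < s" for t
            unfolding h_def h'_def by (rule line_derivative_at[OF H']) (use that in_ball in simp)
          show "continuous_on {-s<..<s} h'"
            unfolding h'_def
            by (rule continuous_on_compose2[OF Cball_0_continuous[OF Cball_SucD(2)[OF H']]])
               (auto intro!: continuous_intros simp: in_ball)
          show "\<bar>h t\<bar> \<le> B" if "\<bar>t\<bar> < s" for t unfolding h_def using that in_ball B by blast
        qed (use Qint in \<open>simp add: Q_def[abs_def]\<close>)
        then show ?thesis unfolding eq by simp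
      qed
      have "(LINT t|lborel. sl t) = (LINT t|lborel. ?I t + ?I (0 + (-1) * t))"
      proof (rule integral_cong_AE)
        show "AE t in lborel. sl t = ?I t + ?I (0 + (-1) * t)"
          using AE_lborel_singleton[of 0]
          by (rule eventually_mono) (use sl_even sl_out in \<open>auto split: split_indicator\<close>)
      qed (use slint in auto)
      also have "\<dots> = (LINT t|lborel. ?I t) + (LINT t|lborel. ?I (0 + (-1) * t))"
        using Iint lborel_integrable_real_affine[OF Iint, of "-1" 0]
        by (intro Bochner_Integration.integral_add) auto
      also have "(LINT t|lborel. ?I (0 + (-1) * t)) = (LINT t|lborel. ?I t)"
        using lborel_integral_real_affine[of "-1" ?I 0] by simp
      finally show ?thesis using half by (simp add: sl_def)
    qed
  qed
  then show ?thesis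
    using integrable_ball_measure(2)[OF Cball_0_measurable[OF \<Psi>]] by (simp add: F_def)
qed

text \<open>
  The adjoint of a Dunkl operator, from the weight with exponent \<open>\<alpha> + 1\<close> to the one with exponent
  \<open>\<alpha>\<close>.  Symmetrising the integrand in \<open>x\<^sub>j\<close> leaves only the odd part of the product \<open>f g\<close>, for which
  the reflection term of the Dunkl operator is the derivative of the factor \<open>\<bar>x\<^sub>j\<bar> powr \<gamma>\<^sub>j\<close>.
\<close>

theorem dunkl_adjoint:
  assumes f: "f \<in> Cball 1" and g: "g \<in> Cball 1"
  shows "L2_ip (\<alpha> + 1) \<gamma> (dunkl \<gamma> j f) g =
    ip f (\<lambda>x. 2 * (\<alpha> + 1) * x $ j * g x - (1 - (norm x)\<^sup>2) * dunkl \<gamma> j g x)"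
proof -
  note f' = f[unfolded One_nat_def] and g' = g[unfolded One_nat_def]
  note f0 = Cball_0[OF f] and g0 = Cball_0[OF g]
  have D: "dunkl \<gamma> j f \<in> Cball 0" "dunkl \<gamma> j g \<in> Cball 0" using dunkl_Cball f' g' by auto
  have rho: "(\<lambda>x. 1 - (norm x)\<^sup>2) \<in> Cball 0" by (intro Cball_minus Cball_const Cball_norm_sq)
  define \<Phi> where "\<Phi> x = (1 - (norm x)\<^sup>2) * (dunkl \<gamma> j f x * g x + f x * dunkl \<gamma> j g x)
    - 2 * (\<alpha> + 1) * x $ j * (f x * g x)" for x
  have \<Phi>: "\<Phi> \<in> Cball 0" unfolding \<Phi>_def
    by (intro Cball_minus Cball_mult Cball_add D f0 g0 Cball_const Cball_norm_sq Cball_coord)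
  define H where "H x = f x * g x - f (reflect j x) * g (reflect j x)" for x
  define \<Psi> where "\<Psi> x = \<Phi> x + \<Phi> (reflect j x)" for x
  have fg: "(\<lambda>x. f x * g x) \<in> Cball (Suc 0)" by (intro Cball_mult f' g')
  have H: "H \<in> Cball (Suc 0)" unfolding H_def
    by (intro Cball_minus fg Cball_reflect[OF fg])
  have \<Psi>: "\<Psi> \<in> Cball 0" unfolding \<Psi>_def by (intro Cball_add \<Phi> Cball_reflect)
  have "(LINT x|\<mu>. \<Psi> x) = 0"
  proof (rule even_part_integral_zero[of H j])
    fix x :: "real ^ 'n" assume x: "x \<in> ball 0 1" and xj: "x $ j \<noteq> 0"
    have rx: "reflect j x \<in> ball 0 1" using x by simp
    have pH: "partial_deriv j H x = (partial_deriv j f x * g x + f x * partial_deriv j g x)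
       + (partial_deriv j f (reflect j x) * g (reflect j x) + f (reflect j x) * partial_deriv j g (reflect j x))"
    proof -
      have "((\<lambda>t. H (x + t *\<^sub>R axis j 1)) has_field_derivative
          partial_deriv j (\<lambda>x. f x * g x) x - (- partial_deriv j (\<lambda>x. f x * g x) (reflect j x))) (at 0)"
        unfolding H_def using partial_deriv_reflect[OF fg x, of j j]
        by (intro DERIV_diff Cball_SucD(3)[OF fg x]) simp
      then show ?thesis
        unfolding partial_deriv_mult[OF f' g' x] partial_deriv_mult[OF f' g' rx]
        by (simp add: partial_derivI)
    qed
    show "\<Psi> x = (1 - (norm x)\<^sup>2) * (partial_deriv j H x + \<gamma> $ j * H x / x $ j)
        - 2 * (\<alpha> + 1) * x $ j * H x"
      unfolding \<Psi>_def \<Phi>_def pH H_def using xj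
      by (simp add: dunkl_def reflect_nth field_simps)
  next
    show "H \<in> Cball 1" using H by simp
    show "\<Psi> \<in> Cball 0" by (rule \<Psi>)
  qed (simp_all add: H_def \<Psi>_def)
  then have "(LINT x|\<mu>. \<Phi> x) = 0"
    unfolding \<Psi>_def
    using integral_reflect[OF Cball_0_measurable[OF \<Phi>]] Cball_0_integrable[OF \<Phi>] by simp
  moreover have "(LINT x|\<mu>. \<Phi> x) = L2_ip (\<alpha> + 1) \<gamma> (dunkl \<gamma> j f) g -
    ip f (\<lambda>x. 2 * (\<alpha> + 1) * x $ j * g x - (1 - (norm x)\<^sup>2) * dunkl \<gamma> j g x)"
    unfolding L2_ip_next[OF D(1) g0] unfolding L2_ip_def
    by (subst Bochner_Integration.integral_diff[symmetric])
       (auto simp: \<Phi>_def algebra_simps intro!: Cball_0_integrable Cball_minus Cball_mult D f0 g0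
         Cball_const Cball_norm_sq Cball_coord Bochner_Integration.integral_cong)
  ultimately show ?thesis by simp
qed

end

section \<open>Dunkl--Sobolev norms\<close>

lemma dunkl_iter_snoc: "dunkl_iter \<gamma> (js @ [j]) u = dunkl_iter \<gamma> js (dunkl \<gamma> j u)"
  by (simp add: dunkl_iter_def)

lemma sobolev_ip_0: "sobolev_ip \<alpha> \<gamma> 0 p q = L2_ip \<alpha> \<gamma> p q"
proof -
  have "{js :: 'a list. length js = 0} = {[]}" by auto
  then show ?thesis by (simp add: sobolev_ip_def dunkl_iter_def)
qed

text \<open>
  Splitting off the innermost operator gives a recursion in which the commutativity of the Dunkl
  operators never enters.
\<close>

lemma sobolev_ip_Suc:
  "sobolev_ip \<alpha> \<gamma> (Suc m) p q =
     L2_ip \<alpha> \<gamma> p q + (\<Sum>j\<in>UNIV. sobolev_ip \<alpha> \<gamma> m (dunkl \<gamma> j p) (dunkl \<gamma> j q))"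
proof -
  let ?t = "\<lambda>js p q. L2_ip \<alpha> \<gamma> (dunkl_iter \<gamma> js p) (dunkl_iter \<gamma> js q)"
  have step: "(\<Sum>js | length js = Suc k. ?t js p q)
      = (\<Sum>j\<in>UNIV. \<Sum>js | length js = k. ?t js (dunkl \<gamma> j p) (dunkl \<gamma> j q))" for k
  proof -
    have bl: "butlast js @ [last js] = js" if "length js = Suc k" for js :: "'a list"
      by (rule append_butlast_last_id) (use that in auto)
    have "(\<Sum>js | length js = Suc k. ?t js p q)
        = (\<Sum>(j, js)\<in>UNIV \<times> {js. length js = k}. ?t (js @ [j]) p q)"
      by (rule sum.reindex_bij_witness[where i = "\<lambda>(j, js). js @ [j]" and j = "\<lambda>js. (last js, butlast js)"])
         (auto simp: bl)
    also have "\<dots> = (\<Sum>j\<in>UNIV. \<Sum>js | length js = k. ?t (js @ [j]) p q)"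
      by (simp add: sum.cartesian_product)
    finally show ?thesis by (simp add: dunkl_iter_snoc)
  qed
  have "sobolev_ip \<alpha> \<gamma> (Suc m) p q
      = (\<Sum>js | length js = 0. ?t js p q) + (\<Sum>k\<le>m. \<Sum>js | length js = Suc k. ?t js p q)"
    unfolding sobolev_ip_def by (rule sum.atMost_Suc_shift)
  also have "(\<Sum>js | length js = 0. ?t js p q) = L2_ip \<alpha> \<gamma> p q"
    using sobolev_ip_0[of \<alpha> \<gamma> p q] by (simp add: sobolev_ip_def)
  also have "(\<Sum>k\<le>m. \<Sum>js | length js = Suc k. ?t js p q)
      = (\<Sum>j\<in>UNIV. sobolev_ip \<alpha> \<gamma> m (dunkl \<gamma> j p) (dunkl \<gamma> j q))"
    unfolding step sobolev_ip_def by (rule sum.swap)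
  finally show ?thesis .
qed

lemma sobolev_ip_cong:
  "(\<And>x. x \<in> ball 0 1 \<Longrightarrow> p x = p' x) \<Longrightarrow> (\<And>x. x \<in> ball 0 1 \<Longrightarrow> q x = q' x) \<Longrightarrow>
     sobolev_ip \<alpha> \<gamma> m p q = sobolev_ip \<alpha> \<gamma> m p' q'"
proof (induction m arbitrary: p q p' q')
  case 0
  then show ?case unfolding sobolev_ip_0 by (rule L2_ip_cong)
next
  case (Suc m)
  have "L2_ip \<alpha> \<gamma> p q = L2_ip \<alpha> \<gamma> p' q'" using Suc.prems by (rule L2_ip_cong)
  moreover have "sobolev_ip \<alpha> \<gamma> m (dunkl \<gamma> j p) (dunkl \<gamma> j q) = sobolev_ip \<alpha> \<gamma> m (dunkl \<gamma> j p') (dunkl \<gamma> j q')" for j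
    by (rule Suc.IH) (use Suc.prems dunkl_cong in blast)+
  ultimately show ?case unfolding sobolev_ip_Suc by simp
qed

context ball_wt
begin

lemma sobolev_semi_ip: "semi_ip (Cball m) (sobolev_ip \<alpha> \<gamma> m)"
proof (induction m)
  case 0
  show ?case
    by unfold_locales
       (auto simp: sobolev_ip_0 Cball_0_L2 L2.ip_add L2.ip_scale L2.ip_nonneg intro: L2.ip_sym)
next
  case (Suc m)
  interpret S: semi_ip "Cball m" "sobolev_ip \<alpha> \<gamma> m" by (rule Suc)
  show ?case
  proof
    fix f g h :: "real ^ 'n \<Rightarrow> real" and c :: real
    assume f: "f \<in> Cball (Suc m)"
    show "(\<lambda>x. c * f x) \<in> Cball (Suc m)" using f by (rule Cball_scale)
    assume h: "h \<in> Cball (Suc m)"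
    have L: "f \<in> L2_space \<alpha> \<gamma>" "h \<in> L2_space \<alpha> \<gamma>" using f h Cball_0 Cball_0_L2 by blast+
    have D: "dunkl \<gamma> j f \<in> Cball m" "dunkl \<gamma> j h \<in> Cball m" for j using f h by (auto intro: dunkl_Cball)
    have "sobolev_ip \<alpha> \<gamma> m (dunkl \<gamma> j (\<lambda>x. c * f x)) (dunkl \<gamma> j h)
        = c * sobolev_ip \<alpha> \<gamma> m (dunkl \<gamma> j f) (dunkl \<gamma> j h)" for j
      unfolding S.ip_scale[OF D, symmetric]
      by (rule sobolev_ip_cong) (use dunkl_scale[OF f] in auto)
    then show "sobolev_ip \<alpha> \<gamma> (Suc m) (\<lambda>x. c * f x) h = c * sobolev_ip \<alpha> \<gamma> (Suc m) f h"
      unfolding sobolev_ip_Suc L2.ip_scale[OF L] by (simp add: distrib_left sum_distrib_left)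
    assume g: "g \<in> Cball (Suc m)"
    show "(\<lambda>x. f x + g x) \<in> Cball (Suc m)" using f g by (rule Cball_add)
    have Lg: "g \<in> L2_space \<alpha> \<gamma>" using g Cball_0 Cball_0_L2 by blast
    have Dg: "dunkl \<gamma> j g \<in> Cball m" for j using g by (rule dunkl_Cball)
    have "sobolev_ip \<alpha> \<gamma> m (dunkl \<gamma> j (\<lambda>x. f x + g x)) (dunkl \<gamma> j h)
        = sobolev_ip \<alpha> \<gamma> m (dunkl \<gamma> j f) (dunkl \<gamma> j h) + sobolev_ip \<alpha> \<gamma> m (dunkl \<gamma> j g) (dunkl \<gamma> j h)" for j
      unfolding S.ip_add[OF D(1) Dg D(2), symmetric]
      by (rule sobolev_ip_cong) (use dunkl_add[OF f g] in auto)
    then show "sobolev_ip \<alpha> \<gamma> (Suc m) (\<lambda>x. f x + g x) h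
        = sobolev_ip \<alpha> \<gamma> (Suc m) f h + sobolev_ip \<alpha> \<gamma> (Suc m) g h"
      unfolding sobolev_ip_Suc L2.ip_add[OF L(1) Lg L(2)] by (simp add: sum.distrib)
  next
    fix f g :: "real ^ 'n \<Rightarrow> real"
    have "sobolev_ip \<alpha> \<gamma> m (dunkl \<gamma> j f) (dunkl \<gamma> j g) = sobolev_ip \<alpha> \<gamma> m (dunkl \<gamma> j g) (dunkl \<gamma> j f)" for j
      by (rule S.ip_sym)
    then show "sobolev_ip \<alpha> \<gamma> (Suc m) f g = sobolev_ip \<alpha> \<gamma> (Suc m) g f"
      unfolding sobolev_ip_Suc L2.ip_sym[of f g] by simp
    show "sobolev_ip \<alpha> \<gamma> (Suc m) f f \<ge> 0"
      unfolding sobolev_ip_Suc by (intro add_nonneg_nonneg sum_nonneg L2.ip_nonneg S.ip_nonneg)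
  qed auto
qed

sublocale S: semi_ip "Cball m" "sobolev_ip \<alpha> \<gamma> m" for m
  by (rule sobolev_semi_ip)

abbreviation snrm :: "nat \<Rightarrow> (real ^ 'n \<Rightarrow> real) \<Rightarrow> real" where
  "snrm m \<equiv> ip_norm (sobolev_ip \<alpha> \<gamma> m)"

lemma snrm_0: "snrm 0 u = nrm u"
  by (simp add: ip_norm_def sobolev_ip_0)

lemma snrm_Suc: "(snrm (Suc m) u)\<^sup>2 = (nrm u)\<^sup>2 + (\<Sum>j\<in>UNIV. (snrm m (dunkl \<gamma> j u))\<^sup>2)"
  unfolding S.nrm_sq L2.nrm_sq sobolev_ip_Suc ..

lemma snrm_cong: "(\<And>x. x \<in> ball 0 1 \<Longrightarrow> u x = v x) \<Longrightarrow> snrm m u = snrm m v"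
  unfolding ip_norm_def by (rule arg_cong[OF sobolev_ip_cong])

lemma nrm_le_snrm: "nrm u \<le> snrm m u"
proof (cases m)
  case (Suc k)
  have "(nrm u)\<^sup>2 \<le> (snrm m u)\<^sup>2" unfolding Suc snrm_Suc by (simp add: sum_nonneg)
  then show ?thesis by (rule power2_le_imp_le) simp
qed (simp add: snrm_0)

lemma snrm_dunkl_le: "snrm m (dunkl \<gamma> j u) \<le> snrm (Suc m) u"
proof (rule power2_le_imp_le)
  have "(snrm m (dunkl \<gamma> j u))\<^sup>2 \<le> (\<Sum>j\<in>UNIV. (snrm m (dunkl \<gamma> j u))\<^sup>2)"
    by (rule member_le_sum) auto
  then show "(snrm m (dunkl \<gamma> j u))\<^sup>2 \<le> (snrm (Suc m) u)\<^sup>2"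
    unfolding snrm_Suc using zero_le_power2[of "nrm u"] by linarith
qed simp

lemma snrm_le_Suc: "snrm m u \<le> snrm (Suc m) u"
proof (induction m arbitrary: u)
  case 0
  then show ?case unfolding snrm_0 by (rule nrm_le_snrm)
next
  case (Suc m)
  have "(snrm m (dunkl \<gamma> j u))\<^sup>2 \<le> (snrm (Suc m) (dunkl \<gamma> j u))\<^sup>2" for j
    by (intro power_mono Suc.IH) simp
  then have "(snrm (Suc m) u)\<^sup>2 \<le> (snrm (Suc (Suc m)) u)\<^sup>2"
    unfolding snrm_Suc[of m u] snrm_Suc[of "Suc m" u] by (intro add_left_mono sum_mono)
  then show ?case by (rule power2_le_imp_le) simp
qed

lemma snrm_mono: "m \<le> n \<Longrightarrow> snrm m u \<le> snrm n u"
  by (rule lift_Suc_mono_le[of "\<lambda>m. snrm m u"]) (rule snrm_le_Suc)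

lemma snrm_Suc_le:
  assumes "nrm u \<le> a" "\<And>j. snrm m (dunkl \<gamma> j u) \<le> b j" "a \<ge> 0"
  shows "snrm (Suc m) u \<le> a + (\<Sum>j\<in>UNIV. b j)"
proof (rule power2_le_imp_le)
  have b: "b j \<ge> 0" for j using assms(2)[of j] S.nrm_nonneg[of m "dunkl \<gamma> j u"] by linarith
  have s: "(\<Sum>j\<in>J. (b j)\<^sup>2) \<le> (\<Sum>j\<in>J. b j)\<^sup>2" if "finite J" for J :: "'n set"
    using that
  proof (induction J rule: finite_induct)
    case (insert j J)
    have "0 \<le> b j * sum b J" by (intro mult_nonneg_nonneg sum_nonneg b)
    then show ?case using insert by (simp add: power2_sum)
  qed simp
  have "(snrm (Suc m) u)\<^sup>2 \<le> a\<^sup>2 + (\<Sum>j\<in>UNIV. (b j)\<^sup>2)"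
    unfolding snrm_Suc by (intro add_mono sum_mono power_mono assms) auto
  also have "\<dots> \<le> a\<^sup>2 + (\<Sum>j\<in>UNIV. b j)\<^sup>2" using s[of UNIV] by simp
  also have "\<dots> \<le> (a + (\<Sum>j\<in>UNIV. b j))\<^sup>2"
    using assms(3) sum_nonneg[of UNIV b] b by (simp add: power2_sum)
  finally show "(snrm (Suc m) u)\<^sup>2 \<le> (a + (\<Sum>j\<in>UNIV. b j))\<^sup>2" .
  show "0 \<le> a + (\<Sum>j\<in>UNIV. b j)" using assms(3) b by (intro add_nonneg_nonneg sum_nonneg)
qed

lemma nrm_reflect:
  assumes "u \<in> Cball 0" shows "nrm (\<lambda>x. u (reflect j x)) = nrm u"
proof -
  have "(\<lambda>x. u x * u x) \<in> borel_measurable \<mu>"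
    by (intro Cball_0_measurable Cball_mult assms)
  from integral_reflect(1)[OF this, of j] show ?thesis by (simp add: ip_norm_def L2_ip_def)
qed

lemma snrm_reflect: "u \<in> Cball m \<Longrightarrow> snrm m (\<lambda>x. u (reflect i x)) = snrm m u"
proof (induction m arbitrary: u)
  case 0
  then show ?case unfolding snrm_0 by (rule nrm_reflect)
next
  case (Suc m)
  have "snrm m (dunkl \<gamma> j (\<lambda>x. u (reflect i x))) = snrm m (dunkl \<gamma> j u)" for j
  proof -
    have D: "dunkl \<gamma> j u \<in> Cball m" by (rule dunkl_Cball[OF Suc.prems])
    have "snrm m (dunkl \<gamma> j (\<lambda>x. u (reflect i x)))
        = snrm m (\<lambda>x. (if i = j then -1 else 1) * dunkl \<gamma> j u (reflect i x))"
      by (rule snrm_cong) (rule dunkl_reflect[OF Suc.prems])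
    also have "\<dots> = snrm m (\<lambda>x. dunkl \<gamma> j u (reflect i x))"
      by (subst S.nrm_scale[OF Cball_reflect[OF D]]) simp
    finally show ?thesis using Suc.IH[OF D] by simp
  qed
  then have "(snrm (Suc m) (\<lambda>x. u (reflect i x)))\<^sup>2 = (snrm (Suc m) u)\<^sup>2"
    unfolding snrm_Suc using nrm_reflect[OF Cball_0[OF Suc.prems]] by simp
  then show ?case by simp
qed

lemma nrm_mult_le:
  assumes "f \<in> Cball 0" "u \<in> Cball 0" "\<And>x. x \<in> ball 0 1 \<Longrightarrow> \<bar>f x\<bar> \<le> 1"
  shows "nrm (\<lambda>x. f x * u x) \<le> nrm u"
proof (rule power2_le_imp_le)
  have "(LINT x|\<mu>. (f x * u x) * (f x * u x)) \<le> (LINT x|\<mu>. u x * u x)"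
  proof (rule integral_mono)
    show "integrable \<mu> (\<lambda>x. (f x * u x) * (f x * u x))" "integrable \<mu> (\<lambda>x. u x * u x)"
      by (intro Cball_0_integrable Cball_mult assms)+
    fix x assume "x \<in> space \<mu>"
    then have "\<bar>f x * u x\<bar> \<le> \<bar>u x\<bar>" using assms(3)[of x] by (simp add: abs_mult mult_left_le_one_le)
    then show "(f x * u x) * (f x * u x) \<le> u x * u x"
      unfolding abs_le_square_iff by (simp add: power2_eq_square)
  qed
  then show "(nrm (\<lambda>x. f x * u x))\<^sup>2 \<le> (nrm u)\<^sup>2" unfolding L2.nrm_sq L2_ip_def .
qed simp

lemma coord_abs_le_1: "x \<in> ball 0 1 \<Longrightarrow> \<bar>(x :: real ^ 'n) $ i\<bar> \<le> 1"
  using component_le_norm_cart[of x i] by (simp add: mem_ball_0)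

text \<open>
  A coordinate commutes with a Dunkl operator up to the identity and a reflection, both of which
  preserve Sobolev norms.
\<close>

lemma snrm_coord_mult_bounded:
  "\<exists>C\<ge>0. \<forall>u\<in>Cball m. snrm m (\<lambda>x. x $ i * u x) \<le> C * snrm m u"
proof (induction m)
  case 0
  show ?case unfolding snrm_0
    by (rule exI[of _ 1]) (auto intro!: nrm_mult_le Cball_coord coord_abs_le_1)
next
  case (Suc m)
  then obtain C where C: "C \<ge> 0" "\<And>u. u \<in> Cball m \<Longrightarrow> snrm m (\<lambda>x. x $ i * u x) \<le> C * snrm m u" by blast
  define B where "B = C + 1 + (\<Sum>j\<in>UNIV. \<bar>\<gamma> $ j\<bar>)"
  have g: "\<bar>\<gamma> $ j\<bar> \<le> (\<Sum>j\<in>UNIV. \<bar>\<gamma> $ j\<bar>)" for j by (rule member_le_sum) auto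
  have B: "B \<ge> 0" unfolding B_def using C(1) by (simp add: sum_nonneg)
  have "snrm (Suc m) (\<lambda>x. x $ i * u x) \<le> (1 + real CARD('n) * B) * snrm (Suc m) u"
    if u: "u \<in> Cball (Suc m)" for u
  proof -
    have D: "dunkl \<gamma> j u \<in> Cball m" for j by (rule dunkl_Cball[OF u])
    have um: "u \<in> Cball m" by (rule Cball_Suc_subset[OF u])
    have "snrm m (dunkl \<gamma> j (\<lambda>x. x $ i * u x)) \<le> B * snrm (Suc m) u" for j
    proof -
      have 1: "snrm m (\<lambda>x. x $ i * dunkl \<gamma> j u x) \<le> C * snrm (Suc m) u"
        using C(2)[OF D, of j] mult_left_mono[OF snrm_dunkl_le[of m j u] C(1)] by linarith
      show ?thesis
      proof (cases "i = j")
        case True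
        have "snrm m (dunkl \<gamma> j (\<lambda>x. x $ i * u x))
            = snrm m (\<lambda>x. x $ i * dunkl \<gamma> j u x + (u x + \<gamma> $ j * u (reflect j x)))"
          by (rule snrm_cong) (use dunkl_coord_mult[OF u] True in auto)
        also have "\<dots> \<le> snrm m (\<lambda>x. x $ i * dunkl \<gamma> j u x) + snrm m (\<lambda>x. u x + \<gamma> $ j * u (reflect j x))"
          by (intro S.nrm_triangle Cball_mult Cball_coord D Cball_add um Cball_scale Cball_reflect[OF um])
        also have "snrm m (\<lambda>x. u x + \<gamma> $ j * u (reflect j x)) \<le> snrm m u + snrm m (\<lambda>x. \<gamma> $ j * u (reflect j x))"
          by (intro S.nrm_triangle um Cball_scale Cball_reflect[OF um])
        also have "snrm m (\<lambda>x. \<gamma> $ j * u (reflect j x)) = \<bar>\<gamma> $ j\<bar> * snrm m u"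
          by (subst S.nrm_scale[OF Cball_reflect[OF um]]) (simp add: snrm_reflect[OF um])
        finally have "snrm m (dunkl \<gamma> j (\<lambda>x. x $ i * u x)) \<le> C * snrm (Suc m) u + (1 + \<bar>\<gamma> $ j\<bar>) * snrm m u"
          using 1 by (simp add: algebra_simps)
        also have "(1 + \<bar>\<gamma> $ j\<bar>) * snrm m u \<le> (1 + (\<Sum>j\<in>UNIV. \<bar>\<gamma> $ j\<bar>)) * snrm (Suc m) u"
          by (intro mult_mono snrm_le_Suc add_left_mono g) (auto intro!: add_nonneg_nonneg sum_nonneg)
        finally show ?thesis by (simp add: B_def algebra_simps)
      next
        case False
        have "snrm m (dunkl \<gamma> j (\<lambda>x. x $ i * u x)) = snrm m (\<lambda>x. x $ i * dunkl \<gamma> j u x)"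
          by (rule snrm_cong) (use dunkl_coord_mult[OF u] False in auto)
        also have "\<dots> \<le> C * snrm (Suc m) u" by (rule 1)
        also have "\<dots> \<le> B * snrm (Suc m) u"
          by (rule mult_right_mono) (auto simp: B_def intro!: add_nonneg_nonneg sum_nonneg)
        finally show ?thesis .
      qed
    qed
    moreover have "nrm (\<lambda>x. x $ i * u x) \<le> snrm (Suc m) u"
      using nrm_mult_le[OF Cball_coord Cball_0[OF u] coord_abs_le_1] nrm_le_snrm[of u "Suc m"]
      by (rule order_trans)
    ultimately have "snrm (Suc m) (\<lambda>x. x $ i * u x) \<le> snrm (Suc m) u + (\<Sum>j\<in>(UNIV :: 'n set). B * snrm (Suc m) u)"
      by (intro snrm_Suc_le) auto
    then show ?thesis by (simp add: algebra_simps)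
  qed
  then show ?case using B by (intro exI[of _ "1 + real CARD('n) * B"]) auto
qed

end

section \<open>The energy form and its operator\<close>

context ball_wt
begin

text \<open>The Dunkl analogue of Euler's operator \<open>x \<cdot> \<nabla>\<close>.\<close>

definition theta :: "(real ^ 'n \<Rightarrow> real) \<Rightarrow> real ^ 'n \<Rightarrow> real" where
  "theta u x = (\<Sum>j\<in>UNIV. x $ j * dunkl \<gamma> j u x)"

definition flux :: "'n \<Rightarrow> (real ^ 'n \<Rightarrow> real) \<Rightarrow> real ^ 'n \<Rightarrow> real" where
  "flux j v x = dunkl \<gamma> j v x - x $ j * theta v x"

text \<open>
  The second order operator with the orthogonal polynomials of each degree as an invariant space, in
  divergence form; without reflections it is the Sturm--Liouville operator of classical orthogonal
  polynomials on the ball.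
\<close>

definition sturm :: "(real ^ 'n \<Rightarrow> real) \<Rightarrow> real ^ 'n \<Rightarrow> real" where
  "sturm v x = 2 * \<alpha> * theta v x - (\<Sum>j\<in>UNIV. dunkl \<gamma> j (flux j v) x)"

text \<open>
  By Lagrange's identity the energy of \<open>u\<close> is the integral of
  \<open>(1 - r\<^sup>2) \<Sum>\<^sub>j (D\<^sub>j u)\<^sup>2 + \<Sum>\<^sub>i\<^sub><\<^sub>j (x\<^sub>i D\<^sub>j u - x\<^sub>j D\<^sub>i u)\<^sup>2\<close>, a radial part degenerating at the sphere and a full
  angular part.
\<close>

definition energy :: "(real ^ 'n \<Rightarrow> real) \<Rightarrow> (real ^ 'n \<Rightarrow> real) \<Rightarrow> real" where
  "energy u v = (\<Sum>j\<in>UNIV. ip (dunkl \<gamma> j u) (dunkl \<gamma> j v)) - ip (theta u) (theta v)"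

lemma theta_Cball: "u \<in> Cball (Suc m) \<Longrightarrow> theta u \<in> Cball m"
  unfolding theta_def[abs_def] by (intro Cball_sum Cball_mult Cball_coord dunkl_Cball)

lemma flux_Cball: "u \<in> Cball (Suc m) \<Longrightarrow> flux j u \<in> Cball m"
  unfolding flux_def[abs_def] by (intro Cball_minus Cball_mult Cball_coord dunkl_Cball theta_Cball)

lemma sturm_Cball: "u \<in> Cball (Suc (Suc m)) \<Longrightarrow> sturm u \<in> Cball m"
  unfolding sturm_def[abs_def]
  by (intro Cball_minus Cball_scale Cball_sum dunkl_Cball flux_Cball theta_Cball) (auto dest: Cball_Suc_subset)

lemma coord_flux: "(\<Sum>j\<in>UNIV. x $ j * flux j v x) = (1 - (norm x)\<^sup>2) * theta v x"
proof -
  have "(\<Sum>j\<in>UNIV. x $ j * flux j v x) = (\<Sum>j\<in>UNIV. x $ j * dunkl \<gamma> j v x) - (\<Sum>j\<in>UNIV. (x $ j)\<^sup>2) * theta v x"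
    by (simp add: flux_def right_diff_distrib sum_subtractf sum_distrib_right power2_eq_square mult.assoc)
  then show ?thesis by (simp add: norm_sq_eq_sum theta_def[symmetric] left_diff_distrib)
qed

text \<open>The radial cut-off used to approximate \<open>1 / (1 - r\<^sup>2)\<close>.\<close>

lemma radial_Cball:
  fixes e :: real assumes "e > 0"
  shows "(\<lambda>x :: real ^ 'n. 1 / (1 - (norm x)\<^sup>2 + e)) \<in> Cball (Suc 0)"
    and "x \<in> ball 0 1 \<Longrightarrow> partial_deriv j (\<lambda>x :: real ^ 'n. 1 / (1 - (norm x)\<^sup>2 + e)) x = 2 * x $ j * (1 / (1 - (norm x)\<^sup>2 + e))\<^sup>2"
proof -
  let ?g = "\<lambda>x :: real ^ 'n. 1 / (1 - (norm x)\<^sup>2 + e)"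
  have pos: "1 - (norm x)\<^sup>2 + e > 0" if "x \<in> cball 0 1" for x :: "real ^ 'n"
  proof -
    have "(norm x)\<^sup>2 \<le> 1" using that by (simp add: mem_cball_0 power_le_one)
    then show ?thesis using assms by simp
  qed
  have 0: "?g \<in> Cball 0"
    by (rule Cball_0I[of ?g]) (use pos in \<open>force intro!: continuous_intros\<close>)+
  have der: "((\<lambda>t. ?g (x + t *\<^sub>R axis j 1)) has_field_derivative 2 * x $ j * (?g x)\<^sup>2) (at 0)"
    if "x \<in> ball 0 1" for j x
  proof -
    have p: "1 - (norm x)\<^sup>2 + e \<noteq> 0" using pos[of x] that ball_subset_cball by fastforce
    have "((\<lambda>t. 1 - (norm (x + t *\<^sub>R axis j 1))\<^sup>2 + e) has_field_derivative - (2 * x $ j)) (at 0)"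
      using DERIV_add[OF DERIV_diff[OF DERIV_const norm_sq_line_deriv] DERIV_const] by simp
    from DERIV_inverse'[OF this] p
    have "((\<lambda>t. inverse (1 - (norm (x + t *\<^sub>R axis j 1))\<^sup>2 + e)) has_field_derivative
        2 * x $ j * (inverse (1 - (norm x)\<^sup>2 + e))\<^sup>2) (at 0)"
      by (simp add: power2_eq_square mult_ac)
    then show ?thesis by (simp add: inverse_eq_divide)
  qed
  show "?g \<in> Cball (Suc 0)"
    by (rule Cball_SucI[OF 0 _ der]) (intro Cball_mult Cball_const Cball_coord Cball_power 0)
  show "x \<in> ball 0 1 \<Longrightarrow> partial_deriv j ?g x = 2 * x $ j * (?g x)\<^sup>2"
    by (rule partial_derivI[OF der])
qed


text \<open>
  Formally this is an integration by parts of the vector field \<open>flux\<close>, whose normal component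
  \<open>(1 - r\<^sup>2) \<theta>v\<close> vanishes on the sphere and compensates the weight with exponent \<open>\<alpha> > -1\<close>.  The
  adjoint formula is only available with one more power of \<open>1 - r\<^sup>2\<close>, so the field is first multiplied
  by \<open>1 / (1 - r\<^sup>2 + \<epsilon>)\<close>, and \<open>\<epsilon>\<close> tends to zero in the result.
\<close>

theorem energy_eq_sturm:
  assumes u: "u \<in> Cball 1" and v: "v \<in> Cball (Suc 1)"
  shows "energy u v = ip u (sturm v)"
proof -
  note u' = u[unfolded One_nat_def] and v' = v[unfolded One_nat_def]
  have v1: "v \<in> Cball (Suc 0)" using v by (auto dest: Cball_Suc_subset)
  have u0: "u \<in> Cball 0" by (rule Cball_0[OF u])
  define F where "F j = flux j v" for j
  have F1: "F j \<in> Cball (Suc 0)" for j unfolding F_def by (rule flux_Cball[OF v'])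
  have F0: "F j \<in> Cball 0" for j by (rule Cball_0[OF F1])
  have Du: "dunkl \<gamma> j u \<in> Cball 0" and Dv: "dunkl \<gamma> j v \<in> Cball 0" and DF: "dunkl \<gamma> j (F j) \<in> Cball 0" for j
    using u' v1 F1 by (auto intro: dunkl_Cball)
  have th: "theta v \<in> Cball 0" "theta u \<in> Cball 0" using theta_Cball v1 u' by auto
  \<comment> \<open>The claim is that the integral of \<open>X\<close> is \<open>2 \<alpha>\<close> times the integral of \<open>Y\<close>; \<open>q \<epsilon>\<close> tends to one.\<close>
  define X where "X x = (\<Sum>j\<in>UNIV. dunkl \<gamma> j u x * F j x + u x * dunkl \<gamma> j (F j) x)" for x
  define Y where "Y x = u x * theta v x" for x
  have X: "X \<in> Cball 0" unfolding X_def by (intro Cball_sum Cball_add Cball_mult Du F0 u0 DF)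
  have Y: "Y \<in> Cball 0" unfolding Y_def[abs_def] by (intro Cball_mult u0 th)
  define q where "q e x = (1 - (norm x)\<^sup>2) / (1 - (norm x)\<^sup>2 + e)" for e :: real and x :: "real ^ 'n"
  have q01: "0 \<le> q e x \<and> q e x \<le> 1" if "x \<in> ball 0 1" "e > 0" for e x
    using norm_sq_less_1[OF that(1)] that(2) by (simp add: q_def)
  have eps: "(LINT x|\<mu>. q e x * X x + 2 * (q e x)\<^sup>2 * Y x - 2 * (\<alpha> + 1) * q e x * Y x) = 0"
    if e: "e > 0" for e
  proof -
    define g where "g x = 1 / (1 - (norm x)\<^sup>2 + e)" for x :: "real ^ 'n"
    have g1: "g \<in> Cball (Suc 0)" and pg: "\<And>j x. x \<in> ball 0 1 \<Longrightarrow> partial_deriv j g x = 2 * x $ j * (g x)\<^sup>2"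
      unfolding g_def[abs_def] using radial_Cball[OF e] by auto
    have g0: "g \<in> Cball 0" by (rule Cball_0[OF g1])
    have rho: "(\<lambda>x. 1 - (norm x)\<^sup>2) \<in> Cball 0" by (intro Cball_minus Cball_const Cball_norm_sq)
    define Z where "Z j x = (1 - (norm x)\<^sup>2) * g x * (dunkl \<gamma> j u x * F j x + u x * dunkl \<gamma> j (F j) x)
        + 2 * (1 - (norm x)\<^sup>2) * (g x)\<^sup>2 * u x * (x $ j * F j x) - 2 * (\<alpha> + 1) * g x * u x * (x $ j * F j x)"
      for j x
    have Z: "Z j \<in> Cball 0" for j
      unfolding Z_def by (intro Cball_minus Cball_add Cball_mult Cball_power Cball_const Cball_coord
          Cball_norm_sq g0 Du F0 u0 DF)
    have "(LINT x|\<mu>. Z j x) = 0" for j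
    proof -
      have gF: "(\<lambda>x. g x * F j x) \<in> Cball 1" unfolding One_nat_def by (intro Cball_mult g1 F1)
      have DgF: "dunkl \<gamma> j (\<lambda>x. g x * F j x) x = g x * dunkl \<gamma> j (F j) x + 2 * x $ j * (g x)\<^sup>2 * F j x"
        if "x \<in> ball 0 1" for x
        using dunkl_mult_even[OF g1 F1 that, of j \<gamma>] pg[OF that] by (simp add: g_def)
      have I1: "(\<lambda>x. (1 - (norm x)\<^sup>2) * (dunkl \<gamma> j u x * (g x * F j x))) \<in> Cball 0"
        by (intro Cball_mult rho Du g0 F0)
      have I2: "(\<lambda>x. u x * (2 * (\<alpha> + 1) * x $ j * (g x * F j x) - (1 - (norm x)\<^sup>2) * dunkl \<gamma> j (\<lambda>x. g x * F j x) x)) \<in> Cball 0"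
        by (intro Cball_mult Cball_minus u0 Cball_const Cball_coord g0 F0 Cball_norm_sq
            dunkl_Cball[OF gF[unfolded One_nat_def]])
      have "(LINT x|\<mu>. Z j x) = (LINT x|\<mu>. (1 - (norm x)\<^sup>2) * (dunkl \<gamma> j u x * (g x * F j x))
          - u x * (2 * (\<alpha> + 1) * x $ j * (g x * F j x) - (1 - (norm x)\<^sup>2) * dunkl \<gamma> j (\<lambda>x. g x * F j x) x))"
        by (rule Bochner_Integration.integral_cong) (simp_all add: Z_def DgF algebra_simps power2_eq_square)
      also have "\<dots> = L2_ip (\<alpha> + 1) \<gamma> (dunkl \<gamma> j u) (\<lambda>x. g x * F j x)
          - ip u (\<lambda>x. 2 * (\<alpha> + 1) * x $ j * (g x * F j x) - (1 - (norm x)\<^sup>2) * dunkl \<gamma> j (\<lambda>x. g x * F j x) x)"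
        unfolding L2_ip_next[OF Du Cball_0[OF gF]] unfolding L2_ip_def
        by (rule Bochner_Integration.integral_diff) (intro Cball_0_integrable I1 I2)+
      also have "\<dots> = 0" using dunkl_adjoint[OF u gF, of j] by simp
      finally show ?thesis .
    qed
    then have "(LINT x|\<mu>. (\<Sum>j\<in>UNIV. Z j x)) = 0"
      by (subst Bochner_Integration.integral_sum) (auto intro: Cball_0_integrable Z)
    moreover have "(LINT x|\<mu>. (\<Sum>j\<in>UNIV. Z j x))
        = (LINT x|\<mu>. q e x * X x + 2 * (q e x)\<^sup>2 * Y x - 2 * (\<alpha> + 1) * q e x * Y x)"
    proof (rule Bochner_Integration.integral_cong[OF refl])
      fix x :: "real ^ 'n"
      have qg: "q e x = (1 - (norm x)\<^sup>2) * g x" by (simp add: q_def g_def)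
      have "(\<Sum>j\<in>UNIV. Z j x) = (1 - (norm x)\<^sup>2) * g x * X x
          + 2 * (1 - (norm x)\<^sup>2) * (g x)\<^sup>2 * u x * (\<Sum>j\<in>UNIV. x $ j * F j x)
          - 2 * (\<alpha> + 1) * g x * u x * (\<Sum>j\<in>UNIV. x $ j * F j x)"
        unfolding X_def sum_distrib_left by (simp only: sum.distrib[symmetric] sum_subtractf[symmetric] Z_def)
      then show "(\<Sum>j\<in>UNIV. Z j x) = q e x * X x + 2 * (q e x)\<^sup>2 * Y x - 2 * (\<alpha> + 1) * q e x * Y x"
        unfolding F_def coord_flux qg Y_def by (simp add: power2_eq_square mult_ac)
    qed
    ultimately show ?thesis by simp
  qed
  define e where "e n = 1 / real (Suc n)" for n
  have e: "e n > 0" for n by (simp add: e_def)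
  have e_lim: "e \<longlonglongrightarrow> 0" unfolding e_def by (rule LIMSEQ_Suc[OF lim_1_over_n])
  have "(\<lambda>n. LINT x|\<mu>. q (e n) x * X x + 2 * (q (e n) x)\<^sup>2 * Y x - 2 * (\<alpha> + 1) * q (e n) x * Y x)
      \<longlonglongrightarrow> (LINT x|\<mu>. X x + 2 * Y x - 2 * (\<alpha> + 1) * Y x)"
  proof (rule integral_dominated_convergence[where w = "\<lambda>x. \<bar>X x\<bar> + 2 * \<bar>Y x\<bar> + 2 * (\<alpha> + 1) * \<bar>Y x\<bar>"])
    have [measurable]: "X \<in> borel_measurable \<mu>" "Y \<in> borel_measurable \<mu>" "(\<lambda>x. (norm x)\<^sup>2) \<in> borel_measurable \<mu>"
      by (intro Cball_0_measurable X Y Cball_norm_sq)+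
    show "(\<lambda>x. X x + 2 * Y x - 2 * (\<alpha> + 1) * Y x) \<in> borel_measurable \<mu>"
      "(\<lambda>x. q (e n) x * X x + 2 * (q (e n) x)\<^sup>2 * Y x - 2 * (\<alpha> + 1) * q (e n) x * Y x) \<in> borel_measurable \<mu>" for n
      unfolding q_def by measurable
    show "integrable \<mu> (\<lambda>x. \<bar>X x\<bar> + 2 * \<bar>Y x\<bar> + 2 * (\<alpha> + 1) * \<bar>Y x\<bar>)"
      using Cball_0_integrable[OF X] Cball_0_integrable[OF Y] by simp
    show "AE x in \<mu>. (\<lambda>n. q (e n) x * X x + 2 * (q (e n) x)\<^sup>2 * Y x - 2 * (\<alpha> + 1) * q (e n) x * Y x)
        \<longlonglongrightarrow> X x + 2 * Y x - 2 * (\<alpha> + 1) * Y x"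
    proof (rule AE_I2)
      fix x assume "x \<in> space \<mu>"
      then have p: "1 - (norm x)\<^sup>2 > 0" using norm_sq_less_1 by simp
      then have "(\<lambda>n. q (e n) x) \<longlonglongrightarrow> (1 - (norm x)\<^sup>2) / (1 - (norm x)\<^sup>2 + 0)"
        unfolding q_def by (intro tendsto_intros e_lim) simp
      then have "(\<lambda>n. q (e n) x) \<longlonglongrightarrow> 1" using p by simp
      then have "(\<lambda>n. q (e n) x * X x + 2 * (q (e n) x)\<^sup>2 * Y x - 2 * (\<alpha> + 1) * q (e n) x * Y x)
        \<longlonglongrightarrow> 1 * X x + 2 * 1\<^sup>2 * Y x - 2 * (\<alpha> + 1) * 1 * Y x" by (intro tendsto_intros)
      then show "(\<lambda>n. q (e n) x * X x + 2 * (q (e n) x)\<^sup>2 * Y x - 2 * (\<alpha> + 1) * q (e n) x * Y x)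
        \<longlonglongrightarrow> X x + 2 * Y x - 2 * (\<alpha> + 1) * Y x" by simp
    qed
    show "AE x in \<mu>. norm (q (e n) x * X x + 2 * (q (e n) x)\<^sup>2 * Y x - 2 * (\<alpha> + 1) * q (e n) x * Y x)
        \<le> \<bar>X x\<bar> + 2 * \<bar>Y x\<bar> + 2 * (\<alpha> + 1) * \<bar>Y x\<bar>" for n
    proof (rule AE_I2)
      fix x assume "x \<in> space \<mu>"
      then have q: "0 \<le> q (e n) x" "q (e n) x \<le> 1" using q01[of x "e n"] e by auto
      have q2: "(q (e n) x)\<^sup>2 \<le> 1" using q by (simp add: power_le_one)
      have a: "\<alpha> + 1 > 0" using \<alpha> by simp
      have "\<bar>q (e n) x * X x\<bar> \<le> \<bar>X x\<bar>" using q by (simp add: abs_mult mult_left_le_one_le)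
      moreover have "\<bar>2 * (q (e n) x)\<^sup>2 * Y x\<bar> \<le> 2 * \<bar>Y x\<bar>"
        using q2 by (simp add: abs_mult mult_left_le_one_le)
      moreover have "\<bar>2 * (\<alpha> + 1) * q (e n) x * Y x\<bar> \<le> 2 * (\<alpha> + 1) * \<bar>Y x\<bar>"
        using q a by (simp add: abs_mult mult_left_le_one_le mult.assoc)
      ultimately show "norm (q (e n) x * X x + 2 * (q (e n) x)\<^sup>2 * Y x - 2 * (\<alpha> + 1) * q (e n) x * Y x)
        \<le> \<bar>X x\<bar> + 2 * \<bar>Y x\<bar> + 2 * (\<alpha> + 1) * \<bar>Y x\<bar>" unfolding real_norm_def by linarith
    qed
  qed
  then have "(LINT x|\<mu>. X x + 2 * Y x - 2 * (\<alpha> + 1) * Y x) = 0"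
    unfolding eps[OF e] using LIMSEQ_unique[OF tendsto_const] by metis
  moreover have "X x + 2 * Y x - 2 * (\<alpha> + 1) * Y x
      = (\<Sum>j\<in>UNIV. dunkl \<gamma> j u x * dunkl \<gamma> j v x) - theta u x * theta v x - u x * sturm v x" for x
  proof -
    have "X x = (\<Sum>j\<in>UNIV. dunkl \<gamma> j u x * dunkl \<gamma> j v x)
        - (\<Sum>j\<in>UNIV. x $ j * dunkl \<gamma> j u x) * theta v x + u x * (\<Sum>j\<in>UNIV. dunkl \<gamma> j (F j) x)"
      unfolding X_def
      by (simp add: sum.distrib sum_distrib_left F_def flux_def right_diff_distrib sum_subtractf
          sum_distrib_right mult_ac)
    then show ?thesis unfolding theta_def[of u x, symmetric] sturm_def Y_def F_def
      by (simp add: algebra_simps)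
  qed
  ultimately have "(LINT x|\<mu>. (\<Sum>j\<in>UNIV. dunkl \<gamma> j u x * dunkl \<gamma> j v x) - theta u x * theta v x - u x * sturm v x) = 0"
    by simp
  moreover have "(LINT x|\<mu>. (\<Sum>j\<in>UNIV. dunkl \<gamma> j u x * dunkl \<gamma> j v x) - theta u x * theta v x - u x * sturm v x)
      = energy u v - ip u (sturm v)"
  proof -
    have i: "integrable \<mu> (\<lambda>x. dunkl \<gamma> j u x * dunkl \<gamma> j v x)" "integrable \<mu> (\<lambda>x. theta u x * theta v x)"
      "integrable \<mu> (\<lambda>x. u x * sturm v x)" for j
      by (intro Cball_0_integrable Cball_mult Du Dv th u0 sturm_Cball v')+
    then show ?thesis unfolding energy_def L2_ip_def by simp
  qed
  ultimately show ?thesis by simp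
qed


subsection \<open>Positivity of the energy\<close>

lemma energy_sym: "energy u v = energy v u"
  unfolding energy_def by (simp add: L2.ip_sym[of "dunkl \<gamma> _ u"] L2.ip_sym[of "theta u"])

lemma theta_minus:
  "u \<in> Cball (Suc m) \<Longrightarrow> v \<in> Cball (Suc m) \<Longrightarrow> x \<in> ball 0 1 \<Longrightarrow> theta (u - v) x = theta u x - theta v x"
  unfolding theta_def by (simp add: dunkl_minus right_diff_distrib sum_subtractf del: minus_apply)

lemma energy_minus:
  assumes u: "u \<in> Cball (Suc 0)" and v: "v \<in> Cball (Suc 0)" and w: "w \<in> Cball (Suc 0)"
  shows "energy (u - v) w = energy u w - energy v w"
proof -
  have L: "dunkl \<gamma> j f \<in> L2_space \<alpha> \<gamma>" "theta f \<in> L2_space \<alpha> \<gamma>" if "f \<in> Cball (Suc 0)" for f j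
    using Cball_0_L2 dunkl_Cball[OF that] theta_Cball[OF that] by auto
  have "ip (dunkl \<gamma> j (u - v)) (dunkl \<gamma> j w) = ip (dunkl \<gamma> j u - dunkl \<gamma> j v) (dunkl \<gamma> j w)" for j
    by (rule L2_ip_cong) (simp_all only: dunkl_minus[OF u v] minus_apply)
  moreover have "ip (theta (u - v)) (theta w) = ip (theta u - theta v) (theta w)"
    by (rule L2_ip_cong) (simp_all only: theta_minus[OF u v] minus_apply)
  ultimately show ?thesis
    unfolding energy_def by (simp add: L2.ip_minus L u v w sum_subtractf del: minus_apply)
qed

lemma energy_sq_minus:
  assumes u: "u \<in> Cball (Suc 0)" and v: "v \<in> Cball (Suc 0)"
  shows "energy (u - v) (u - v) = energy u u - 2 * energy u v + energy v v"
  using energy_minus[OF u v Cball_fun_minus[OF u v]] energy_minus[OF u v u] energy_minus[OF u v v]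
    energy_sym[of u "u - v"] energy_sym[of v "u - v"] energy_sym[of v u]
  by linarith

lemma energy_le: "energy u u \<le> (\<Sum>j\<in>UNIV. (nrm (dunkl \<gamma> j u))\<^sup>2)"
  unfolding energy_def L2.nrm_sq using L2.ip_nonneg[of "theta u"] by linarith

text \<open>
  By Cauchy--Schwarz \<open>(\<theta>u)\<^sup>2 \<le> r\<^sup>2 \<Sum>\<^sub>j (D\<^sub>j u)\<^sup>2\<close>, so the energy controls the Dunkl gradient in the
  weight with one more power of \<open>1 - r\<^sup>2\<close>.
\<close>

lemma energy_ge:
  assumes u: "u \<in> Cball (Suc 0)"
  shows "(\<Sum>j\<in>UNIV. L2_ip (\<alpha> + 1) \<gamma> (dunkl \<gamma> j u) (dunkl \<gamma> j u)) \<le> energy u u"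
proof -
  have D: "dunkl \<gamma> j u \<in> Cball 0" for j by (rule dunkl_Cball[OF u])
  have th: "theta u \<in> Cball 0" by (rule theta_Cball[OF u])
  have i1: "integrable \<mu> (\<lambda>x. (1 - (norm x)\<^sup>2) * (dunkl \<gamma> j u x * dunkl \<gamma> j u x))" for j
    by (intro Cball_0_integrable Cball_mult Cball_minus Cball_const Cball_norm_sq D)
  have i2: "integrable \<mu> (\<lambda>x. dunkl \<gamma> j u x * dunkl \<gamma> j u x)" for j
    by (intro Cball_0_integrable Cball_mult D)
  have i3: "integrable \<mu> (\<lambda>x. theta u x * theta u x)"
    by (intro Cball_0_integrable Cball_mult th)
  have "(\<Sum>j\<in>UNIV. L2_ip (\<alpha> + 1) \<gamma> (dunkl \<gamma> j u) (dunkl \<gamma> j u))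
      = (LINT x|\<mu>. (\<Sum>j\<in>UNIV. (1 - (norm x)\<^sup>2) * (dunkl \<gamma> j u x * dunkl \<gamma> j u x)))"
    unfolding L2_ip_next[OF D D] using i1 by simp
  also have "\<dots> \<le> (LINT x|\<mu>. (\<Sum>j\<in>UNIV. dunkl \<gamma> j u x * dunkl \<gamma> j u x) - theta u x * theta u x)"
  proof (rule integral_mono)
    fix x :: "real ^ 'n"
    have "(theta u x)\<^sup>2 \<le> (\<Sum>j\<in>UNIV. (x $ j)\<^sup>2) * (\<Sum>j\<in>UNIV. (dunkl \<gamma> j u x)\<^sup>2)"
      unfolding theta_def by (rule Cauchy_Schwarz_ineq_sum)
    moreover have "(\<Sum>j\<in>UNIV. (1 - (norm x)\<^sup>2) * (dunkl \<gamma> j u x * dunkl \<gamma> j u x))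
        = (1 - (norm x)\<^sup>2) * (\<Sum>j\<in>UNIV. (dunkl \<gamma> j u x)\<^sup>2)"
      by (simp only: sum_distrib_left power2_eq_square)
    ultimately show "(\<Sum>j\<in>UNIV. (1 - (norm x)\<^sup>2) * (dunkl \<gamma> j u x * dunkl \<gamma> j u x))
        \<le> (\<Sum>j\<in>UNIV. dunkl \<gamma> j u x * dunkl \<gamma> j u x) - theta u x * theta u x"
      by (simp add: norm_sq_eq_sum[symmetric] power2_eq_square[symmetric] left_diff_distrib)
  qed (intro Bochner_Integration.integrable_sum Bochner_Integration.integrable_diff i1 i2 i3)+
  also have "\<dots> = energy u u"
    unfolding energy_def L2_ip_def using i2 i3 by simp
  finally show ?thesis .
qed

lemma energy_nonneg: "u \<in> Cball (Suc 0) \<Longrightarrow> energy u u \<ge> 0"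
proof -
  assume "u \<in> Cball (Suc 0)"
  from energy_ge[OF this] show ?thesis
    by (rule order_trans[rotated]) (intro sum_nonneg, simp add: L2_ip_def)
qed

subsection \<open>The energy on polynomials\<close>

lemma dunkl_zero: "dunkl \<gamma> j (\<lambda>_. 0) = (\<lambda>_. 0)"
  by (rule below_0[OF below_dunkl[OF below_zero]])

lemma below_dunkl_same: "p \<in> polys_below n \<Longrightarrow> dunkl \<gamma> j p \<in> polys_below n"
proof (cases n)
  case 0
  assume "p \<in> polys_below n"
  then have "p = (\<lambda>_. 0)" using 0 below_0 by blast
  then show ?thesis using below_zero by (simp add: dunkl_zero)
next
  case (Suc k)
  assume "p \<in> polys_below n"
  then have "dunkl \<gamma> j p \<in> polys_below k" unfolding Suc by (rule below_dunkl)
  then show ?thesis unfolding Suc by (rule below_mono[rotated]) simp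
qed

lemma theta_zero: "theta (\<lambda>_. 0) = (\<lambda>_. 0)"
  by (simp add: theta_def[abs_def] dunkl_zero)

lemma theta_below:
  assumes "p \<in> polys_below n" shows "theta p \<in> polys_below n"
proof (cases n)
  case 0
  then have "p = (\<lambda>_. 0)" using assms below_0 by blast
  then show ?thesis using below_zero by (simp add: theta_zero)
next
  case (Suc k)
  then show ?thesis using assms unfolding theta_def[abs_def]
    by (auto intro!: below_sum below_coord_mult below_dunkl)
qed

lemma sturm_below:
  assumes "p \<in> polys_below n" shows "sturm p \<in> polys_below n"
proof (cases n)
  case 0
  then have p: "p = (\<lambda>_. 0)" using assms below_0 by blast
  have "flux j (\<lambda>_. 0) = (\<lambda>_. 0)" for j by (simp add: flux_def[abs_def] theta_zero dunkl_zero)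
  then have "sturm p = (\<lambda>_. 0)" unfolding p by (simp add: sturm_def[abs_def] theta_zero dunkl_zero)
  then show ?thesis using below_zero by simp
next
  case (Suc k)
  have "dunkl \<gamma> j p \<in> polys_below (Suc n)" for j
    by (rule below_mono[of n]) (auto intro: below_dunkl_same assms)
  then have "flux j p \<in> polys_below (Suc n)" for j
    unfolding flux_def[abs_def] by (intro below_minus below_coord_mult theta_below assms)
  then show ?thesis unfolding sturm_def[abs_def]
    by (intro below_minus below_scale theta_below assms below_sum below_dunkl)
qed

text \<open>
  Such combinations of reflections preserve degrees and are bounded in the mean; they absorb all
  contributions of \<open>\<gamma>\<close> to the operators below.
\<close>

definition refl_op :: "real \<Rightarrow> ('n \<Rightarrow> real) \<Rightarrow> (real ^ 'n \<Rightarrow> real) \<Rightarrow> real ^ 'n \<Rightarrow> real" where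
  "refl_op c a u x = c * u x + (\<Sum>j\<in>UNIV. a j * u (reflect j x))"

lemma refl_op_Cball: "u \<in> Cball m \<Longrightarrow> refl_op c a u \<in> Cball m"
  unfolding refl_op_def[abs_def] by (intro Cball_add Cball_scale Cball_sum Cball_reflect[of u])

lemma refl_op_below: "p \<in> polys_below n \<Longrightarrow> refl_op c a p \<in> polys_below n"
  unfolding refl_op_def[abs_def] by (intro below_add below_scale below_sum below_reflect[of p])

lemma refl_op_linear:
  "refl_op c a (\<lambda>x. k * f x + g x) x = k * refl_op c a f x + refl_op c a g x"
  by (simp add: refl_op_def distrib_left sum.distrib sum_distrib_left mult_ac)

lemma nrm_refl_op_le:
  assumes u: "u \<in> Cball 0"
  shows "nrm (refl_op c a u) \<le> (\<bar>c\<bar> + (\<Sum>j\<in>UNIV. \<bar>a j\<bar>)) * nrm u"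
proof -
  have L: "u \<in> L2_space \<alpha> \<gamma>" "(\<lambda>x. u (reflect j x)) \<in> L2_space \<alpha> \<gamma>" for j
    using Cball_0_L2 u Cball_reflect[OF u] by auto
  have "nrm (refl_op c a u) \<le> nrm (\<lambda>x. c * u x) + nrm (\<lambda>x. \<Sum>j\<in>UNIV. a j * u (reflect j x))"
    unfolding refl_op_def[abs_def] by (intro L2.nrm_triangle L2.V_scale L2.V_sum L)
  also have "nrm (\<lambda>x. \<Sum>j\<in>UNIV. a j * u (reflect j x)) \<le> (\<Sum>j\<in>UNIV. nrm (\<lambda>x. a j * u (reflect j x)))"
    by (intro L2.nrm_sum L2.V_scale L)
  finally show ?thesis by (simp add: L2.nrm_scale L nrm_reflect[OF u] distrib_right sum_distrib_right)
qed

lemma ip_refl_op_le: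
  assumes u: "u \<in> Cball 0"
  shows "\<bar>ip u (refl_op c a u)\<bar> \<le> (\<bar>c\<bar> + (\<Sum>j\<in>UNIV. \<bar>a j\<bar>)) * ip u u"
proof -
  have "\<bar>ip u (refl_op c a u)\<bar> \<le> nrm u * nrm (refl_op c a u)"
    using u by (intro L2.Cauchy_Schwarz Cball_0_L2 refl_op_Cball)
  also have "\<dots> \<le> nrm u * ((\<bar>c\<bar> + (\<Sum>j\<in>UNIV. \<bar>a j\<bar>)) * nrm u)"
    by (intro mult_left_mono nrm_refl_op_le u) simp
  finally show ?thesis by (simp add: L2.nrm_sq[symmetric] power2_eq_square mult_ac)
qed

text \<open>The part of \<open>\<theta>\<close> that comes from the difference quotients.\<close>

definition kappa :: "(real ^ 'n \<Rightarrow> real) \<Rightarrow> real ^ 'n \<Rightarrow> real" where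
  "kappa = refl_op (\<Sum>j\<in>UNIV. \<gamma> $ j / 2) (\<lambda>j. - (\<gamma> $ j / 2))"

lemma theta_eq: "theta u x = (\<Sum>j\<in>UNIV. x $ j * partial_deriv j u x) + kappa u x"
  unfolding theta_def coord_mult_dunkl
  by (simp add: sum.distrib kappa_def refl_op_def right_diff_distrib sum_subtractf sum_distrib_right sum_negf)

text \<open>On polynomials of degree \<open>n\<close>, modulo lower degree, \<open>\<theta>\<close> is \<open>n + \<kappa>\<close>.\<close>

lemma theta_remainder:
  assumes "p \<in> polys_below (Suc n)"
  shows "(\<lambda>x. theta p x - (real n * p x + kappa p x)) \<in> polys_below n"
  using euler_below[OF assms] by (simp add: theta_eq algebra_simps)

text \<open>
  Modulo lower degree \<open>sturm\<close> acts on polynomials of degree \<open>n\<close> as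
  \<open>(n + \<kappa>) (n + 2 \<alpha> + d + \<kappa> + \<Sum>\<^sub>j \<gamma>\<^sub>j \<sigma>\<^sub>j)\<close>, where \<open>\<sigma>\<^sub>j\<close> are the reflections, that is as \<open>n\<^sup>2\<close> up to
  \<open>O(n)\<close>.
\<close>

lemma energy_eigenvalue:
  "\<exists>C\<ge>0. \<forall>n. \<forall>p\<in>polys_below (Suc n). (\<forall>q\<in>polys_below n. ip p q = 0) \<longrightarrow>
     \<bar>energy p p - (real n)\<^sup>2 * ip p p\<bar> \<le> C * (real n + 1) * ip p p"
proof -
  define d where "d = real CARD('n)"
  define c1 where "c1 = \<bar>\<Sum>j\<in>UNIV. \<gamma> $ j / 2\<bar> + (\<Sum>j\<in>UNIV. \<bar>- (\<gamma> $ j / 2)\<bar>)"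
  define c2 where "c2 = \<bar>2 * \<alpha> + d + (\<Sum>j\<in>UNIV. \<gamma> $ j / 2)\<bar> + (\<Sum>j\<in>UNIV. \<bar>\<gamma> $ j / 2\<bar>)"
  define K where "K = refl_op (2 * \<alpha> + d + (\<Sum>j\<in>UNIV. \<gamma> $ j / 2)) (\<lambda>j. \<gamma> $ j / 2)"
  have c: "c1 \<ge> 0" "c2 \<ge> 0" by (auto simp: c1_def c2_def intro!: add_nonneg_nonneg sum_nonneg)
  have "\<bar>energy p p - (real n)\<^sup>2 * ip p p\<bar> \<le> (c1 + c2 + c1 * c2) * (real n + 1) * ip p p"
    if p: "p \<in> polys_below (Suc n)" and orth: "\<And>q. q \<in> polys_below n \<Longrightarrow> ip p q = 0" for n p
  proof -
    \<comment> \<open>\<open>R1\<close>, \<open>R2\<close> and \<open>R\<close> are remainders of lower degree, invisible in the inner product with \<open>p\<close>.\<close>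
    define h where "h = theta p"
    have h: "h \<in> polys_below (Suc n)" unfolding h_def by (rule theta_below[OF p])
    define R1 where "R1 x = theta h x - (real n * h x + kappa h x)" for x
    define R2 where "R2 x = h x - (real n * p x + kappa p x)" for x
    have R1: "R1 \<in> polys_below n" unfolding R1_def[abs_def] by (rule theta_remainder[OF h])
    have R2: "R2 \<in> polys_below n" unfolding R2_def[abs_def] h_def by (rule theta_remainder[OF p])
    define R where "R x = R1 x - (\<Sum>j\<in>UNIV. dunkl \<gamma> j (dunkl \<gamma> j p) x)" for x
    have R: "R \<in> polys_below n" unfolding R_def[abs_def]
      by (intro below_minus R1 below_sum below_dunkl_same below_dunkl p)
    have kp: "kappa p \<in> polys_below (Suc n)" unfolding kappa_def by (rule refl_op_below[OF p])
    have L: "q \<in> L2_space \<alpha> \<gamma>" if "q \<in> polys_below k" for q k using that by (rule below_L2)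
    have pC: "p \<in> Cball m" for m by (rule below_Cball[OF p])
    have hC: "h \<in> Cball m" for m by (rule below_Cball[OF h])
    have sturm_p: "sturm p x = real n * h x + (K h x + R x)" if x: "x \<in> ball 0 1" for x
    proof -
      have "dunkl \<gamma> j (flux j p) x
          = dunkl \<gamma> j (dunkl \<gamma> j p) x - (x $ j * dunkl \<gamma> j h x + h x + \<gamma> $ j * h (reflect j x))" for j
      proof -
        have D: "dunkl \<gamma> j p \<in> Cball (Suc 0)" by (rule dunkl_Cball[OF pC])
        have "flux j p = dunkl \<gamma> j p - (\<lambda>x. x $ j * h x)" by (simp add: fun_eq_iff flux_def h_def)
        then have "dunkl \<gamma> j (flux j p) x = dunkl \<gamma> j (dunkl \<gamma> j p) x - dunkl \<gamma> j (\<lambda>x. x $ j * h x) x"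
          using dunkl_minus[OF D Cball_mult[OF Cball_coord hC] x] by simp
        then show ?thesis using dunkl_coord_mult[OF hC[of "Suc 0"] x, of \<gamma> j j] by simp
      qed
      then have "sturm p x = 2 * \<alpha> * h x - (\<Sum>j\<in>UNIV. dunkl \<gamma> j (dunkl \<gamma> j p) x)
          + (theta h x + d * h x + (\<Sum>j\<in>UNIV. \<gamma> $ j * h (reflect j x)))"
        unfolding sturm_def by (simp add: sum_subtractf sum.distrib theta_def[of h x] d_def flip: h_def)
      also have "theta h x = real n * h x + kappa h x + R1 x" by (simp add: R1_def)
      also have "(\<Sum>j\<in>UNIV. \<gamma> $ j * h (reflect j x))
          = (\<Sum>j\<in>UNIV. \<gamma> $ j / 2 * h (reflect j x)) + (\<Sum>j\<in>UNIV. \<gamma> $ j / 2 * h (reflect j x))"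
        by (simp add: sum.distrib[symmetric])
      finally show ?thesis
        unfolding K_def kappa_def refl_op_def R_def by (simp add: algebra_simps sum_negf)
    qed
    have Kb: "K q \<in> polys_below k" if "q \<in> polys_below k" for q k
      unfolding K_def using that by (rule refl_op_below)
    have "energy p p = ip p (sturm p)"
      by (rule energy_eq_sturm[OF pC pC])
    also have "\<dots> = ip p (\<lambda>x. real n * h x + (K h x + R x))"
      by (rule L2_ip_cong) (simp_all add: sturm_p)
    also have "\<dots> = real n * ip p h + (ip p (K h) + ip p R)"
      by (simp add: L2.ip_add_right L2.ip_scale_right L[OF p] L[OF h] L[OF Kb[OF h]] L[OF R] L2.V_add L2.V_scale)
    also have "ip p R = 0" by (rule orth[OF R])
    finally have E: "energy p p = real n * ip p h + ip p (K h)" by simp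
    have h_eq: "h = (\<lambda>x. real n * p x + (kappa p x + R2 x))" by (simp add: R2_def fun_eq_iff)
    have "ip p h = real n * ip p p + (ip p (kappa p) + ip p R2)"
      by (subst h_eq) (simp add: L2.ip_add_right L2.ip_scale_right L[OF p] L[OF kp] L[OF R2] L2.V_add L2.V_scale)
    then have ph: "ip p h = real n * ip p p + ip p (kappa p)" using orth[OF R2] by simp
    have "K h = (\<lambda>x. real n * K p x + (K (kappa p) x + K R2 x))"
      using refl_op_linear[of _ _ 1 "kappa p" R2] unfolding K_def by (subst h_eq) (simp add: refl_op_linear fun_eq_iff)
    then have "ip p (K h) = real n * ip p (K p) + (ip p (K (kappa p)) + ip p (K R2))"
      by (simp add: L2.ip_add_right L2.ip_scale_right L[OF p] L[OF Kb[OF p]] L[OF Kb[OF kp]] L[OF Kb[OF R2]]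
          L2.V_add L2.V_scale)
    then have pKh: "ip p (K h) = real n * ip p (K p) + ip p (K (kappa p))" using orth[OF Kb[OF R2]] by simp
    have b1: "\<bar>ip p (kappa p)\<bar> \<le> c1 * ip p p"
      unfolding kappa_def c1_def by (rule ip_refl_op_le[OF pC])
    have b2: "\<bar>ip p (K p)\<bar> \<le> c2 * ip p p"
      unfolding K_def c2_def by (rule ip_refl_op_le[OF pC])
    have b3: "\<bar>ip p (K (kappa p))\<bar> \<le> c1 * c2 * ip p p"
    proof -
      have "nrm (K (kappa p)) \<le> c2 * nrm (kappa p)"
        unfolding K_def c2_def by (rule nrm_refl_op_le[OF below_Cball[OF kp]])
      moreover have "nrm (kappa p) \<le> c1 * nrm p"
        unfolding kappa_def c1_def by (rule nrm_refl_op_le[OF pC])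
      ultimately have "nrm (K (kappa p)) \<le> c2 * (c1 * nrm p)"
        using mult_left_mono[OF _ c(2)] order_trans by blast
      from mult_left_mono[OF this L2.nrm_nonneg[of p]]
      have "nrm p * nrm (K (kappa p)) \<le> c1 * c2 * ip p p"
        by (simp add: L2.nrm_sq[symmetric] power2_eq_square mult_ac)
      then show ?thesis using L2.Cauchy_Schwarz[OF L[OF p] L[OF Kb[OF kp]]] by linarith
    qed
    have P: "ip p p \<ge> 0" by (rule L2.ip_nonneg)
    have tri: "\<bar>a + b + c\<bar> \<le> \<bar>a\<bar> + \<bar>b\<bar> + \<bar>c\<bar>" for a b c :: real by linarith
    have "\<bar>energy p p - (real n)\<^sup>2 * ip p p\<bar>
        = \<bar>real n * ip p (kappa p) + real n * ip p (K p) + ip p (K (kappa p))\<bar>"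
      unfolding E ph pKh by (simp add: power2_eq_square algebra_simps)
    also have "\<dots> \<le> real n * \<bar>ip p (kappa p)\<bar> + real n * \<bar>ip p (K p)\<bar> + \<bar>ip p (K (kappa p))\<bar>"
      using tri[of "real n * ip p (kappa p)" "real n * ip p (K p)" "ip p (K (kappa p))"] by (simp add: abs_mult)
    also have "\<dots> \<le> real n * (c1 * ip p p) + real n * (c2 * ip p p) + c1 * c2 * ip p p"
      by (intro add_mono mult_left_mono b1 b2 b3) auto
    also have "\<dots> \<le> (c1 + c2 + c1 * c2) * (real n + 1) * ip p p"
    proof -
      have "0 \<le> (c1 + c2 + c1 * c2 * real n) * ip p p"
        using c P by (intro mult_nonneg_nonneg add_nonneg_nonneg) auto
      then show ?thesis by (simp add: algebra_simps)
    qed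
    finally show ?thesis .
  qed
  then show ?thesis using c by (intro exI[of _ "c1 + c2 + c1 * c2"]) auto
qed

text \<open>
  The energy is diagonal with respect to degrees, because \<open>sturm\<close> maps polynomials of degree less than
  \<open>m\<close> to such polynomials.
\<close>

lemma energy_split:
  assumes p: "p \<in> polys_below n"
  shows "energy p p = energy (p - proj m p) (p - proj m p) + energy (proj m p) (proj m p)"
    and "ip p p = ip (p - proj m p) (p - proj m p) + ip (proj m p) (proj m p)"
proof -
  have pL: "p \<in> L2_space \<alpha> \<gamma>" by (rule below_L2[OF p])
  have q: "proj m p \<in> polys_below m" by (rule proj_props(1)[OF pL])
  have C: "p \<in> Cball k" "proj m p \<in> Cball k" for k using below_Cball p q by auto
  have "energy (p - proj m p) (proj m p) = ip (p - proj m p) (sturm (proj m p))"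
    using C by (intro energy_eq_sturm Cball_fun_minus) auto
  also have "\<dots> = 0" by (rule proj_props(2)[OF pL sturm_below[OF q]])
  finally have "energy p (proj m p) = energy (proj m p) (proj m p)"
    using energy_minus[OF C(1) C(2) C(2)] by simp
  then show "energy p p = energy (p - proj m p) (p - proj m p) + energy (proj m p) (proj m p)"
    using energy_sq_minus[OF C(1) C(2)] by simp
  show "ip p p = ip (p - proj m p) (p - proj m p) + ip (proj m p) (proj m p)"
    using proj_pythagoras[OF pL, of m] by (simp add: L2.nrm_sq)
qed

lemma energy_upper:
  "\<exists>C\<ge>0. \<forall>n. \<forall>p\<in>polys_below n. energy p p \<le> C * (real n)\<^sup>2 * ip p p"
proof -
  obtain C where C: "C \<ge> 0" and eig: "\<And>n p. p \<in> polys_below (Suc n) \<Longrightarrow> (\<And>q. q \<in> polys_below n \<Longrightarrow> ip p q = 0) \<Longrightarrow>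
     \<bar>energy p p - (real n)\<^sup>2 * ip p p\<bar> \<le> C * (real n + 1) * ip p p"
    using energy_eigenvalue by blast
  have "energy p p \<le> (1 + C) * (real n)\<^sup>2 * ip p p" if "p \<in> polys_below n" for n p
    using that
  proof (induction n arbitrary: p)
    case 0
    then have "p = (\<lambda>_. 0)" by (rule below_0)
    then have "energy p p = 0" by (simp add: energy_def dunkl_zero theta_zero L2.ip_zero L2.V_zero)
    then show ?case using L2.ip_nonneg[of p] by simp
  next
    case (Suc n)
    have pL: "p \<in> L2_space \<alpha> \<gamma>" by (rule below_L2[OF Suc.prems])
    define q where "q = proj n p"
    define t where "t = p - q"
    have q: "q \<in> polys_below n" unfolding q_def by (rule proj_props(1)[OF pL])
    have t: "t \<in> polys_below (Suc n)" unfolding t_def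
      using Suc.prems below_mono[OF _ q, of "Suc n"] by (intro below_fun_minus) auto
    have "ip t s = 0" if "s \<in> polys_below n" for s
      unfolding t_def q_def by (rule proj_props(2)[OF pL that])
    from eig[OF t this] have "energy t t \<le> (real n)\<^sup>2 * ip t t + C * (real n + 1) * ip t t" by linarith
    also have "\<dots> \<le> (1 + C) * (real (Suc n))\<^sup>2 * ip t t"
    proof -
      have "(real n)\<^sup>2 + C * (real n + 1) \<le> (1 + C) * (real (Suc n))\<^sup>2"
        using C mult_nonneg_nonneg[of C "real n"] mult_nonneg_nonneg[of C "(real n)\<^sup>2"]
        by (simp add: power2_eq_square algebra_simps)
      from mult_right_mono[OF this L2.ip_nonneg[of t]] show ?thesis by (simp add: algebra_simps)
    qed
    finally have 1: "energy t t \<le> (1 + C) * (real (Suc n))\<^sup>2 * ip t t" .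
    have "energy q q \<le> (1 + C) * (real n)\<^sup>2 * ip q q" by (rule Suc.IH[OF q])
    also have "\<dots> \<le> (1 + C) * (real (Suc n))\<^sup>2 * ip q q"
      using C by (intro mult_right_mono mult_left_mono power_mono L2.ip_nonneg) auto
    finally show ?case using 1 energy_split[OF Suc.prems, of n]
      by (simp add: q_def t_def distrib_left del: minus_apply)
  qed
  then show ?thesis using C by (intro exI[of _ "1 + C"]) auto
qed

lemma energy_lower_polynomial:
  "\<exists>N0>0. \<forall>N\<ge>N0. \<forall>m. \<forall>p\<in>polys_below m. (\<forall>q\<in>polys_below N. ip p q = 0) \<longrightarrow>
     (real N)\<^sup>2 / 2 * ip p p \<le> energy p p"
proof -
  obtain C where C: "C \<ge> 0" and eig: "\<And>n p. p \<in> polys_below (Suc n) \<Longrightarrow> (\<And>q. q \<in> polys_below n \<Longrightarrow> ip p q = 0) \<Longrightarrow>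
     \<bar>energy p p - (real n)\<^sup>2 * ip p p\<bar> \<le> C * (real n + 1) * ip p p"
    using energy_eigenvalue by blast
  \<comment> \<open>From here on the error \<open>C (n + 1)\<close> is at most half of \<open>n\<^sup>2\<close>.\<close>
  define N0 where "N0 = Suc (nat \<lceil>4 * C\<rceil>)"
  have N0: "4 * C \<le> real n" if "n \<ge> N0" for n
    using that unfolding N0_def by linarith
  have "(real N)\<^sup>2 / 2 * ip p p \<le> energy p p"
    if "N \<ge> N0" "p \<in> polys_below m" "\<And>q. q \<in> polys_below N \<Longrightarrow> ip p q = 0" for N m p
    using that(2,3)
  proof (induction m arbitrary: p)
    case 0
    then have "p \<in> polys_below N" using below_mono by blast
    then have "ip p p = 0" using 0 by blast
    then show ?case using energy_nonneg[OF below_Cball[OF 0(1)]] by simp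
  next
    case (Suc m)
    show ?case
    proof (cases "m < N")
      case True
      then have "p \<in> polys_below N" using below_mono[of "Suc m" N] Suc.prems by simp
      then have "ip p p = 0" using Suc.prems by blast
      then show ?thesis using energy_nonneg[OF below_Cball[OF Suc.prems(1)]] by simp
    next
      case False
      have pL: "p \<in> L2_space \<alpha> \<gamma>" by (rule below_L2[OF Suc.prems(1)])
      define q where "q = proj m p"
      define t where "t = p - q"
      have q: "q \<in> polys_below m" unfolding q_def by (rule proj_props(1)[OF pL])
      have t: "t \<in> polys_below (Suc m)" unfolding t_def
        using Suc.prems below_mono[OF _ q, of "Suc m"] by (intro below_fun_minus) auto
      have "ip t s = 0" if "s \<in> polys_below m" for s
        unfolding t_def q_def by (rule proj_props(2)[OF pL that])
      from eig[OF t this] have "(real m)\<^sup>2 * ip t t - C * (real m + 1) * ip t t \<le> energy t t" by linarith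
      moreover have "(real N)\<^sup>2 / 2 * ip t t \<le> (real m)\<^sup>2 * ip t t - C * (real m + 1) * ip t t"
      proof -
        have m: "real m \<ge> 1" "real m \<ge> real N" using False that(1) by (auto simp: N0_def)
        have "C * (real m + 1) \<le> (real m / 4) * (2 * real m)"
          using N0[of m] False that(1) m by (intro mult_mono) auto
        then have "(real N)\<^sup>2 / 2 \<le> (real m)\<^sup>2 - C * (real m + 1)"
          using power_mono[OF m(2), of 2] by (simp add: power2_eq_square)
        from mult_right_mono[OF this L2.ip_nonneg[of t]] show ?thesis by (simp add: algebra_simps)
      qed
      ultimately have 1: "(real N)\<^sup>2 / 2 * ip t t \<le> energy t t" by linarith
      have "ip q s = 0" if s: "s \<in> polys_below N" for s
      proof -
        have "s \<in> polys_below m" using below_mono[OF _ s, of m] False by simp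
        then show ?thesis unfolding q_def using proj_ip[OF pL] Suc.prems(2)[OF s] by simp
      qed
      from Suc.IH[OF q this] have "(real N)\<^sup>2 / 2 * ip q q \<le> energy q q" .
      then show ?thesis using 1 energy_split[OF Suc.prems(1), of m]
        by (simp add: q_def t_def distrib_left del: minus_apply)
    qed
  qed
  then show ?thesis by (intro exI[of _ N0]) (auto simp: N0_def)
qed

text \<open>
  The lower bound passes to every function orthogonal to the polynomials of degree less than \<open>N\<close>:
  the energy of a function dominates the energies of its projections (Bessel's inequality in the
  energy form), and these projections converge to it in the mean.
\<close>

lemma energy_lower:
  "\<exists>N0>0. \<forall>N\<ge>N0. \<forall>w\<in>Cball (Suc 0). (\<forall>q\<in>polys_below N. ip w q = 0) \<longrightarrow>
     (real N)\<^sup>2 / 2 * ip w w \<le> energy w w"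
proof -
  obtain N0 where N0: "N0 > 0" and low': "\<forall>N\<ge>N0. \<forall>m. \<forall>p\<in>polys_below m.
      (\<forall>q\<in>polys_below N. ip p q = 0) \<longrightarrow> (real N)\<^sup>2 / 2 * ip p p \<le> energy p p"
    using energy_lower_polynomial by (elim exE conjE) (rule that)
  have low: "(real N)\<^sup>2 / 2 * ip p p \<le> energy p p"
    if "N \<ge> N0" "p \<in> polys_below m" "\<And>q. q \<in> polys_below N \<Longrightarrow> ip p q = 0" for N m p
    using low' that by simp
  have "(real N)\<^sup>2 / 2 * ip w w \<le> energy w w"
    if N: "N \<ge> N0" and w: "w \<in> Cball (Suc 0)" and orth: "\<And>q. q \<in> polys_below N \<Longrightarrow> ip w q = 0" for N w
  proof (rule field_le_epsilon)
    fix e :: real assume e: "e > 0"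
    have wL: "w \<in> L2_space \<alpha> \<gamma>" by (rule Cball_0_L2[OF Cball_0[OF w]])
    define c where "c = (real N)\<^sup>2 / 2"
    have c: "c > 0" using N N0 by (simp add: c_def)
    obtain M where M: "\<And>n. n \<ge> M \<Longrightarrow> nrm (w - proj n w) < sqrt (e / c)"
      using proj_approx[OF Cball_0[OF w], of "sqrt (e / c)"] e c by auto
    define n where "n = max M N"
    define p where "p = proj n w"
    have p: "p \<in> polys_below n" unfolding p_def by (rule proj_props(1)[OF wL])
    have pC: "p \<in> Cball k" for k by (rule below_Cball[OF p])
    have "nrm (w - p) < sqrt (e / c)" unfolding p_def by (rule M) (simp add: n_def)
    then have "(nrm (w - p))\<^sup>2 < (sqrt (e / c))\<^sup>2" by (intro power_strict_mono) auto
    then have close: "ip w w - e / c \<le> ip p p"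
      using proj_pythagoras[OF wL, of n] e c by (simp add: L2.nrm_sq p_def del: minus_apply)
    have "ip p q = 0" if q: "q \<in> polys_below N" for q
    proof -
      have "q \<in> polys_below n" using below_mono[OF _ q, of n] by (simp add: n_def)
      then show ?thesis unfolding p_def using proj_ip[OF wL] orth[OF q] by simp
    qed
    from low[OF N p this] have 1: "c * ip p p \<le> energy p p" by (simp add: c_def)
    have "energy w p = ip w (sturm p)" using w by (intro energy_eq_sturm pC) simp
    also have "\<dots> = ip p (sturm p)" using proj_ip[OF wL sturm_below[OF p]] by (simp add: p_def)
    also have "\<dots> = energy p p" by (rule energy_eq_sturm[symmetric, OF pC pC])
    finally have "energy w p = energy p p" .
    then have "energy p p \<le> energy w w"
      using energy_sq_minus[OF w pC] energy_nonneg[OF Cball_fun_minus[OF w pC]] by simp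
    moreover have "c * (ip w w - e / c) \<le> c * ip p p" using close c by (intro mult_left_mono) auto
    ultimately show "(real N)\<^sup>2 / 2 * ip w w \<le> energy w w + e"
      using 1 c by (simp add: c_def[symmetric] right_diff_distrib)
  qed
  then show ?thesis using N0 by blast
qed

end

section \<open>The projection error in the mean\<close>

context ball_wt
begin

lemma snrm_theta_bounded: "\<exists>C\<ge>0. \<forall>u\<in>Cball (Suc m). snrm m (theta u) \<le> C * snrm (Suc m) u"
proof -
  have "\<forall>i. \<exists>C\<ge>0. \<forall>u\<in>Cball m. snrm m (\<lambda>x. x $ i * u x) \<le> C * snrm m u"
    using snrm_coord_mult_bounded by blast
  then obtain C where C: "\<And>i. C i \<ge> 0" "\<And>i u. u \<in> Cball m \<Longrightarrow> snrm m (\<lambda>x. x $ i * u x) \<le> C i * snrm m u"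
    by metis
  have "snrm m (theta u) \<le> (\<Sum>i\<in>UNIV. C i) * snrm (Suc m) u" if u: "u \<in> Cball (Suc m)" for u
  proof -
    have D: "dunkl \<gamma> i u \<in> Cball m" for i by (rule dunkl_Cball[OF u])
    have "snrm m (theta u) \<le> (\<Sum>i\<in>UNIV. snrm m (\<lambda>x. x $ i * dunkl \<gamma> i u x))"
      unfolding theta_def[abs_def] by (intro S.nrm_sum Cball_mult Cball_coord D)
    also have "\<dots> \<le> (\<Sum>i\<in>UNIV. C i * snrm (Suc m) u)"
      by (intro sum_mono order_trans[OF C(2)[OF D] mult_left_mono[OF snrm_dunkl_le C(1)]])
    finally show ?thesis by (simp add: sum_distrib_right)
  qed
  then show ?thesis using C(1) by (intro exI[of _ "\<Sum>i\<in>UNIV. C i"]) (simp add: sum_nonneg)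
qed

lemma snrm_flux_bounded: "\<exists>C\<ge>0. \<forall>u\<in>Cball (Suc m). snrm m (flux j u) \<le> C * snrm (Suc m) u"
proof -
  obtain A where A: "A \<ge> 0" "\<forall>u\<in>Cball m. snrm m (\<lambda>x. x $ j * u x) \<le> A * snrm m u"
    using snrm_coord_mult_bounded by blast
  obtain B where B: "B \<ge> 0" "\<forall>u\<in>Cball (Suc m). snrm m (theta u) \<le> B * snrm (Suc m) u"
    using snrm_theta_bounded by blast
  have "snrm m (flux j u) \<le> (1 + A * B) * snrm (Suc m) u" if u: "u \<in> Cball (Suc m)" for u
  proof -
    have th: "theta u \<in> Cball m" by (rule theta_Cball[OF u])
    have eq: "flux j u = dunkl \<gamma> j u - (\<lambda>x. x $ j * theta u x)" by (simp add: fun_eq_iff flux_def)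
    have "snrm m (flux j u) \<le> snrm m (dunkl \<gamma> j u) + snrm m (\<lambda>x. x $ j * theta u x)"
      unfolding eq by (rule S.nrm_minus_le[OF dunkl_Cball[OF u] Cball_mult[OF Cball_coord th]])
    also have "snrm m (dunkl \<gamma> j u) \<le> snrm (Suc m) u" by (rule snrm_dunkl_le)
    also have "snrm m (\<lambda>x. x $ j * theta u x) \<le> A * snrm m (theta u)" using A(2) th by blast
    also have "A * snrm m (theta u) \<le> A * (B * snrm (Suc m) u)"
      using B(2) u A(1) by (intro mult_left_mono) auto
    finally show ?thesis by (simp add: algebra_simps)
  qed
  then show ?thesis using A(1) B(1) by (intro exI[of _ "1 + A * B"]) simp
qed

lemma snrm_sturm_bounded: "\<exists>C\<ge>0. \<forall>u\<in>Cball (Suc (Suc m)). snrm m (sturm u) \<le> C * snrm (Suc (Suc m)) u"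
proof -
  obtain B where B: "B \<ge> 0" "\<forall>u\<in>Cball (Suc m). snrm m (theta u) \<le> B * snrm (Suc m) u"
    using snrm_theta_bounded by blast
  have "\<forall>j. \<exists>C\<ge>0. \<forall>u\<in>Cball (Suc (Suc m)). snrm (Suc m) (flux j u) \<le> C * snrm (Suc (Suc m)) u"
    using snrm_flux_bounded by blast
  then obtain C where C: "\<And>j. C j \<ge> 0"
    "\<And>j u. u \<in> Cball (Suc (Suc m)) \<Longrightarrow> snrm (Suc m) (flux j u) \<le> C j * snrm (Suc (Suc m)) u" by metis
  have "snrm m (sturm u) \<le> (\<bar>2 * \<alpha>\<bar> * B + (\<Sum>j\<in>UNIV. C j)) * snrm (Suc (Suc m)) u"
    if u: "u \<in> Cball (Suc (Suc m))" for u
  proof -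
    have u1: "u \<in> Cball (Suc m)" by (rule Cball_Suc_subset[OF u])
    have th: "theta u \<in> Cball m" by (rule theta_Cball[OF u1])
    have F: "dunkl \<gamma> j (flux j u) \<in> Cball m" for j by (rule dunkl_Cball[OF flux_Cball[OF u]])
    have eq: "sturm u = (\<lambda>x. (2 * \<alpha>) * theta u x) - (\<lambda>x. \<Sum>j\<in>UNIV. dunkl \<gamma> j (flux j u) x)"
      by (simp add: fun_eq_iff sturm_def)
    have "snrm m (sturm u) \<le> snrm m (\<lambda>x. (2 * \<alpha>) * theta u x) + snrm m (\<lambda>x. \<Sum>j\<in>UNIV. dunkl \<gamma> j (flux j u) x)"
      unfolding eq by (rule S.nrm_minus_le[OF Cball_scale[OF th] Cball_sum[OF F]])
    also have "snrm m (\<lambda>x. (2 * \<alpha>) * theta u x) = \<bar>2 * \<alpha>\<bar> * snrm m (theta u)" by (rule S.nrm_scale[OF th])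
    also have "snrm m (\<lambda>x. \<Sum>j\<in>UNIV. dunkl \<gamma> j (flux j u) x) \<le> (\<Sum>j\<in>UNIV. snrm m (dunkl \<gamma> j (flux j u)))"
      by (rule S.nrm_sum[OF F])
    also have "\<dots> \<le> (\<Sum>j\<in>UNIV. C j * snrm (Suc (Suc m)) u)"
      by (intro sum_mono order_trans[OF snrm_dunkl_le C(2)[OF u]])
    also have "\<bar>2 * \<alpha>\<bar> * snrm m (theta u) \<le> \<bar>2 * \<alpha>\<bar> * (B * snrm (Suc (Suc m)) u)"
    proof (rule mult_left_mono)
      have "snrm m (theta u) \<le> B * snrm (Suc m) u" using B(2) u1 by blast
      also have "\<dots> \<le> B * snrm (Suc (Suc m)) u" by (intro mult_left_mono snrm_le_Suc B(1))
      finally show "snrm m (theta u) \<le> B * snrm (Suc (Suc m)) u" .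
    qed simp
    finally show ?thesis by (simp add: algebra_simps sum_distrib_right)
  qed
  then show ?thesis using B(1) C(1)
    by (intro exI[of _ "\<bar>2 * \<alpha>\<bar> * B + (\<Sum>j\<in>UNIV. C j)"]) (simp add: sum_nonneg)
qed

lemma sturm_minus:
  assumes u: "u \<in> Cball (Suc (Suc m))" and v: "v \<in> Cball (Suc (Suc m))" and x: "x \<in> ball 0 1"
  shows "sturm (u - v) x = sturm u x - sturm v x"
proof -
  have th: "theta (u - v) y = theta u y - theta v y" if "y \<in> ball 0 1" for y
    by (rule theta_minus[OF u v that])
  have fl: "flux j (u - v) y = (flux j u - flux j v) y" if "y \<in> ball 0 1" for j y
    unfolding flux_def minus_apply dunkl_minus[OF u v that] th[OF that] by (simp add: algebra_simps)
  have "dunkl \<gamma> j (flux j (u - v)) x = dunkl \<gamma> j (flux j u) x - dunkl \<gamma> j (flux j v) x" for j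
  proof -
    have "dunkl \<gamma> j (flux j (u - v)) x = dunkl \<gamma> j (flux j u - flux j v) x"
      by (rule dunkl_cong[OF x fl])
    also have "\<dots> = dunkl \<gamma> j (flux j u) x - dunkl \<gamma> j (flux j v) x"
      by (rule dunkl_minus[OF flux_Cball[OF u] flux_Cball[OF v] x])
    finally show ?thesis .
  qed
  then show ?thesis unfolding sturm_def th[OF x] by (simp add: sum_subtractf right_diff_distrib)
qed

lemma sturm_proj:
  assumes u: "u \<in> Cball (Suc (Suc 0))"
  shows "proj N (sturm u) = sturm (proj N u)"
proof -
  have uL: "u \<in> L2_space \<alpha> \<gamma>" by (rule Cball_0_L2[OF Cball_0[OF u]])
  have p: "proj N u \<in> polys_below N" by (rule proj_props(1)[OF uL])
  have pC: "proj N u \<in> Cball k" for k by (rule below_Cball[OF p])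
  show ?thesis
  proof (rule proj_unique)
    show "sturm u \<in> L2_space \<alpha> \<gamma>" by (rule Cball_0_L2[OF sturm_Cball[OF u]])
    show "sturm (proj N u) \<in> polys_below N" by (rule sturm_below[OF p])
    fix q :: "real ^ 'n \<Rightarrow> real" assume q: "q \<in> polys_below N"
    have qC: "q \<in> Cball k" for k by (rule below_Cball[OF q])
    have w: "u - proj N u \<in> Cball (Suc (Suc 0))" by (rule Cball_fun_minus[OF u pC])
    have "ip (sturm u - sturm (proj N u)) q = ip (sturm (u - proj N u)) q"
      by (rule L2_ip_cong) (simp_all only: sturm_minus[OF u pC] minus_apply)
    also have "\<dots> = ip q (sturm (u - proj N u))" by (rule L2.ip_sym)
    also have "\<dots> = energy q (u - proj N u)"
      using w by (intro energy_eq_sturm[symmetric] qC) simp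
    also have "\<dots> = energy (u - proj N u) q" by (rule energy_sym)
    also have "\<dots> = ip (u - proj N u) (sturm q)"
      using Cball_Suc_subset[OF w] by (intro energy_eq_sturm qC) simp
    also have "\<dots> = 0" by (rule proj_props(2)[OF uL sturm_below[OF q]])
    finally show "ip (sturm u - sturm (proj N u)) q = 0" .
  qed
qed

text \<open>
  Two orders of smoothness are exchanged for a factor \<open>N\<^sup>-\<^sup>2\<close> by the operator \<open>sturm\<close>, which commutes
  with the projections; a remaining single order is exchanged through the energy itself.
\<close>

theorem projection_error_L2:
  "\<exists>C\<ge>0. \<forall>u\<in>Cball l. \<forall>N. (real N + 1) ^ l * nrm (u - proj N u) \<le> C * snrm l u"
proof -
  obtain N0 where N0: "N0 > 0" and low': "\<forall>N\<ge>N0. \<forall>w\<in>Cball (Suc 0). (\<forall>q\<in>polys_below N. ip w q = 0) \<longrightarrow>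
     (real N)\<^sup>2 / 2 * ip w w \<le> energy w w"
    using energy_lower by (elim exE conjE) (rule that)
  have low: "(real N + 1)\<^sup>2 / 8 * (nrm (u - proj N u))\<^sup>2 \<le> energy (u - proj N u) (u - proj N u)"
    if N: "N \<ge> N0" and u: "u \<in> Cball (Suc 0)" for N u
  proof -
    have uL: "u \<in> L2_space \<alpha> \<gamma>" by (rule Cball_0_L2[OF Cball_0[OF u]])
    have "u - proj N u \<in> Cball (Suc 0)" by (rule Cball_fun_minus[OF u below_Cball[OF proj_props(1)[OF uL]]])
    then have "(real N)\<^sup>2 / 2 * ip (u - proj N u) (u - proj N u) \<le> energy (u - proj N u) (u - proj N u)"
      using low' N proj_props(2)[OF uL] by blast
    moreover have "(real N + 1)\<^sup>2 / 8 \<le> (real N)\<^sup>2 / 2"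
    proof -
      have "real N + 1 \<le> 2 * real N" using N N0 by simp
      then have "(real N + 1)\<^sup>2 \<le> (2 * real N)\<^sup>2" by (intro power_mono) auto
      then show ?thesis by (simp add: power_mult_distrib)
    qed
    ultimately show ?thesis
      using mult_right_mono[OF _ L2.ip_nonneg[of "u - proj N u"]] unfolding L2.nrm_sq by fastforce
  qed
  \<comment> \<open>The finitely many small degrees only affect the constant.\<close>
  have small: "(real N + 1) ^ l * nrm (u - proj N u) \<le> (real N0 + 1) ^ l * snrm l u"
    if "u \<in> Cball l" "N < N0" for u N l
  proof -
    have "nrm (u - proj N u) \<le> nrm u" by (rule nrm_minus_proj_le[OF Cball_0_L2[OF Cball_0[OF that(1)]]])
    also have "\<dots> \<le> snrm l u" by (rule nrm_le_snrm)
    finally show ?thesis using that(2) by (intro mult_mono power_mono) auto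
  qed
  have combine: "\<exists>C\<ge>0. \<forall>u\<in>Cball l. \<forall>N. (real N + 1) ^ l * nrm (u - proj N u) \<le> C * snrm l u"
    if A: "A \<ge> 0" and large: "\<And>u N. u \<in> Cball l \<Longrightarrow> N \<ge> N0 \<Longrightarrow> (real N + 1) ^ l * nrm (u - proj N u) \<le> A * snrm l u"
    for A l
  proof (intro exI[of _ "A + (real N0 + 1) ^ l"] conjI ballI allI)
    show "A + (real N0 + 1) ^ l \<ge> 0" using A by (intro add_nonneg_nonneg) auto
    fix u :: "real ^ 'n \<Rightarrow> real" and N assume u: "u \<in> Cball l"
    have "A * snrm l u \<ge> 0" "(real N0 + 1) ^ l * snrm l u \<ge> 0" using A by (auto intro!: mult_nonneg_nonneg)
    moreover have "N < N0 \<or> N \<ge> N0" by linarith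
    ultimately show "(real N + 1) ^ l * nrm (u - proj N u) \<le> (A + (real N0 + 1) ^ l) * snrm l u"
      unfolding distrib_right using small[OF u, of N] large[OF u, of N] by linarith
  qed
  show ?thesis
  proof (induction l rule: induct_nat_012)
    case 0
    have "nrm (u - proj N u) \<le> snrm 0 u" if "u \<in> Cball 0" for u N
      unfolding snrm_0 by (rule nrm_minus_proj_le[OF Cball_0_L2[OF that]])
    then show ?case by (intro exI[of _ 1]) (auto simp del: minus_apply)
  next
    case 1
    show ?case
    proof (rule combine[of 3])
      fix u :: "real ^ 'n \<Rightarrow> real" and N assume u: "u \<in> Cball (Suc 0)" and N: "N \<ge> N0"
      have uL: "u \<in> L2_space \<alpha> \<gamma>" by (rule Cball_0_L2[OF Cball_0[OF u]])
      have p: "proj N u \<in> polys_below N" by (rule proj_props(1)[OF uL])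
      have pC: "proj N u \<in> Cball k" for k by (rule below_Cball[OF p])
      have w: "u - proj N u \<in> Cball (Suc 0)" by (rule Cball_fun_minus[OF u pC])
      have "energy (u - proj N u) (proj N u) = ip (u - proj N u) (sturm (proj N u))"
        using w by (intro energy_eq_sturm pC) simp
      also have "\<dots> = 0" by (rule proj_props(2)[OF uL sturm_below[OF p]])
      finally have "energy u (proj N u) = energy (proj N u) (proj N u)"
        using energy_minus[OF u pC pC] by simp
      then have "energy (u - proj N u) (u - proj N u) \<le> energy u u"
        using energy_sq_minus[OF u pC] energy_nonneg[OF pC] by simp
      also have "\<dots> \<le> (\<Sum>j\<in>UNIV. (nrm (dunkl \<gamma> j u))\<^sup>2)" by (rule energy_le)
      also have "\<dots> \<le> (snrm (Suc 0) u)\<^sup>2" unfolding snrm_Suc snrm_0 by simp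
      finally have "(real N + 1)\<^sup>2 / 8 * (nrm (u - proj N u))\<^sup>2 \<le> (snrm (Suc 0) u)\<^sup>2"
        using low[OF N u] by linarith
      moreover have "(3 * snrm (Suc 0) u)\<^sup>2 = 9 * (snrm (Suc 0) u)\<^sup>2" by (simp add: power_mult_distrib)
      ultimately have "((real N + 1) * nrm (u - proj N u))\<^sup>2 \<le> (3 * snrm (Suc 0) u)\<^sup>2"
        using zero_le_power2[of "snrm (Suc 0) u"] unfolding power_mult_distrib[of "real N + 1"] by linarith
      then have "(real N + 1) * nrm (u - proj N u) \<le> 3 * snrm (Suc 0) u"
        by (rule power2_le_imp_le) simp
      then show "(real N + 1) ^ Suc 0 * nrm (u - proj N u) \<le> 3 * snrm (Suc 0) u"
        by (simp del: minus_apply)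
    qed simp
  next
    case (ge2 l)
    then obtain A where A: "A \<ge> 0"
      "\<forall>u\<in>Cball l. \<forall>N. (real N + 1) ^ l * nrm (u - proj N u) \<le> A * snrm l u" by blast
    obtain B where B: "B \<ge> 0" "\<forall>u\<in>Cball (Suc (Suc l)). snrm l (sturm u) \<le> B * snrm (Suc (Suc l)) u"
      using snrm_sturm_bounded by blast
    show ?case
    proof (rule combine[of "8 * (A * B)"])
      fix u :: "real ^ 'n \<Rightarrow> real" and N assume u: "u \<in> Cball (Suc (Suc l))" and N: "N \<ge> N0"
      have u2: "u \<in> Cball (Suc (Suc 0))" by (rule Cball_mono[OF _ u]) simp
      have u1: "u \<in> Cball (Suc 0)" by (rule Cball_Suc_subset[OF u2])
      have uL: "u \<in> L2_space \<alpha> \<gamma>" by (rule Cball_0_L2[OF Cball_0[OF u]])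
      have pC: "proj N u \<in> Cball k" for k by (rule below_Cball[OF proj_props(1)[OF uL]])
      define w where "w = u - proj N u"
      define s where "s = sturm u - proj N (sturm u)"
      have w: "w \<in> Cball (Suc (Suc 0))" unfolding w_def by (rule Cball_fun_minus[OF u2 pC])
      have wL: "w \<in> L2_space \<alpha> \<gamma>" by (rule Cball_0_L2[OF Cball_0[OF w]])
      have suL: "sturm u \<in> L2_space \<alpha> \<gamma>" by (rule Cball_0_L2[OF sturm_Cball[OF u2]])
      have sL: "s \<in> L2_space \<alpha> \<gamma>" unfolding s_def by (rule L2.V_minus[OF suL proj_L2[OF suL]])
      have "energy w w = ip w (sturm w)"
        using w Cball_Suc_subset[OF w] by (intro energy_eq_sturm) auto
      also have "\<dots> = ip w s"
        unfolding w_def s_def sturm_proj[OF u2]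
        by (rule L2_ip_cong) (simp_all only: sturm_minus[OF u2 pC] minus_apply)
      also have "\<dots> \<le> nrm w * nrm s" by (rule L2.Cauchy_Schwarz_upper[OF wL sL])
      finally have e: "(real N + 1)\<^sup>2 / 8 * (nrm w)\<^sup>2 \<le> nrm w * nrm s"
        using low[OF N u1] unfolding w_def by linarith
      have e': "(real N + 1)\<^sup>2 * nrm w \<le> 8 * nrm s"
      proof (cases "nrm w = 0")
        case False
        then have "nrm w > 0" using L2.nrm_nonneg[of w] by linarith
        moreover have "nrm w * ((real N + 1)\<^sup>2 * nrm w) \<le> nrm w * (8 * nrm s)"
          using e by (simp add: power2_eq_square algebra_simps)
        ultimately show ?thesis by (rule mult_left_le_imp_le[rotated])
      qed simp
      have "(real N + 1) ^ Suc (Suc l) * nrm w = (real N + 1) ^ l * ((real N + 1)\<^sup>2 * nrm w)"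
        by (simp add: power2_eq_square mult_ac)
      also have "\<dots> \<le> (real N + 1) ^ l * (8 * nrm s)" by (intro mult_left_mono e') simp
      also have "\<dots> = 8 * ((real N + 1) ^ l * nrm s)" by simp
      also have "(real N + 1) ^ l * nrm s \<le> A * snrm l (sturm u)"
        unfolding s_def using A(2) sturm_Cball[OF u] by blast
      also have "A * snrm l (sturm u) \<le> A * (B * snrm (Suc (Suc l)) u)"
        using B(2) u A(1) by (intro mult_left_mono) auto
      finally show "(real N + 1) ^ Suc (Suc l) * nrm (u - proj N u) \<le> 8 * (A * B) * snrm (Suc (Suc l)) u"
        unfolding w_def by (simp add: mult.assoc del: minus_apply)
    qed (use A(1) B(1) in simp)
  qed
qed

section \<open>Comparison of consecutive weights\<close>

lemma ip_next_le:
  assumes "u \<in> Cball 0" shows "L2_ip (\<alpha> + 1) \<gamma> u u \<le> ip u u"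
  unfolding L2_ip_next[OF assms assms] unfolding L2_ip_def
proof (rule integral_mono)
  show "integrable \<mu> (\<lambda>x. (1 - (norm x)\<^sup>2) * (u x * u x))" "integrable \<mu> (\<lambda>x. u x * u x)"
    by (intro Cball_0_integrable Cball_mult Cball_minus Cball_const Cball_norm_sq assms)+
  fix x :: "real ^ 'n"
  have "(1 - (norm x)\<^sup>2) * (u x * u x) \<le> 1 * (u x * u x)" by (intro mult_right_mono) auto
  then show "(1 - (norm x)\<^sup>2) * (u x * u x) \<le> u x * u x" by simp
qed

lemma ip_next_eq:
  assumes "u \<in> Cball 0" "v \<in> Cball 0"
  shows "L2_ip (\<alpha> + 1) \<gamma> u v = ip u (\<lambda>x. (1 - (norm x)\<^sup>2) * v x)"
  unfolding L2_ip_next[OF assms] unfolding L2_ip_def by (simp add: mult.left_commute)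

lemma ip_next_eq_minus:
  assumes "u \<in> Cball 0" "v \<in> Cball 0"
  shows "L2_ip (\<alpha> + 1) \<gamma> u v = ip u v - ip u (\<lambda>x. (norm x)\<^sup>2 * v x)"
proof -
  have "(\<lambda>x. (1 - (norm x)\<^sup>2) * v x) = v - (\<lambda>x. (norm x)\<^sup>2 * v x)"
    by (simp add: fun_eq_iff left_diff_distrib)
  then show ?thesis unfolding ip_next_eq[OF assms]
    by (simp add: L2.ip_minus_right Cball_0_L2 assms Cball_mult Cball_norm_sq del: minus_apply)
qed

lemma below_norm_sq_mult: "p \<in> polys_below n \<Longrightarrow> (\<lambda>x. (norm x)\<^sup>2 * p x) \<in> polys_below (Suc (Suc n))"
proof -
  assume p: "p \<in> polys_below n"
  have "(\<lambda>x. \<Sum>i\<in>UNIV. x $ i * (x $ i * p x)) \<in> polys_below (Suc (Suc n))"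
    by (intro below_sum below_coord_mult p)
  moreover have "(\<Sum>i\<in>UNIV. x $ i * (x $ i * p x)) = (norm x)\<^sup>2 * p x" for x
    unfolding norm_sq_eq_sum sum_distrib_right by (simp add: power2_eq_square mult.assoc)
  ultimately show ?thesis by simp
qed

lemma below_rho_mult: "p \<in> polys_below n \<Longrightarrow> (\<lambda>x. (1 - (norm x)\<^sup>2) * p x) \<in> polys_below (Suc (Suc n))"
  using below_minus[OF below_mono[of n "Suc (Suc n)" p] below_norm_sq_mult[of p n]]
  by (simp add: left_diff_distrib)

text \<open>
  Summing the adjoint formula for the pairs \<open>b\<close>, \<open>x\<^sub>j b\<close> expresses \<open>2 (\<alpha> + 1) \<parallel>b\<parallel>\<^sup>2\<close> in the weight with
  exponent \<open>\<alpha>\<close> through quantities in the weight with exponent \<open>\<alpha> + 1\<close>.  The only one with a derivative is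
  the inner product of \<open>b\<close> and \<open>\<theta>b\<close>, which Euler's relation evaluates, up to a bounded multiple of the
  squared norm, as \<open>n\<close> times this squared norm if \<open>b\<close> is an orthogonal polynomial of degree \<open>n\<close>.
\<close>

lemma orthogonal_polynomial_trace:
  "\<exists>C\<ge>0. \<forall>n. \<forall>b\<in>polys_below (Suc n). (\<forall>q\<in>polys_below n. L2_ip (\<alpha> + 1) \<gamma> b q = 0) \<longrightarrow>
     ip b b \<le> C * (real n + 1) * L2_ip (\<alpha> + 1) \<gamma> b b"
proof -
  interpret up: ball_wt "\<alpha> + 1" \<gamma> by (rule next_weight)
  have a: "\<alpha> + 1 > 0" using \<alpha> by simp
  define c1 where "c1 = \<bar>\<Sum>j\<in>UNIV. \<gamma> $ j / 2\<bar> + (\<Sum>j\<in>UNIV. \<bar>- (\<gamma> $ j / 2)\<bar>)"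
  define c2 where "c2 = \<bar>real CARD('n)\<bar> + (\<Sum>j\<in>UNIV. \<bar>\<gamma> $ j\<bar>)"
  define C where "C = (2 * (\<alpha> + 1) + 2 + 2 * c1 + c2) / (2 * (\<alpha> + 1))"
  have c: "c1 \<ge> 0" "c2 \<ge> 0" by (auto simp: c1_def c2_def intro!: add_nonneg_nonneg sum_nonneg)
  have "ip b b \<le> C * (real n + 1) * up.ip b b"
    if b: "b \<in> polys_below (Suc n)" and orth: "\<And>q. q \<in> polys_below n \<Longrightarrow> up.ip b q = 0" for n b
  proof -
    have bC: "b \<in> Cball m" for m by (rule below_Cball[OF b])
    define G where "G = up.refl_op (real CARD('n)) (\<lambda>j. \<gamma> $ j) b"
    have GC: "G \<in> Cball m" for m unfolding G_def by (rule up.refl_op_Cball[OF bC])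
    have thC: "theta b \<in> Cball m" for m by (rule theta_Cball[OF bC])
    have DC: "dunkl \<gamma> j b \<in> Cball m" for j m by (rule dunkl_Cball[OF bC])
    have xbC: "(\<lambda>x. x $ j * b x) \<in> Cball m" for j m by (intro Cball_mult Cball_coord bC)
    have DxC: "dunkl \<gamma> j (\<lambda>x. x $ j * b x) \<in> Cball m" for j m by (rule dunkl_Cball[OF xbC])
    have adj: "up.ip (dunkl \<gamma> j b) (\<lambda>x. x $ j * b x)
        = 2 * (\<alpha> + 1) * ip b (\<lambda>x. (x $ j)\<^sup>2 * b x) - up.ip b (dunkl \<gamma> j (\<lambda>x. x $ j * b x))" for j
    proof -
      have eq: "(\<lambda>x. 2 * (\<alpha> + 1) * x $ j * (x $ j * b x) - (1 - (norm x)\<^sup>2) * dunkl \<gamma> j (\<lambda>x. x $ j * b x) x)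
          = (\<lambda>x. 2 * (\<alpha> + 1) * ((x $ j)\<^sup>2 * b x)) - (\<lambda>x. (1 - (norm x)\<^sup>2) * dunkl \<gamma> j (\<lambda>x. x $ j * b x) x)"
        by (simp add: fun_eq_iff power2_eq_square)
      have L: "(\<lambda>x. (x $ j)\<^sup>2 * b x) \<in> L2_space \<alpha> \<gamma>"
        "(\<lambda>x. (1 - (norm x)\<^sup>2) * dunkl \<gamma> j (\<lambda>x. x $ j * b x) x) \<in> L2_space \<alpha> \<gamma>" "b \<in> L2_space \<alpha> \<gamma>"
        by (intro Cball_0_L2 Cball_mult Cball_power Cball_coord Cball_minus Cball_const Cball_norm_sq DxC bC)+
      show ?thesis
        unfolding dunkl_adjoint[OF bC xbC] eq ip_next_eq[OF bC DxC]
        by (simp add: L2.ip_minus_right L2.ip_scale_right L2.V_scale L del: minus_apply)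
    qed
    have s1: "(\<Sum>j\<in>UNIV. up.ip (dunkl \<gamma> j b) (\<lambda>x. x $ j * b x)) = up.ip b (theta b)"
    proof -
      have "up.ip (dunkl \<gamma> j b) (\<lambda>x. x $ j * b x) = up.ip b (\<lambda>x. x $ j * dunkl \<gamma> j b x)" for j
        by (rule up.L2_ip_eqI) (simp add: mult_ac)
      moreover have "(\<Sum>j\<in>UNIV. up.ip b (\<lambda>x. x $ j * dunkl \<gamma> j b x)) = up.ip b (theta b)"
        unfolding theta_def[abs_def]
        by (rule up.L2.ip_sum_right[symmetric]) (intro up.Cball_0_L2 Cball_mult Cball_coord DC bC)+
      ultimately show ?thesis by simp
    qed
    have s2: "(\<Sum>j\<in>UNIV. ip b (\<lambda>x. (x $ j)\<^sup>2 * b x)) = ip b b - up.ip b b"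
    proof -
      have "(\<Sum>j\<in>UNIV. ip b (\<lambda>x. (x $ j)\<^sup>2 * b x)) = ip b (\<lambda>x. \<Sum>j\<in>UNIV. (x $ j)\<^sup>2 * b x)"
        by (rule L2.ip_sum_right[symmetric]) (intro Cball_0_L2 Cball_mult Cball_power Cball_coord bC)+
      also have "(\<lambda>x. \<Sum>j\<in>UNIV. (x $ j)\<^sup>2 * b x) = (\<lambda>x. (norm x)\<^sup>2 * b x)"
        by (simp add: norm_sq_eq_sum sum_distrib_right)
      finally show ?thesis using ip_next_eq_minus[OF bC bC] by simp
    qed
    have s3: "(\<Sum>j\<in>UNIV. up.ip b (dunkl \<gamma> j (\<lambda>x. x $ j * b x))) = up.ip b (theta b) + up.ip b G"
    proof -
      have "(\<Sum>j\<in>UNIV. up.ip b (dunkl \<gamma> j (\<lambda>x. x $ j * b x)))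
          = up.ip b (\<lambda>x. \<Sum>j\<in>UNIV. dunkl \<gamma> j (\<lambda>x. x $ j * b x) x)"
        by (rule up.L2.ip_sum_right[symmetric]) (intro up.Cball_0_L2 DxC bC)+
      also have "\<dots> = up.ip b (\<lambda>x. theta b x + G x)"
      proof (rule L2_ip_cong)
        fix x :: "real ^ 'n" assume x: "x \<in> ball 0 1"
        have "dunkl \<gamma> j (\<lambda>x. x $ j * b x) x = x $ j * dunkl \<gamma> j b x + (b x + \<gamma> $ j * b (reflect j x))" for j
          using dunkl_coord_mult[OF bC[of "Suc 0"] x, of \<gamma> j j] by simp
        then show "(\<Sum>j\<in>UNIV. dunkl \<gamma> j (\<lambda>x. x $ j * b x) x) = theta b x + G x"
          unfolding G_def up.refl_op_def theta_def by (simp add: sum.distrib)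
      qed simp
      also have "\<dots> = up.ip b (theta b) + up.ip b G"
        by (rule up.L2.ip_add_right) (intro up.Cball_0_L2 thC GC bC)+
      finally show ?thesis .
    qed
    have "(\<Sum>j\<in>UNIV. up.ip (dunkl \<gamma> j b) (\<lambda>x. x $ j * b x))
        = 2 * (\<alpha> + 1) * (\<Sum>j\<in>UNIV. ip b (\<lambda>x. (x $ j)\<^sup>2 * b x)) - (\<Sum>j\<in>UNIV. up.ip b (dunkl \<gamma> j (\<lambda>x. x $ j * b x)))"
      unfolding adj by (simp add: sum_subtractf sum_distrib_left)
    then have main: "2 * (\<alpha> + 1) * ip b b = 2 * (\<alpha> + 1) * up.ip b b + 2 * up.ip b (theta b) + up.ip b G"
      unfolding s1 s2 s3 by (simp add: algebra_simps)
    define R where "R x = theta b x - (real n * b x + kappa b x)" for x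
    have R: "R \<in> polys_below n" unfolding R_def[abs_def] by (rule theta_remainder[OF b])
    have L: "b \<in> L2_space (\<alpha> + 1) \<gamma>" "kappa b \<in> L2_space (\<alpha> + 1) \<gamma>" "R \<in> L2_space (\<alpha> + 1) \<gamma>"
      using up.below_L2 b R refl_op_below[OF b] unfolding kappa_def by blast+
    have "theta b = (\<lambda>x. (real n * b x + kappa b x) + R x)"
      by (simp add: fun_eq_iff R_def)
    then have th: "up.ip b (theta b) = real n * up.ip b b + up.ip b (kappa b)"
      using up.L2.ip_add_right[OF up.L2.V_add[OF up.L2.V_scale[OF L(1)] L(2)] L(3) L(1)]
        up.L2.ip_add_right[OF up.L2.V_scale[OF L(1)] L(2) L(1)] up.L2.ip_scale_right[OF L(1) L(1)] orth[OF R]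
      by simp
    have "up.ip b (kappa b) \<le> c1 * up.ip b b"
      using up.ip_refl_op_le[OF bC, of "\<Sum>j\<in>UNIV. \<gamma> $ j / 2" "\<lambda>j. - (\<gamma> $ j / 2)"]
      unfolding kappa_def c1_def up.refl_op_def[abs_def] refl_op_def[abs_def] by linarith
    moreover have "up.ip b G \<le> c2 * up.ip b b"
      using up.ip_refl_op_le[OF bC, of "real CARD('n)" "\<lambda>j. \<gamma> $ j"] unfolding G_def c2_def by linarith
    ultimately have "2 * (\<alpha> + 1) * ip b b \<le> (2 * (\<alpha> + 1) + 2 * real n + 2 * c1 + c2) * up.ip b b"
      unfolding main th by (simp add: algebra_simps)
    also have "\<dots> \<le> ((2 * (\<alpha> + 1) + 2 + 2 * c1 + c2) * (real n + 1)) * up.ip b b"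
    proof (intro mult_right_mono up.L2.ip_nonneg)
      have "0 \<le> (2 * (\<alpha> + 1) + 2 * c1 + c2) * real n" using a c by (intro mult_nonneg_nonneg) auto
      then show "2 * (\<alpha> + 1) + 2 * real n + 2 * c1 + c2 \<le> (2 * (\<alpha> + 1) + 2 + 2 * c1 + c2) * (real n + 1)"
        by (simp add: algebra_simps)
    qed
    finally show ?thesis using a unfolding C_def by (simp add: field_simps)
  qed
  moreover have "C \<ge> 0" using a c unfolding C_def by simp
  ultimately show ?thesis by blast
qed


text \<open>
  Orthogonal decomposition by degree and Cauchy--Schwarz: the constant grows with the number \<open>n - m\<close>
  of degrees that occur.
\<close>

lemma polynomial_trace:
  "\<exists>C\<ge>0. \<forall>n m. \<forall>y\<in>polys_below n. m \<le> n \<longrightarrow> (\<forall>q\<in>polys_below m. L2_ip (\<alpha> + 1) \<gamma> y q = 0) \<longrightarrow>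
     ip y y \<le> C * real n * real (n - m) * L2_ip (\<alpha> + 1) \<gamma> y y"
proof -
  interpret up: ball_wt "\<alpha> + 1" \<gamma> by (rule next_weight)
  obtain C where C: "C \<ge> 0" and tr: "\<forall>n. \<forall>b\<in>polys_below (Suc n). (\<forall>q\<in>polys_below n. up.ip b q = 0) \<longrightarrow>
     ip b b \<le> C * (real n + 1) * up.ip b b"
    using orthogonal_polynomial_trace by (elim exE conjE) (rule that)
  have *: "ip y y \<le> C * real (m + k) * real k * up.ip y y"
    if "y \<in> polys_below (m + k)" "\<forall>q\<in>polys_below m. up.ip y q = 0" for m k y
    using that
  proof (induction k arbitrary: y)
    case 0
    then have "up.ip y y = 0" by simp
    then have "y = (\<lambda>_. 0)" using up.below_nrm_zero[OF 0(1)] by blast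
    then show ?case by (simp add: L2.ip_zero L2.V_zero)
  next
    case (Suc k)
    define n where "n = m + k"
    have y: "y \<in> polys_below (Suc n)" using Suc.prems(1) by (simp add: n_def)
    have yL: "y \<in> L2_space (\<alpha> + 1) \<gamma>" by (rule up.below_L2[OF y])
    define z where "z = up.proj n y"
    define t where "t = y - z"
    have z: "z \<in> polys_below n" unfolding z_def by (rule up.proj_props(1)[OF yL])
    have t: "t \<in> polys_below (Suc n)" unfolding t_def
      using y below_mono[OF _ z, of "Suc n"] by (intro below_fun_minus) auto
    have L: "t \<in> L2_space \<alpha> \<gamma>" "z \<in> L2_space \<alpha> \<gamma>" using below_L2 t z by blast+
    have torth: "\<forall>q\<in>polys_below n. up.ip t q = 0"
      unfolding t_def z_def using up.proj_props(2)[OF yL] by blast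
    have zorth: "\<forall>q\<in>polys_below m. up.ip z q = 0"
    proof
      fix q :: "real ^ 'n \<Rightarrow> real" assume q: "q \<in> polys_below m"
      have "q \<in> polys_below n" using below_mono[OF _ q, of n] by (simp add: n_def)
      then show "up.ip z q = 0" unfolding z_def using up.proj_ip[OF yL] Suc.prems(2) q by simp
    qed
    have T: "ip t t \<le> C * (real n + 1) * up.ip t t" using tr t torth by blast
    have Z: "ip z z \<le> C * real n * real k * up.ip z z"
      using Suc.IH[of z] z zorth by (simp add: n_def)
    have pyth: "up.ip y y = up.ip z z + up.ip t t"
      using up.proj_pythagoras[OF yL, of n] unfolding up.L2.nrm_sq z_def t_def .
    have "y = (\<lambda>x. t x + z x)" by (simp add: t_def fun_eq_iff)
    then have yy: "ip y y = ip t t + 2 * ip t z + ip z z" using L2.ip_sq_add[OF L] by simp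
    have cross: "2 * ip t z \<le> real k * ip t t + C * (real n + 1) * up.ip z z"
    proof (cases "k = 0")
      case True
      then have "up.ip z z = 0" using zorth z by (simp add: n_def)
      then have "z = (\<lambda>_. 0)" using up.below_nrm_zero[OF z] by blast
      then have "ip t z = 0" using L2.ip_zero_right[OF L(1)] by simp
      then show ?thesis using True C up.L2.ip_nonneg[of z] by simp
    next
      case False
      have "0 \<le> ip (\<lambda>x. real k * t x - z x) (\<lambda>x. real k * t x - z x)" by (rule L2.ip_nonneg)
      also have "(\<lambda>x. real k * t x - z x) = (\<lambda>x. real k * t x) - z" by (simp add: fun_eq_iff)
      also have "ip \<dots> \<dots> = (real k)\<^sup>2 * ip t t - 2 * real k * ip t z + ip z z"
        using L2.ip_sq_minus[OF L2.V_scale[OF L(1)] L(2), of "real k"] L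
        by (simp add: L2.ip_scale L2.ip_scale_right L2.V_scale power2_eq_square del: minus_apply)
      finally have "real k * (2 * ip t z) \<le> real k * (real k * ip t t) + ip z z"
        by (simp add: power2_eq_square algebra_simps)
      also have "ip z z \<le> real k * (C * (real n + 1) * up.ip z z)"
      proof -
        have "C * real n * real k * up.ip z z \<le> real k * (C * (real n + 1) * up.ip z z)"
          using C up.L2.ip_nonneg[of z] mult_nonneg_nonneg[of "C * real k" "up.ip z z"] by (simp add: algebra_simps)
        with Z show ?thesis by linarith
      qed
      finally have "real k * (2 * ip t z) \<le> real k * (real k * ip t t + C * (real n + 1) * up.ip z z)"
        by (simp add: algebra_simps)
      then show ?thesis using False by (simp add: mult_le_cancel_left_pos)
    qed
    have "real (Suc k) * ip t t \<le> real (Suc k) * (C * (real n + 1) * up.ip t t)"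
      using T by (intro mult_left_mono) auto
    moreover have "C * real n * real k * up.ip z z \<le> real k * (C * (real n + 1) * up.ip z z)"
      using C up.L2.ip_nonneg[of z] mult_nonneg_nonneg[of "C * real k" "up.ip z z"] by (simp add: algebra_simps)
    ultimately have "ip y y \<le> real (Suc k) * (C * (real n + 1) * up.ip t t) + real (Suc k) * (C * (real n + 1) * up.ip z z)"
      using cross Z unfolding yy by (simp add: algebra_simps)
    then show ?case unfolding pyth by (simp add: n_def algebra_simps)
  qed
  have "ip y y \<le> C * real n * real (n - m) * up.ip y y"
    if "y \<in> polys_below n" "m \<le> n" "\<forall>q\<in>polys_below m. up.ip y q = 0" for n m y
    using *[of y m "n - m"] that by simp
  then show ?thesis using C by blast
qed

text \<open>
  The inverse inequality: passing from the Dunkl gradient in the next weight, where it is controlled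
  by the energy, back to the original weight costs a second factor \<open>n\<close>.
\<close>

lemma inverse_inequality:
  "\<exists>C\<ge>0. \<forall>n. \<forall>p\<in>polys_below n. \<forall>j. nrm (dunkl \<gamma> j p) \<le> C * (real n)\<^sup>2 * nrm p"
proof -
  obtain A where A: "A \<ge> 0" and tr: "\<forall>n m. \<forall>y\<in>polys_below n. m \<le> n \<longrightarrow>
      (\<forall>q\<in>polys_below m. L2_ip (\<alpha> + 1) \<gamma> y q = 0) \<longrightarrow> ip y y \<le> A * real n * real (n - m) * L2_ip (\<alpha> + 1) \<gamma> y y"
    using polynomial_trace by (elim exE conjE) (rule that)
  obtain B where B: "B \<ge> 0" and en: "\<forall>n. \<forall>p\<in>polys_below n. energy p p \<le> B * (real n)\<^sup>2 * ip p p"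
    using energy_upper by (elim exE conjE) (rule that)
  interpret up: ball_wt "\<alpha> + 1" \<gamma> by (rule next_weight)
  have "nrm (dunkl \<gamma> j p) \<le> sqrt (A * B) * (real n)\<^sup>2 * nrm p" if p: "p \<in> polys_below n" for n p j
  proof (rule power2_le_imp_le)
    have D: "dunkl \<gamma> j p \<in> polys_below n" by (rule below_dunkl_same[OF p])
    have "\<forall>q\<in>polys_below 0. up.ip (dunkl \<gamma> j p) q = 0"
      using below_0 up.L2.ip_zero_right[OF up.below_L2[OF D]] by blast
    then have "ip (dunkl \<gamma> j p) (dunkl \<gamma> j p) \<le> A * real n * real (n - 0) * up.ip (dunkl \<gamma> j p) (dunkl \<gamma> j p)"
      using tr D by blast
    also have "up.ip (dunkl \<gamma> j p) (dunkl \<gamma> j p) \<le> (\<Sum>j\<in>UNIV. up.ip (dunkl \<gamma> j p) (dunkl \<gamma> j p))"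
      by (rule member_le_sum) (auto intro: up.L2.ip_nonneg)
    also have "\<dots> \<le> energy p p" by (rule energy_ge[OF below_Cball[OF p]])
    also have "energy p p \<le> B * (real n)\<^sup>2 * ip p p" using en p by blast
    finally have "ip (dunkl \<gamma> j p) (dunkl \<gamma> j p) \<le> A * real n * real (n - 0) * (B * (real n)\<^sup>2 * ip p p)"
      using A by (simp add: mult_left_mono)
    moreover have "(sqrt (A * B))\<^sup>2 = A * B" using A B by simp
    ultimately show "(nrm (dunkl \<gamma> j p))\<^sup>2 \<le> (sqrt (A * B) * (real n)\<^sup>2 * nrm p)\<^sup>2"
      unfolding power_mult_distrib L2.nrm_sq by (simp add: power2_eq_square mult_ac)
  qed (use A B in simp)
  then show ?thesis using A B by (intro exI[of _ "sqrt (A * B)"]) auto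
qed

lemma snrm_inverse_inequality:
  "\<exists>C\<ge>0. \<forall>n. \<forall>p\<in>polys_below (Suc n). snrm m p \<le> C * (real n + 1) ^ (2 * m) * nrm p"
proof (induction m)
  case 0
  show ?case by (rule exI[of _ 1]) (simp add: snrm_0)
next
  case (Suc m)
  then obtain A where A: "A \<ge> 0" "\<forall>n. \<forall>p\<in>polys_below (Suc n). snrm m p \<le> A * (real n + 1) ^ (2 * m) * nrm p"
    by blast
  obtain B where B: "B \<ge> 0" "\<forall>n. \<forall>p\<in>polys_below n. \<forall>j. nrm (dunkl \<gamma> j p) \<le> B * (real n)\<^sup>2 * nrm p"
    using inverse_inequality by blast
  have "snrm (Suc m) p \<le> (1 + real CARD('n) * (A * B)) * (real n + 1) ^ (2 * Suc m) * nrm p"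
    if p: "p \<in> polys_below (Suc n)" for n p
  proof -
    let ?X = "real n + 1"
    have "snrm m (dunkl \<gamma> j p) \<le> A * B * ?X ^ (2 * Suc m) * nrm p" for j
    proof -
      have D: "dunkl \<gamma> j p \<in> polys_below (Suc n)" by (rule below_dunkl_same[OF p])
      have 1: "nrm (dunkl \<gamma> j p) \<le> B * (real (Suc n))\<^sup>2 * nrm p" using B(2) p by blast
      have "snrm m (dunkl \<gamma> j p) \<le> A * ?X ^ (2 * m) * nrm (dunkl \<gamma> j p)" using A(2) D by blast
      also have "\<dots> \<le> A * ?X ^ (2 * m) * (B * (real (Suc n))\<^sup>2 * nrm p)"
        using A(1) by (intro mult_left_mono 1) auto
      finally show ?thesis by (simp add: power2_eq_square mult_ac add.commute)
    qed
    then have "snrm (Suc m) p \<le> nrm p + (\<Sum>j\<in>(UNIV :: 'n set). A * B * ?X ^ (2 * Suc m) * nrm p)"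
      by (intro snrm_Suc_le) auto
    moreover have "nrm p \<le> ?X ^ (2 * Suc m) * nrm p"
      using mult_right_mono[OF one_le_power[of ?X "2 * Suc m"] L2.nrm_nonneg[of p]] by simp
    ultimately show ?thesis by (simp add: algebra_simps)
  qed
  then show ?case using A(1) B(1) by (intro exI[of _ "1 + real CARD('n) * (A * B)"]) auto
qed

text \<open>
  A Dunkl operator intertwines the projections for consecutive weights, since its adjoint raises
  the degree by one.
\<close>

lemma dunkl_proj:
  assumes u: "u \<in> Cball (Suc 0)"
  shows "dunkl \<gamma> j (proj (Suc N) u) = ball_wt.proj (\<alpha> + 1) \<gamma> N (dunkl \<gamma> j u)"
proof -
  interpret up: ball_wt "\<alpha> + 1" \<gamma> by (rule next_weight)
  have uL: "u \<in> L2_space \<alpha> \<gamma>" by (rule Cball_0_L2[OF Cball_0[OF u]])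
  have p: "proj (Suc N) u \<in> polys_below (Suc N)" by (rule proj_props(1)[OF uL])
  have pC: "proj (Suc N) u \<in> Cball k" for k by (rule below_Cball[OF p])
  have w: "u - proj (Suc N) u \<in> Cball (Suc 0)" by (rule Cball_fun_minus[OF u pC])
  have "up.proj N (dunkl \<gamma> j u) = dunkl \<gamma> j (proj (Suc N) u)"
  proof (rule up.proj_unique)
    show "dunkl \<gamma> j u \<in> L2_space (\<alpha> + 1) \<gamma>" by (rule up.Cball_0_L2[OF dunkl_Cball[OF u]])
    show "dunkl \<gamma> j (proj (Suc N) u) \<in> polys_below N" by (rule below_dunkl[OF p])
    fix q :: "real ^ 'n \<Rightarrow> real" assume q: "q \<in> polys_below N"
    let ?q = "\<lambda>x. 2 * (\<alpha> + 1) * x $ j * q x - (1 - (norm x)\<^sup>2) * dunkl \<gamma> j q x"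
    have rho: "(\<lambda>x. (1 - (norm x)\<^sup>2) * dunkl \<gamma> j q x) \<in> polys_below (Suc N)"
    proof (cases N)
      case 0
      then have "q = (\<lambda>_. 0)" using q below_0 by blast
      then show ?thesis using below_zero by (simp add: dunkl_zero)
    next
      case (Suc k)
      then have "dunkl \<gamma> j q \<in> polys_below k" using q below_dunkl by blast
      then show ?thesis unfolding Suc by (rule below_rho_mult)
    qed
    have "(\<lambda>x. (2 * (\<alpha> + 1)) * (x $ j * q x) - (1 - (norm x)\<^sup>2) * dunkl \<gamma> j q x) \<in> polys_below (Suc N)"
      by (intro below_minus rho below_scale below_coord_mult q)
    then have qq: "?q \<in> polys_below (Suc N)" by (simp add: mult.assoc)
    have "up.ip (dunkl \<gamma> j u - dunkl \<gamma> j (proj (Suc N) u)) q = up.ip (dunkl \<gamma> j (u - proj (Suc N) u)) q"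
      by (rule L2_ip_cong) (simp_all only: dunkl_minus[OF u pC] minus_apply)
    also have "\<dots> = ip (u - proj (Suc N) u) ?q"
      using w by (intro dunkl_adjoint below_Cball[OF q]) simp
    also have "\<dots> = 0" by (rule proj_props(2)[OF uL qq])
    finally show "up.ip (dunkl \<gamma> j u - dunkl \<gamma> j (proj (Suc N) u)) q = 0" .
  qed
  then show ?thesis by simp
qed

text \<open>
  Since multiplication by \<open>1 - r\<^sup>2\<close> raises the degree by two, the projections for consecutive
  weights differ only in two degrees, on which the trace inequality costs the factor \<open>N\<^sup>1\<^sup>/\<^sup>2\<close>.
\<close>

lemma proj_next_weight:
  "\<exists>C\<ge>0. \<forall>q\<in>Cball 0. \<forall>N. nrm (ball_wt.proj (\<alpha> + 1) \<gamma> N q - proj (Suc N) q)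
     \<le> C * sqrt (real N + 1) * nrm (q - proj N q)"
proof -
  interpret up: ball_wt "\<alpha> + 1" \<gamma> by (rule next_weight)
  obtain A where A: "A \<ge> 0" and tr: "\<forall>n m. \<forall>y\<in>polys_below n. m \<le> n \<longrightarrow>
      (\<forall>q\<in>polys_below m. up.ip y q = 0) \<longrightarrow> ip y y \<le> A * real n * real (n - m) * up.ip y y"
    using polynomial_trace by (elim exE conjE) (rule that)
  have "nrm (up.proj N q - proj (Suc N) q) \<le> (sqrt (2 * A) + 1) * sqrt (real N + 1) * nrm (q - proj N q)"
    if q: "q \<in> Cball 0" for q N
  proof -
    have qL: "q \<in> L2_space \<alpha> \<gamma>" and qL': "q \<in> L2_space (\<alpha> + 1) \<gamma>"
      using q by (auto intro: Cball_0_L2 up.Cball_0_L2)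
    have p: "proj N q \<in> polys_below N" by (rule proj_props(1)[OF qL])
    define z where "z = q - proj N q"
    have zC: "z \<in> Cball 0" unfolding z_def by (rule Cball_fun_minus[OF q below_Cball[OF p]])
    have zL: "z \<in> L2_space \<alpha> \<gamma>" and zL': "z \<in> L2_space (\<alpha> + 1) \<gamma>"
      using zC by (auto intro: Cball_0_L2 up.Cball_0_L2)
    define y where "y = up.proj N z"
    have y: "y \<in> polys_below N" unfolding y_def by (rule up.proj_props(1)[OF zL'])
    have yL: "y \<in> L2_space \<alpha> \<gamma>" by (rule below_L2[OF y])
    have y_eq: "y = up.proj N q - proj N q"
      unfolding y_def z_def up.proj_minus[OF qL' up.below_L2[OF p]] up.proj_id[OF p] ..
    have s: "proj (Suc N) z = proj (Suc N) q - proj N q"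
      unfolding z_def proj_minus[OF qL below_L2[OF p]] using proj_id[OF below_mono[OF _ p, of "Suc N"]] by simp
    have "up.proj N q - proj (Suc N) q = y - proj (Suc N) z" unfolding y_eq s by (simp add: fun_eq_iff)
    then have "nrm (up.proj N q - proj (Suc N) q) \<le> nrm y + nrm (proj (Suc N) z)"
      using L2.nrm_minus_le[OF yL proj_L2[OF zL]] by simp
    moreover have "nrm (proj (Suc N) z) \<le> sqrt (real N + 1) * nrm z"
    proof -
      have "nrm (proj (Suc N) z) \<le> 1 * nrm z" using nrm_proj_le[OF zL] by simp
      also have "\<dots> \<le> sqrt (real N + 1) * nrm z" by (intro mult_right_mono) auto
      finally show ?thesis .
    qed
    moreover have "nrm y \<le> sqrt (2 * A) * sqrt (real N + 1) * nrm z"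
    proof (rule power2_le_imp_le)
      \<comment> \<open>The subtraction is truncated; for \<open>N < 2\<close> the orthogonality is void.\<close>
      have "\<forall>r\<in>polys_below (N - 2). up.ip y r = 0"
      proof
        fix r :: "real ^ 'n \<Rightarrow> real" assume r: "r \<in> polys_below (N - 2)"
        show "up.ip y r = 0"
        proof (cases "N < 2")
          case True
          then have "r = (\<lambda>_. 0)" using r below_0 by simp
          then show ?thesis using up.L2.ip_zero_right[OF up.below_L2[OF y]] by simp
        next
          case False
          then have N: "Suc (Suc (N - 2)) = N" by simp
          have "r \<in> polys_below N" by (rule below_mono[OF _ r]) simp
          then have "up.ip y r = up.ip z r" unfolding y_def by (rule up.proj_ip[OF zL'])
          also have "\<dots> = ip z (\<lambda>x. (1 - (norm x)\<^sup>2) * r x)"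
            by (rule ip_next_eq[OF zC below_Cball[OF r]])
          also have "\<dots> = 0" unfolding z_def
            using proj_props(2)[OF qL, of "\<lambda>x. (1 - (norm x)\<^sup>2) * r x" N] below_rho_mult[OF r] N by simp
          finally show ?thesis .
        qed
      qed
      then have "ip y y \<le> A * real N * real (N - (N - 2)) * up.ip y y" using tr y by simp
      also have "\<dots> \<le> A * (real N + 1) * 2 * ip z z"
      proof -
        have "up.ip y y \<le> up.ip z z"
          using up.proj_pythagoras[OF zL', of N] zero_le_power2[of "up.nrm (z - up.proj N z)"]
          unfolding up.L2.nrm_sq y_def by linarith
        also have "\<dots> \<le> ip z z" by (rule ip_next_le[OF zC])
        finally show ?thesis using A by (intro mult_mono up.L2.ip_nonneg) auto
      qed
      finally show "(nrm y)\<^sup>2 \<le> (sqrt (2 * A) * sqrt (real N + 1) * nrm z)\<^sup>2"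
        using A by (simp add: L2.nrm_sq power_mult_distrib mult_ac)
    qed (use A in simp)
    ultimately show ?thesis unfolding z_def[symmetric] by (simp add: algebra_simps)
  qed
  then show ?thesis using A by (intro exI[of _ "sqrt (2 * A) + 1"]) auto
qed

section \<open>The projection error in Dunkl--Sobolev norms\<close>

text \<open>
  Induction on the order \<open>r\<close> of the norm on the left, one Dunkl operator at a time.  The half power and
  the doubling of \<open>r\<close> enter through the polynomial \<open>y\<close> that compensates for the change of weight; order
  zero is not affected by this loss, whence the case distinction.
\<close>

theorem projection_error_sobolev:
  assumes "r \<le> l"
  shows "\<exists>C\<ge>0. \<forall>u\<in>Cball l. \<forall>N. snrm r (u - proj (Suc N) u)
     \<le> C * (real N + 1) powr ((if r = 0 then 0 else 2 * real r - 1 / 2) - real l) * snrm l u"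
  using assms
proof (induction r arbitrary: l)
  case 0
  obtain C where C: "C \<ge> 0" "\<forall>u\<in>Cball l. \<forall>N. (real N + 1) ^ l * nrm (u - proj N u) \<le> C * snrm l u"
    using projection_error_L2 by blast
  have "snrm 0 (u - proj (Suc N) u) \<le> C * (real N + 1) powr (0 - real l) * snrm l u" if u: "u \<in> Cball l" for u N
  proof -
    let ?X = "real N + 1"
    have X: "?X > 0" by simp
    have "?X ^ l * nrm (u - proj (Suc N) u) \<le> (real (Suc N) + 1) ^ l * nrm (u - proj (Suc N) u)"
      by (intro mult_right_mono power_mono) auto
    also have "\<dots> \<le> C * snrm l u" using C(2) u by blast
    finally have "nrm (u - proj (Suc N) u) \<le> C * snrm l u / ?X ^ l"
      using X by (simp add: field_simps del: minus_apply)
    then show ?thesis using X by (simp add: snrm_0 powr_minus powr_realpow divide_inverse mult_ac del: minus_apply)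
  qed
  then show ?case using C(1) by (intro exI[of _ C]) (simp del: minus_apply)
next
  case (Suc r)
  then obtain k where l: "l = Suc k" and rk: "r \<le> k" by (cases l) auto
  define e where "e = (if r = 0 then 0 else 2 * real r - 1 / 2)"
  define E where "E = 2 * real r + 1 / 2 - real k"
  interpret up: ball_wt "\<alpha> + 1" \<gamma> by (rule next_weight)
  obtain A where A: "A \<ge> 0" "\<forall>u\<in>Cball l. \<forall>N. (real N + 1) ^ l * nrm (u - proj N u) \<le> A * snrm l u"
    using projection_error_L2 by blast
  obtain A' where A': "A' \<ge> 0" "\<forall>u\<in>Cball k. \<forall>N. (real N + 1) ^ k * nrm (u - proj N u) \<le> A' * snrm k u"
    using projection_error_L2 by blast
  obtain B where B: "B \<ge> 0" "\<forall>u\<in>Cball k. \<forall>N. snrm r (u - proj (Suc N) u) \<le> B * (real N + 1) powr (e - real k) * snrm k u"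
    using Suc.IH[OF rk] unfolding e_def by blast
  obtain D where D: "D \<ge> 0" "\<forall>n. \<forall>p\<in>polys_below (Suc n). snrm r p \<le> D * (real n + 1) ^ (2 * r) * nrm p"
    using snrm_inverse_inequality by blast
  obtain G where G: "G \<ge> 0" "\<forall>q\<in>Cball 0. \<forall>N. nrm (up.proj N q - proj (Suc N) q) \<le> G * sqrt (real N + 1) * nrm (q - proj N q)"
    using proj_next_weight by blast
  define H where "H = B + D * G * A'"
  have H: "H \<ge> 0" using A' B D G by (simp add: H_def)
  have "snrm (Suc r) (u - proj (Suc N) u) \<le> (A + real CARD('n) * H) * (real N + 1) powr E * snrm l u"
    if u: "u \<in> Cball l" for u N
  proof -
    let ?X = "real N + 1"
    have X: "?X \<ge> 1" by simp
    have uk: "u \<in> Cball (Suc k)" using u l by simp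
    have u1: "u \<in> Cball (Suc 0)" by (rule Cball_mono[OF _ uk]) simp
    have uL: "u \<in> L2_space \<alpha> \<gamma>" by (rule Cball_0_L2[OF Cball_0[OF u]])
    have p: "proj (Suc N) u \<in> polys_below (Suc N)" by (rule proj_props(1)[OF uL])
    have pw: "?X ^ m = ?X powr real m" for m by (simp add: powr_realpow)
    have mean: "nrm (v - proj M v) \<le> c * ?X powr (- real m) * snrm m v"
      if "v \<in> Cball m" "M \<ge> N" "c \<ge> 0" "\<forall>u\<in>Cball m. \<forall>N. (real N + 1) ^ m * nrm (u - proj N u) \<le> c * snrm m u" for v M c m
    proof -
      have "?X ^ m * nrm (v - proj M v) \<le> (real M + 1) ^ m * nrm (v - proj M v)"
        using that(2) by (intro mult_right_mono power_mono) auto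
      also have "\<dots> \<le> c * snrm m v" using that by blast
      finally have "nrm (v - proj M v) \<le> c * snrm m v / ?X ^ m"
        using X by (simp add: field_simps del: minus_apply)
      then show ?thesis by (simp add: powr_minus pw divide_inverse mult_ac del: minus_apply)
    qed
    have "nrm (u - proj (Suc N) u) \<le> A * ?X powr (- real l) * snrm l u"
      by (rule mean[OF u _ A]) simp
    also have "\<dots> \<le> A * ?X powr E * snrm l u"
      using A(1) l by (intro mult_right_mono mult_left_mono powr_mono) (auto simp: E_def)
    finally have 0: "nrm (u - proj (Suc N) u) \<le> A * ?X powr E * snrm l u" .
    have "snrm r (dunkl \<gamma> j (u - proj (Suc N) u)) \<le> H * ?X powr E * snrm l u" for j
    proof -
      define q where "q = dunkl \<gamma> j u"
      have qC: "q \<in> Cball k" unfolding q_def by (rule dunkl_Cball[OF uk])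
      have q0: "q \<in> Cball 0" by (rule Cball_0[OF qC])
      have qL: "q \<in> L2_space \<alpha> \<gamma>" "q \<in> L2_space (\<alpha> + 1) \<gamma>" using q0 Cball_0_L2 up.Cball_0_L2 by blast+
      have qr: "q \<in> Cball r" by (rule Cball_mono[OF rk qC])
      have qn: "snrm k q \<le> snrm l u" unfolding q_def l by (rule snrm_dunkl_le)
      define y where "y = up.proj N q - proj (Suc N) q"
      have P: "up.proj N q \<in> polys_below (Suc N)" "proj (Suc N) q \<in> polys_below (Suc N)"
        using below_mono[OF _ up.proj_props(1)[OF qL(2)], of N "Suc N"] proj_props(1)[OF qL(1)] by auto
      have y: "y \<in> polys_below (Suc N)" unfolding y_def by (rule below_fun_minus[OF P])
      have "snrm r (dunkl \<gamma> j (u - proj (Suc N) u)) = snrm r ((q - proj (Suc N) q) - y)"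
      proof (rule snrm_cong)
        fix x :: "real ^ 'n" assume x: "x \<in> ball 0 1"
        show "dunkl \<gamma> j (u - proj (Suc N) u) x = ((q - proj (Suc N) q) - y) x"
          unfolding dunkl_minus[OF u1 below_Cball[OF p] x] dunkl_proj[OF u1] by (simp add: q_def y_def)
      qed
      also have "\<dots> \<le> snrm r (q - proj (Suc N) q) + snrm r y"
        by (intro S.nrm_minus_le Cball_fun_minus qr below_Cball[OF P(2)] below_Cball[OF y])
      also have "snrm r (q - proj (Suc N) q) \<le> B * ?X powr E * snrm l u"
      proof -
        have "snrm r (q - proj (Suc N) q) \<le> B * ?X powr (e - real k) * snrm k q" using B(2) qC by blast
        also have "\<dots> \<le> B * ?X powr E * snrm l u"
          using B(1) by (intro mult_mono mult_left_mono powr_mono qn) (auto simp: e_def E_def)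
        finally show ?thesis .
      qed
      also have "snrm r y \<le> D * G * A' * ?X powr E * snrm l u"
      proof -
        have "snrm r y \<le> D * ?X ^ (2 * r) * nrm y" using D(2) y by blast
        also have "\<dots> \<le> D * ?X ^ (2 * r) * (G * sqrt ?X * (A' * ?X powr (- real k) * snrm l u))"
        proof (rule mult_left_mono)
          have "nrm y \<le> G * sqrt ?X * nrm (q - proj N q)" unfolding y_def using G(2) q0 by blast
          also have "nrm (q - proj N q) \<le> A' * ?X powr (- real k) * snrm k q"
            by (rule mean[OF qC _ A']) simp
          also have "A' * ?X powr (- real k) * snrm k q \<le> A' * ?X powr (- real k) * snrm l u"
            using A'(1) by (intro mult_left_mono qn) auto
          finally show "nrm y \<le> G * sqrt ?X * (A' * ?X powr (- real k) * snrm l u)"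
            using G(1) by (simp add: mult_left_mono)
        qed (use D(1) in simp)
        also have "\<dots> = D * G * A' * (?X powr (2 * real r) * ?X powr (1 / 2) * ?X powr (- real k)) * snrm l u"
          by (simp add: pw powr_half_sqrt)
        also have "?X powr (2 * real r) * ?X powr (1 / 2) * ?X powr (- real k) = ?X powr E"
          by (simp add: E_def powr_add[symmetric])
        finally show ?thesis .
      qed
      finally show ?thesis by (simp add: H_def algebra_simps)
    qed
    then have "snrm (Suc r) (u - proj (Suc N) u) \<le> A * ?X powr E * snrm l u + (\<Sum>j\<in>(UNIV :: 'n set). H * ?X powr E * snrm l u)"
      using 0 A(1) by (intro snrm_Suc_le) auto
    then show ?thesis by (simp add: algebra_simps del: minus_apply)
  qed
  moreover have "(if Suc r = 0 then 0 else 2 * real (Suc r) - 1 / 2) - real l = E"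
    by (simp add: E_def l)
  ultimately show ?case using A(1) H by (intro exI[of _ "A + real CARD('n) * H"]) (auto simp del: minus_apply)
qed

end

section \<open>Passage to the completion\<close>

context ball_wt
begin

lemma cauchy_seqs_snrm_mono:
  assumes "r \<le> l" and U: "U \<in> cauchy_seqs (Cball l) (sobolev_ip \<alpha> \<gamma> l)"
  shows "U \<in> cauchy_seqs (Cball r) (sobolev_ip \<alpha> \<gamma> r)"
  unfolding cauchy_seqs_def
proof (intro CollectI conjI allI impI)
  show "U n \<in> Cball r" for n by (rule Cball_mono[OF assms(1) S.cauchy_seqs_V[OF U]])
  fix e :: real assume "e > 0"
  then obtain M where "\<forall>i\<ge>M. \<forall>k\<ge>M. snrm l (U i - U k) < e" using S.cauchy_seqsD[OF U] by blast
  then have "\<forall>i\<ge>M. \<forall>k\<ge>M. snrm r (U i - U k) < e" using snrm_mono[OF assms(1)] le_less_trans by blast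
  then show "\<exists>M. \<forall>i\<ge>M. \<forall>k\<ge>M. snrm r (U i - U k) < e" by blast
qed

lemma H_incl_class:
  assumes "r \<le> l" and U: "U \<in> cauchy_seqs (Cball l) (sobolev_ip \<alpha> \<gamma> l)"
  shows "H_incl \<alpha> \<gamma> r (null_rel (Cball l) (sobolev_ip \<alpha> \<gamma> l) `` {U}) = null_rel (Cball r) (sobolev_ip \<alpha> \<gamma> r) `` {U}"
proof -
  have "(U, W) \<in> null_rel (Cball r) (sobolev_ip \<alpha> \<gamma> r)" if "(U, W) \<in> null_rel (Cball l) (sobolev_ip \<alpha> \<gamma> l)" for W
  proof -
    have W: "W \<in> cauchy_seqs (Cball l) (sobolev_ip \<alpha> \<gamma> l)" and lim: "(\<lambda>n. snrm l (U n - W n)) \<longlonglongrightarrow> 0"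
      using that unfolding null_rel_def by blast+
    have "(\<lambda>n. snrm r (U n - W n)) \<longlonglongrightarrow> 0"
      by (rule LIMSEQ_zero_of_le[OF _ lim]) (simp only: abs_of_nonneg S.nrm_nonneg snrm_mono[OF assms(1)])
    then show ?thesis
      using cauchy_seqs_snrm_mono[OF assms(1)] U W unfolding null_rel_def by blast
  qed
  moreover have "(U, U) \<in> null_rel (Cball l) (sobolev_ip \<alpha> \<gamma> l)" by (rule S.null_rel_refl[OF U])
  ultimately show ?thesis unfolding H_incl_def using S.null_rel_trans by blast
qed

text \<open>Completeness of the weighted \<open>L\<^sup>2\<close> space makes the choice in the definition meaningful.\<close>

lemma L2_of_H0_limit:
  assumes U: "U \<in> cauchy_seqs (Cball 0) (sobolev_ip \<alpha> \<gamma> 0)"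
  defines "f \<equiv> L2_of_H0 \<alpha> \<gamma> (null_rel (Cball 0) (sobolev_ip \<alpha> \<gamma> 0) `` {U})"
  shows "f \<in> L2_space \<alpha> \<gamma>" "(\<lambda>n. nrm (U n - f)) \<longlonglongrightarrow> 0"
proof -
  let ?A = "null_rel (Cball 0) (sobolev_ip \<alpha> \<gamma> 0) `` {U}"
  have "U \<in> cauchy_seqs (L2_space \<alpha> \<gamma>) (L2_ip \<alpha> \<gamma>)"
    using U Cball_0_L2 unfolding cauchy_seqs_def snrm_0 by blast
  then obtain g where g: "g \<in> L2_space \<alpha> \<gamma>" "(\<lambda>n. nrm (U n - g)) \<longlonglongrightarrow> 0"
    using L2_complete by blast
  have "(\<lambda>n. nrm (W n - g)) \<longlonglongrightarrow> 0" if "W \<in> ?A" for W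
  proof -
    have W: "W \<in> cauchy_seqs (Cball 0) (sobolev_ip \<alpha> \<gamma> 0)" and lim: "(\<lambda>n. nrm (U n - W n)) \<longlonglongrightarrow> 0"
      using that unfolding null_rel_def snrm_0 by blast+
    have V: "U n \<in> L2_space \<alpha> \<gamma>" "W n \<in> L2_space \<alpha> \<gamma>" for n
      using S.cauchy_seqs_V[OF U] S.cauchy_seqs_V[OF W] Cball_0_L2 by blast+
    have "(\<lambda>n. nrm (U n - W n) + nrm (U n - g)) \<longlonglongrightarrow> 0 + 0" by (rule tendsto_add[OF lim g(2)])
    then have lim2: "(\<lambda>n. nrm (U n - W n) + nrm (U n - g)) \<longlonglongrightarrow> 0" by simp
    have "nrm (W n - g) \<le> nrm (U n - W n) + nrm (U n - g)" for n
      using L2.nrm_minus_triangle[OF V(2) V(1) g(1)] L2.nrm_minus_commute[OF V(2) V(1)] by metis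
    then show ?thesis
      by (intro LIMSEQ_zero_of_le[OF _ lim2]) (simp only: abs_of_nonneg L2.nrm_nonneg)
  qed
  then have "\<exists>f. f \<in> L2_space \<alpha> \<gamma> \<and> (\<forall>W\<in>?A. (\<lambda>n. nrm (W n - f)) \<longlonglongrightarrow> 0)" using g by blast
  from someI_ex[OF this] have f: "f \<in> L2_space \<alpha> \<gamma> \<and> (\<forall>W\<in>?A. (\<lambda>n. nrm (W n - f)) \<longlonglongrightarrow> 0)"
    unfolding f_def L2_of_H0_def .
  then show "f \<in> L2_space \<alpha> \<gamma>" by blast
  have "U \<in> ?A" using S.null_rel_refl[OF U] by blast
  then show "(\<lambda>n. nrm (U n - f)) \<longlonglongrightarrow> 0" using f by blast
qed

end

theorem theorem1p1:
  fixes \<alpha> :: real and \<gamma> :: "real ^ 'n" and r l :: nat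
  assumes "1 \<le> r" and "r \<le> l"
    and "\<alpha> > -1" and "\<And>i. \<gamma> $ i > -1"
  shows "\<exists>C>0. \<forall>N\<ge>1. \<forall>u\<in>H_space \<alpha> \<gamma> l.
           H_norm \<alpha> \<gamma> r (H_minus \<alpha> \<gamma> r (H_incl \<alpha> \<gamma> r u) (H_embed \<alpha> \<gamma> r (H_proj \<alpha> \<gamma> N u)))
             \<le> C * real N powr (- 1 / 2 + 2 * real r - real l) * H_norm \<alpha> \<gamma> l u"
proof -
  interpret ball_wt \<alpha> \<gamma> by unfold_locales (use assms in auto)
  define e where "e = - 1 / 2 + 2 * real r - real l"
  have "(if r = 0 then 0 else 2 * real r - 1 / 2) - real l = e" using assms(1) by (simp add: e_def)
  then obtain A where A: "A \<ge> 0"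
    "\<forall>u\<in>Cball l. \<forall>N. snrm r (u - proj (Suc N) u) \<le> A * (real N + 1) powr e * snrm l u"
    using projection_error_sobolev[OF assms(2)] by auto
  obtain D where D: "D \<ge> 0" "\<forall>n. \<forall>p\<in>polys_below (Suc n). snrm r p \<le> D * (real n + 1) ^ (2 * r) * nrm p"
    using snrm_inverse_inequality by blast
  \<comment> \<open>The projection onto degrees at most \<open>N\<close> is \<open>proj (Suc N)\<close>; its error is estimated in terms of \<open>N + 1\<close>.\<close>
  define C where "C = A * max 1 (2 powr e) + 1"
  have C: "C > 0" using A(1) by (simp add: C_def add_nonneg_pos)
  have "H_norm \<alpha> \<gamma> r (H_minus \<alpha> \<gamma> r (H_incl \<alpha> \<gamma> r u) (H_embed \<alpha> \<gamma> r (H_proj \<alpha> \<gamma> N u)))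
      \<le> C * real N powr e * H_norm \<alpha> \<gamma> l u"
    if N: "N \<ge> 1" and u: "u \<in> H_space \<alpha> \<gamma> l" for N u
  proof -
    obtain U where U: "U \<in> cauchy_seqs (Cball l) (sobolev_ip \<alpha> \<gamma> l)"
      and u_eq: "u = null_rel (Cball l) (sobolev_ip \<alpha> \<gamma> l) `` {U}"
      using u unfolding H_space_def by (rule S.completion_cases)
    have Ur: "U \<in> cauchy_seqs (Cball r) (sobolev_ip \<alpha> \<gamma> r)" and U0: "U \<in> cauchy_seqs (Cball 0) (sobolev_ip \<alpha> \<gamma> 0)"
      using cauchy_seqs_snrm_mono[OF _ U] assms(2) by auto
    have UV: "U n \<in> Cball l" for n by (rule S.cauchy_seqs_V[OF U])
    have UL: "U n \<in> L2_space \<alpha> \<gamma>" for n by (rule Cball_0_L2[OF Cball_0[OF UV]])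
    define f where "f = L2_of_H0 \<alpha> \<gamma> (null_rel (Cball 0) (sobolev_ip \<alpha> \<gamma> 0) `` {U})"
    have f: "f \<in> L2_space \<alpha> \<gamma>" "(\<lambda>n. nrm (U n - f)) \<longlonglongrightarrow> 0"
      unfolding f_def by (rule L2_of_H0_limit[OF U0])+
    define p where "p = proj (Suc N) f"
    have p: "p \<in> polys_below (Suc N)" unfolding p_def by (rule proj_props(1)[OF f(1)])
    have Hp: "H_proj \<alpha> \<gamma> N u = p"
      unfolding H_proj_def poly_proj_eq u_eq H_incl_class[OF le0 U] p_def f_def ..
    have pcon: "(\<lambda>_. p) \<in> cauchy_seqs (Cball r) (sobolev_ip \<alpha> \<gamma> r)" by (rule S.const_cauchy[OF below_Cball[OF p]])
    have diff: "H_minus \<alpha> \<gamma> r (H_incl \<alpha> \<gamma> r u) (H_embed \<alpha> \<gamma> r (H_proj \<alpha> \<gamma> N u))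
        = null_rel (Cball r) (sobolev_ip \<alpha> \<gamma> r) `` {\<lambda>n. U n - p}"
      unfolding Hp unfolding H_minus_def H_embed_def completion_embed_def u_eq H_incl_class[OF assms(2) U]
      by (rule S.completion_minus_class[OF Ur pcon])
    have lim1: "(\<lambda>n. snrm r (U n - p)) \<longlonglongrightarrow>
        H_norm \<alpha> \<gamma> r (H_minus \<alpha> \<gamma> r (H_incl \<alpha> \<gamma> r u) (H_embed \<alpha> \<gamma> r (H_proj \<alpha> \<gamma> N u)))"
      unfolding diff H_norm_def by (rule S.nrm_class_limit[OF S.minus_cauchy[OF Ur pcon]])
    have lim2: "(\<lambda>n. snrm l (U n)) \<longlonglongrightarrow> H_norm \<alpha> \<gamma> l u"
      unfolding u_eq H_norm_def by (rule S.nrm_class_limit[OF U])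
    have "(\<lambda>n. A * (real N + 1) powr e * snrm l (U n) + D * (real N + 1) ^ (2 * r) * nrm (U n - f))
        \<longlonglongrightarrow> A * (real N + 1) powr e * H_norm \<alpha> \<gamma> l u + D * (real N + 1) ^ (2 * r) * 0"
      by (intro tendsto_intros lim2 f(2))
    moreover have "snrm r (U n - p) \<le> A * (real N + 1) powr e * snrm l (U n) + D * (real N + 1) ^ (2 * r) * nrm (U n - f)" for n
    proof -
      define q where "q = proj (Suc N) (U n)"
      have q: "q \<in> polys_below (Suc N)" unfolding q_def by (rule proj_props(1)[OF UL])
      have Unr: "U n \<in> Cball r" by (rule Cball_mono[OF assms(2) UV])
      have "snrm r (U n - p) \<le> snrm r (U n - q) + snrm r (q - p)"
        by (rule S.nrm_minus_triangle[OF Unr below_Cball[OF q] below_Cball[OF p]])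
      moreover have "snrm r (U n - q) \<le> A * (real N + 1) powr e * snrm l (U n)"
        unfolding q_def using A(2) UV by blast
      moreover have "snrm r (q - p) \<le> D * (real N + 1) ^ (2 * r) * nrm (U n - f)"
      proof -
        have "snrm r (q - p) \<le> D * (real N + 1) ^ (2 * r) * nrm (q - p)"
          using D(2) below_fun_minus[OF q p] by blast
        also have "\<dots> \<le> D * (real N + 1) ^ (2 * r) * nrm (U n - f)"
        proof (rule mult_left_mono)
          have "q - p = proj (Suc N) (U n - f)"
            unfolding q_def p_def by (rule proj_minus[OF UL f(1), symmetric])
          then show "nrm (q - p) \<le> nrm (U n - f)"
            using nrm_proj_le[OF L2.V_minus[OF UL f(1)]] by simp
        qed (use D(1) in simp)
        finally show ?thesis .
      qed
      ultimately show ?thesis by linarith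
    qed
    ultimately have "H_norm \<alpha> \<gamma> r (H_minus \<alpha> \<gamma> r (H_incl \<alpha> \<gamma> r u) (H_embed \<alpha> \<gamma> r (H_proj \<alpha> \<gamma> N u)))
        \<le> A * (real N + 1) powr e * H_norm \<alpha> \<gamma> l u + D * (real N + 1) ^ (2 * r) * 0"
      by (intro LIMSEQ_le[OF lim1]) blast+
    also have "\<dots> = A * (real N + 1) powr e * H_norm \<alpha> \<gamma> l u" by simp
    also have "\<dots> \<le> C * real N powr e * H_norm \<alpha> \<gamma> l u"
    proof (rule mult_right_mono)
      show "H_norm \<alpha> \<gamma> l u \<ge> 0" using lim2 by (rule LIMSEQ_le_const) auto
      have "(real N + 1) powr e \<le> max 1 (2 powr e) * real N powr e"
      proof (cases "e \<ge> 0")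
        case True
        have "(real N + 1) powr e \<le> (2 * real N) powr e" using N True by (intro powr_mono2) auto
        also have "\<dots> = 2 powr e * real N powr e" by (rule powr_mult)
        also have "\<dots> \<le> max 1 (2 powr e) * real N powr e" by (intro mult_right_mono) auto
        finally show ?thesis .
      next
        case False
        have "(real N + 1) powr e \<le> 1 * real N powr e" using N False by (simp add: powr_mono2')
        also have "\<dots> \<le> max 1 (2 powr e) * real N powr e" by (intro mult_right_mono) auto
        finally show ?thesis .
      qed
      then have "A * (real N + 1) powr e \<le> A * (max 1 (2 powr e) * real N powr e)"
        using A(1) by (rule mult_left_mono)
      also have "\<dots> \<le> C * real N powr e" by (simp add: C_def algebra_simps)
      finally show "A * (real N + 1) powr e \<le> C * real N powr e" .
    qed
    finally show ?thesis .
  qed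
  then show ?thesis using C unfolding e_def by blast
qed

end
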